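(* Fix $\gamma_0\ge1$. There exist a constant $C<\infty$ depending only on $\gamma_0$ and an absolute constant $\bar C<\infty$ such that the following holds. Let $n,d$ be positive integers with $1\le d\le n^{\gamma_0}$, let $S_n^d=\sum_{\ell=1}^d P_n^\ell$ where $P_n^\ell(i,j)=\mathbf 1(\pi_n^\ell(i)=j)$ for independent uniformly random permutations $\pi_n^1,\dots,\pi_n^d$ of $[n]$, and let $Z_n$ be a deterministic complex $n\times n$ matrix such that $\|Z_n\|_{\langle\mathbf 1\rangle^\perp}\le n^{\gamma_0}$ and $Z_n\mathbf 1=\zeta\mathbf 1$, $Z_n^*\mathbf 1=\bar\zeta\mathbf 1$ for some $\zeta\in\mathbb C$. Then $$\mathbb P\Big\{ s_n(S_n^d+Z_n)< n^{-\bar C\gamma_0\log_{d\wedge n}n}\wedge|d+\zeta|\Big\}\le C\,\frac{\log^4n}{\sqrt{d\wedge n}}.$$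
   Context: $\mathbf 1\in\mathbb C^n$ is the all-ones vector, $\langle\mathbf 1\rangle^\perp$ its orthogonal complement in $\mathbb C^n$, and for an $n\times n$ matrix $M$, $\|M\|_{\langle\mathbf 1\rangle^\perp}=\sup\{\|Mu\|_2: u\in\mathbb C^n,\ \|u\|_2=1,\ u\perp\mathbf 1\}$. $s_n(\cdot)$ denotes the smallest singular value, $a\wedge b=\min(a,b)$. *)

theory Defs
  imports "HOL-Probability.Probability" "Jordan_Normal_Form.Schur_Decomposition"
begin

definition vnorm2 :: "complex vec \<Rightarrow> real" where
  "vnorm2 v = sqrt (\<Sum>i<dim_vec v. (cmod (v $ i))\<^sup>2)"

text \<open>Smallest singular value of an n x n complex matrix, via its variational
  characterisation s_n(M) = min over unit vectors u of the norm of M u.\<close>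
definition smallest_sv :: "complex mat \<Rightarrow> real" where
  "smallest_sv M = Inf {vnorm2 (M *\<^sub>v u) | u. u \<in> carrier_vec (dim_col M) \<and> vnorm2 u = 1}"

text \<open>Operator norm restricted to the orthogonal complement of the all-ones vector
  (supremum over unit u with u orthogonal to 1, i.e. sum of the entries of u is 0;
  the supremum of the empty set is taken to be 0).\<close>
definition norm_perp1 :: "complex mat \<Rightarrow> real" where
  "norm_perp1 M = Sup (insert 0 {vnorm2 (M *\<^sub>v u) | u.
       u \<in> carrier_vec (dim_col M) \<and> vnorm2 u = 1 \<and> (\<Sum>i<dim_col M. u $ i) = 0})"

definition perm_tuples :: "nat \<Rightarrow> nat \<Rightarrow> (nat \<Rightarrow> nat \<Rightarrow> nat) set" where
  "perm_tuples n d = PiE {..<d} (\<lambda>_. {p. p permutes {..<n}})"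

definition perm_tuple_pmf :: "nat \<Rightarrow> nat \<Rightarrow> (nat \<Rightarrow> nat \<Rightarrow> nat) pmf" where
  "perm_tuple_pmf n d = pmf_of_set (perm_tuples n d)"

definition perm_mat :: "nat \<Rightarrow> (nat \<Rightarrow> nat) \<Rightarrow> complex mat" where
  "perm_mat n p = mat n n (\<lambda>(i,j). if p i = j then 1 else 0)"

definition S_mat :: "nat \<Rightarrow> nat \<Rightarrow> (nat \<Rightarrow> nat \<Rightarrow> nat) \<Rightarrow> complex mat" where
  "S_mat n d \<pi> = mat n n (\<lambda>(i,j). \<Sum>l<d. perm_mat n (\<pi> l) $$ (i,j))"

definition ones_vec :: "nat \<Rightarrow> complex vec" where
  "ones_vec n = vec n (\<lambda>_. 1)"

end

theory Submission
  imports Defs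
begin

text \<open>
  Put \<open>\<kappa> = d + \<zeta>\<close> and let \<open>T = S + Z - (\<kappa>/n) J\<close>, \<open>J\<close> the all-ones matrix. Then \<open>T\<close> kills constants on both
  sides and agrees with \<open>S + Z\<close> on mean-zero vectors, so a small singular value yields mean-zero unit
  vectors \<open>u\<close>, \<open>w\<close> with \<open>T u\<close> and \<open>w\<^sup>T T\<close> tiny. Let \<open>N = min d n\<close>; only the first \<open>N\<close> permutations are
  used as a source of randomness.

  First, \<open>u\<close> and \<open>w\<close> have no dominant value: for every constant \<open>z\<close>, order the entries of \<open>u - z\<close> by modulus. If
  between positions \<open>m\<close> and \<open>m' \<approx> m \<surd>N\<close> (or, at the last step, \<open>m' \<approx> n / ln n\<close>) they drop by a factor
  \<open>n^(-8\<gamma>)\<close>, then \<open>T\<close> almost kills an \<open>m'\<close>-sparse vector with \<open>m\<close> large entries. For a fixed such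
  vector, independently exchanging, in each permutation, large entries with zero entries shows that this has
  probability \<open>2^(-c min(m N, n))\<close>, which beats the entropy \<open>m' \<gamma> ln n\<close> of a net. There are
  \<open>O(log_N n)\<close> steps, so for every \<open>z\<close> some \<open>n / (C ln n)\<close> entries of \<open>u\<close> are at distance
  \<open>\<ge> \<rho> = n^(-C \<gamma> log_N n)\<close> from \<open>z\<close>, and the same holds for \<open>w\<close>.

  Second, for each permutation many pairs of rows \<open>a, b\<close> separate both \<open>w\<close> and \<open>u \<circ> \<pi>\<close>. For such a pair,
  exchanging the images of \<open>a\<close> and \<open>b\<close> in each permutation independently, the equation \<open>w\<^sup>T T u \<approx> 0\<close> forces
  a signed sum of many numbers of modulus \<open>\<ge> \<rho>\<close> into a small disc. The Littlewood-Offord inequality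
  bounds the probability by \<open>O(polylog n / \<surd>N)\<close>; averaging over the pairs concludes.
\<close>

section \<open>Averaging and random permutations\<close>

text \<open>The near-null vectors depend on the permutations, so they cannot be fixed in advance,
  and a net of all of C^n has about exp(c n ln n) points, more than the exponent n available for a
  fixed vector can pay for. Hence the split: nets only for vectors with O(n / ln n) sizeable
  entries, and for spread vectors a polynomial bound obtained without any net. The support grows by
  about sqrt N per step because the gain min(m N, n) must beat m' ln n: with m' = m sqrt N this asks
  that sqrt N exceed a multiple of ln n, which holds whenever the claimed bound is below 1. The same
  sqrt N exceeds the number of steps, which pays for the few entries of size up to n^(8 \<gamma> k)
  inherited from earlier steps. The term |d + \<zeta>| in the threshold is the size of the matrix on
  constants; it prevents a small singular value from being caused by the constant component. As
  \<zeta> is not controlled, only the centred matrix has bounded entries. The logarithms come from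
  n/m of order ln n: two factors from averaging over pairs of rows, one from the number of
  Littlewood-Offord coefficients.\<close>

lemma card_le_by_averaging:
  fixes \<Phi> :: "'k \<Rightarrow> 'a \<Rightarrow> 'a" and p :: real
  assumes fin: "finite \<Omega>" "finite K" and ne: "K \<noteq> {}"
    and maps: "\<And>k. k \<in> K \<Longrightarrow> bij_betw (\<Phi> k) \<Omega> \<Omega>"
    and sub: "E \<subseteq> \<Omega>" "D \<subseteq> \<Omega>" and p: "0 \<le> p"
    and fibre: "\<And>\<omega>. \<omega> \<in> \<Omega> - D \<Longrightarrow> real (card {k\<in>K. \<Phi> k \<omega> \<in> E}) \<le> p * real (card K)"
  shows "real (card E) \<le> p * real (card \<Omega>) + real (card D)"
proof -
  have finD: "finite D" using sub fin finite_subset by blast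
  have 1: "card {\<omega>\<in>\<Omega>. \<Phi> k \<omega> \<in> E} = card E" if "k \<in> K" for k
  proof -
    have "bij_betw (\<Phi> k) {\<omega>\<in>\<Omega>. \<Phi> k \<omega> \<in> E} E"
      using maps[OF that] sub(1) unfolding bij_betw_def inj_on_def by auto
    then show ?thesis by (rule bij_betw_same_card)
  qed
  \<comment> \<open>Each \<open>\<Phi> k\<close> preserves the uniform measure, so applying a random
    \<open>k\<close> first does not change the probability of \<open>E\<close>. It then suffices to
    bound the share of good \<open>k\<close> for each fixed \<open>\<omega>\<close> outside
    \<open>D\<close>; on \<open>D\<close> the trivial share 1 is used.\<close>
  have "card K * card E = (\<Sum>k\<in>K. card {\<omega>\<in>\<Omega>. \<Phi> k \<omega> \<in> E})"
    using 1 by simp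
  also have "\<dots> = (\<Sum>\<omega>\<in>\<Omega>. card {k\<in>K. \<Phi> k \<omega> \<in> E})"
    by (rule sum_multicount_gen) (auto simp: fin)
  finally have eq: "real (card K) * real (card E) = (\<Sum>\<omega>\<in>\<Omega>. real (card {k\<in>K. \<Phi> k \<omega> \<in> E}))"
    unfolding of_nat_mult[symmetric] of_nat_sum[symmetric] by (rule arg_cong)
  have "(\<Sum>\<omega>\<in>\<Omega>. real (card {k\<in>K. \<Phi> k \<omega> \<in> E}))
      = (\<Sum>\<omega>\<in>\<Omega> - D. real (card {k\<in>K. \<Phi> k \<omega> \<in> E})) + (\<Sum>\<omega>\<in>D. real (card {k\<in>K. \<Phi> k \<omega> \<in> E}))"
    by (rule sum.subset_diff[OF sub(2) fin(1)])
  also have "\<dots> \<le> (\<Sum>\<omega>\<in>\<Omega> - D. p * real (card K)) + (\<Sum>\<omega>\<in>D. real (card K))"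
    by (intro add_mono sum_mono fibre) (auto intro!: card_mono fin)
  also have "\<dots> \<le> (\<Sum>\<omega>\<in>\<Omega>. p * real (card K)) + (\<Sum>\<omega>\<in>D. real (card K))"
    by (rule add_right_mono, rule sum_mono2) (use fin p in auto)
  also have "\<dots> = real (card K) * (p * real (card \<Omega>) + real (card D))"
    by (simp add: algebra_simps)
  finally have "real (card K) * real (card E) \<le> real (card K) * (p * real (card \<Omega>) + real (card D))"
    using eq by simp
  moreover have "real (card K) > 0" using ne fin by (simp add: card_gt_0_iff)
  ultimately show ?thesis by simp
qed

text \<open>The count for \<open>insert j J\<close> is the same for every new value
  \<open>j\<close>, by composing with a transposition. Summing over the \<open>n - card J\<close>
  new values counts, for each permutation good for \<open>J\<close>, the images of \<open>T\<close>
  outside \<open>J\<close>, and there are \<open>card T - card J\<close> of them.\<close>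

lemma card_permutations_preimage_insert:
  assumes J: "J \<subseteq> {..<n}" and T: "T \<subseteq> {..<n}" and j: "j < n" "j \<notin> J"
  shows "(n - card J) * card {\<sigma>. \<sigma> permutes {..<n} \<and> (\<forall>i<n. \<sigma> i \<in> insert j J \<longrightarrow> i \<in> T)}
       = card {\<sigma>. \<sigma> permutes {..<n} \<and> (\<forall>i<n. \<sigma> i \<in> J \<longrightarrow> i \<in> T)} * (card T - card J)"
proof -
  let ?A = "\<lambda>J. {\<sigma>. \<sigma> permutes {..<n} \<and> (\<forall>i<n. \<sigma> i \<in> J \<longrightarrow> i \<in> T)}"
  have fin: "finite (?A X)" for X
    by (rule finite_subset[OF _ finite_permutations[of "{..<n}"]]) auto
  let ?R = "{..<n} - J"
  have finT: "finite T" and finJ: "finite J" using T J finite_subset by blast+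
  have j: "j \<in> ?R" using j by auto
  have sym: "card (?A (insert j' J)) = card (?A (insert j J))" if j': "j' \<in> ?R" for j'
  proof -
    let ?f = "\<lambda>\<sigma>. Transposition.transpose j j' \<circ> \<sigma>"
    have tr: "Transposition.transpose j j' permutes {..<n}"
      using j j' by (intro permutes_swap_id) auto
    have inv: "?f (?f \<sigma>) = \<sigma>" for \<sigma> by (simp add: fun_eq_iff)
    have m: "Transposition.transpose j j' x \<in> insert j' J \<longleftrightarrow> x \<in> insert j J" for x
      using j j' by (auto simp: Transposition.transpose_def)
    have m': "Transposition.transpose j j' x \<in> insert j J \<longleftrightarrow> x \<in> insert j' J" for x
      using j j' by (auto simp: Transposition.transpose_def)
    have "bij_betw ?f (?A (insert j J)) (?A (insert j' J))"
    proof (rule bij_betw_byWitness[where f' = ?f])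
      show "?f ` ?A (insert j J) \<subseteq> ?A (insert j' J)"
        using permutes_compose[OF _ tr] by (simp add: image_subset_iff m del: insert_iff)
      show "?f ` ?A (insert j' J) \<subseteq> ?A (insert j J)"
        using permutes_compose[OF _ tr] by (simp add: image_subset_iff m' del: insert_iff)
    qed (simp_all only: inv simp_thms ball_triv)
    then show ?thesis by (simp add: bij_betw_same_card)
  qed
  have cJ: "card J \<le> n" using J by (metis card_lessThan card_mono finite_lessThan)
  have cR: "card ?R = n - card J" using J finJ by (subst card_Diff_subset) auto
  have "(n - card J) * card (?A (insert j J)) = (\<Sum>j'\<in>?R. card (?A (insert j' J)))"
    using sym cR by simp
  also have "\<dots> = (\<Sum>j'\<in>?R. card {\<sigma>\<in>?A J. \<forall>i<n. \<sigma> i = j' \<longrightarrow> i \<in> T})"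
    by (intro sum.cong arg_cong[where f = card]) auto
  also have "\<dots> = (\<Sum>\<sigma>\<in>?A J. card {j'\<in>?R. \<forall>i<n. \<sigma> i = j' \<longrightarrow> i \<in> T})"
    by (rule sum_multicount_gen) (use fin in auto)
  also have "\<dots> = (\<Sum>\<sigma>\<in>?A J. card T - card J)"
  proof (rule sum.cong)
    fix \<sigma> assume s: "\<sigma> \<in> ?A J"
    then have p: "\<sigma> permutes {..<n}" by auto
    have "{j'\<in>?R. \<forall>i<n. \<sigma> i = j' \<longrightarrow> i \<in> T} = \<sigma> ` T - J"
    proof (intro Set.set_eqI iffI)
      fix x assume x: "x \<in> {j'\<in>?R. \<forall>i<n. \<sigma> i = j' \<longrightarrow> i \<in> T}"
      then have "x \<in> \<sigma> ` {..<n}" using permutes_image[OF p] by auto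
      then show "x \<in> \<sigma> ` T - J" using x by auto
    next
      fix x assume x: "x \<in> \<sigma> ` T - J"
      then obtain i where i: "i \<in> T" "x = \<sigma> i" by auto
      have "\<sigma> i \<in> {..<n}" using permutes_in_image[OF p, of i] i T by blast
      then show "x \<in> {j'\<in>?R. \<forall>i<n. \<sigma> i = j' \<longrightarrow> i \<in> T}"
        using x i injD[OF permutes_inj[OF p]] by auto
    qed
    moreover have "J \<subseteq> \<sigma> ` T"
    proof
      fix x assume x: "x \<in> J"
      then have "x \<in> \<sigma> ` {..<n}" using permutes_image[OF p] J by auto
      then show "x \<in> \<sigma> ` T" using s x by auto
    qed
    moreover have "card (\<sigma> ` T) = card T"
      by (rule card_image) (use permutes_inj_on[OF p] in blast)
    ultimately show "card {j'\<in>?R. \<forall>i<n. \<sigma> i = j' \<longrightarrow> i \<in> T} = card T - card J"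
      using finJ finT by (simp add: card_Diff_subset)
  qed simp
  finally show ?thesis by simp
qed

lemma card_insert_less_imp_card_less:
  assumes "insert j J \<subseteq> {..<n}" "j \<notin> J"
  shows "card J < n"
proof -
  have "finite J" using assms finite_subset by auto
  then have "Suc (card J) \<le> card {..<n}" using assms card_mono[OF finite_lessThan assms(1)] by simp
  then show ?thesis by simp
qed

text \<open>With k values already placed, one more multiplies the fraction by (|T| - k)/(n - k),
  which is at most |T|/n.\<close>

lemma card_permutations_preimage_subset:
  assumes "J \<subseteq> {..<n}" "T \<subseteq> {..<n}"
  shows "card {\<sigma>. \<sigma> permutes {..<n} \<and> (\<forall>i<n. \<sigma> i \<in> J \<longrightarrow> i \<in> T)} * n ^ card J
           \<le> card T ^ card J * fact n"
proof -
  have "finite J" using assms finite_subset by blast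
  then show ?thesis using assms(1)
  proof (induction J rule: finite_induct)
    case empty
    then show ?case by (simp add: card_permutations)
  next
    case (insert j J)
    let ?A = "\<lambda>J. {\<sigma>. \<sigma> permutes {..<n} \<and> (\<forall>i<n. \<sigma> i \<in> J \<longrightarrow> i \<in> T)}"
    have eq: "(n - card J) * card (?A (insert j J)) = card (?A J) * (card T - card J)"
      using insert by (intro card_permutations_preimage_insert assms) auto
    have lt: "card J < n" using card_insert_less_imp_card_less insert by blast
    have cT: "card T \<le> n" using card_mono[OF finite_lessThan assms(2)] by simp
    have le: "n * (card T - card J) \<le> card T * (n - card J)"
    proof -
      have "card T * card J \<le> n * card J" using cT by simp
      then show ?thesis unfolding diff_mult_distrib2 by (simp add: mult.commute diff_le_mono2)
    qed
    have "(n - card J) * (card (?A (insert j J)) * n ^ Suc (card J))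
        = (card (?A J) * n ^ card J) * (n * (card T - card J))"
      unfolding mult.assoc[symmetric] eq by (simp only: power_Suc ac_simps)
    also have "\<dots> \<le> (card T ^ card J * fact n) * (card T * (n - card J))"
      by (rule mult_le_mono[OF insert.IH le]) (use insert.prems in simp)
    also have "\<dots> = (n - card J) * (card T ^ Suc (card J) * fact n)" by (simp only: power_Suc ac_simps)
    finally show ?case using lt insert by simp
  qed
qed

text \<open>The exact form serves the LYM argument, where \<open>card T = card J\<close> and the
  binomial on the right is 1.\<close>

lemma card_permutations_preimage_subset_eq:
  assumes "J \<subseteq> {..<n}" "T \<subseteq> {..<n}"
  shows "card {\<sigma>. \<sigma> permutes {..<n} \<and> (\<forall>i<n. \<sigma> i \<in> J \<longrightarrow> i \<in> T)} * (n choose card J)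
           = (card T choose card J) * fact n"
proof -
  have "finite J" using assms finite_subset by blast
  then show ?thesis using assms(1)
  proof (induction J rule: finite_induct)
    case empty
    then show ?case by (simp add: card_permutations)
  next
    case (insert j J)
    let ?A = "\<lambda>J. {\<sigma>. \<sigma> permutes {..<n} \<and> (\<forall>i<n. \<sigma> i \<in> J \<longrightarrow> i \<in> T)}"
    let ?m = "card J"
    have eq: "(n - ?m) * card (?A (insert j J)) = card (?A J) * (card T - ?m)"
      using insert by (intro card_permutations_preimage_insert assms) auto
    have lt: "?m < n" using card_insert_less_imp_card_less insert by blast
    have IH: "card (?A J) * (n choose ?m) = (card T choose ?m) * fact n"
      using insert by blast
    have bin: "Suc k * (N choose Suc k) = (N - k) * (N choose k)" for N k :: nat
      by (metis binomial_absorb_comp binomial_absorption)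
    have "(n - ?m) * (Suc ?m * (card (?A (insert j J)) * (n choose Suc ?m)))
        = ((n - ?m) * card (?A (insert j J))) * (Suc ?m * (n choose Suc ?m))" by (simp only: ac_simps)
    also have "\<dots> = (card (?A J) * (n choose ?m)) * ((card T - ?m) * (n - ?m))"
      unfolding eq bin by (simp only: ac_simps)
    also have "\<dots> = (n - ?m) * (((card T - ?m) * (card T choose ?m)) * fact n)"
      unfolding IH by (simp only: ac_simps)
    also have "\<dots> = (n - ?m) * (Suc ?m * ((card T choose Suc ?m) * fact n))"
      unfolding bin[symmetric] by (simp only: ac_simps)
    finally show ?case using lt insert by (simp del: mult_Suc)
  qed
qed

section \<open>Uniform tuples of permutations\<close>

lemma finite_perm_tuples: "finite (perm_tuples n d)"
  unfolding perm_tuples_def by (intro finite_PiE finite_permutations) auto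

lemma card_perm_tuples: "card (perm_tuples n d) = fact n ^ d"
  unfolding perm_tuples_def by (simp add: card_PiE card_permutations)

lemma card_perm_tuples_pos: "card (perm_tuples n d) > 0"
  by (simp add: card_perm_tuples)

lemma perm_tuplesD: "\<pi> \<in> perm_tuples n d \<Longrightarrow> l < d \<Longrightarrow> \<pi> l permutes {..<n}"
  unfolding perm_tuples_def by (auto dest!: PiE_mem[where x = l])

lemma card_perm_tuples_preimage_subset:
  assumes J: "J \<subseteq> {..<n}" and T: "T \<subseteq> {..<n}" and n: "n > 0" and d: "d' \<le> d"
  shows "real (card {\<pi>\<in>perm_tuples n d. \<forall>l<d'. \<forall>i<n. \<pi> l i \<in> J \<longrightarrow> i \<in> T})
         \<le> (real (card T) / real n) ^ (card J * d') * real (card (perm_tuples n d))"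
proof -
  let ?F = "{\<sigma>. \<sigma> permutes {..<n} \<and> (\<forall>i<n. \<sigma> i \<in> J \<longrightarrow> i \<in> T)}"
  let ?P = "\<lambda>l. if l < d' then ?F else {\<sigma>. \<sigma> permutes {..<n}}"
  have finF: "finite ?F"
    by (rule finite_subset[OF _ finite_permutations[of "{..<n}"]]) auto
  have "{\<pi>\<in>perm_tuples n d. \<forall>l<d'. \<forall>i<n. \<pi> l i \<in> J \<longrightarrow> i \<in> T} \<subseteq> PiE {..<d} ?P"
    unfolding perm_tuples_def by (auto simp: PiE_iff extensional_def)
  then have "card {\<pi>\<in>perm_tuples n d. \<forall>l<d'. \<forall>i<n. \<pi> l i \<in> J \<longrightarrow> i \<in> T} \<le> card (PiE {..<d} ?P)"
    by (rule card_mono[rotated]) (use finF in \<open>auto intro!: finite_PiE finite_permutations\<close>)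
  also have "\<dots> = (\<Prod>l<d. card (?P l))" by (simp add: card_PiE)
  also have "\<dots> = (\<Prod>l<d'. card (?P l)) * (\<Prod>l\<in>{d'..<d}. card (?P l))"
    using d by (subst prod.union_disjoint[symmetric]) (auto intro!: prod.cong)
  also have "\<dots> = card ?F ^ d' * fact n ^ (d - d')"
    by (simp add: card_permutations)
  finally have 1: "real (card {\<pi>\<in>perm_tuples n d. \<forall>l<d'. \<forall>i<n. \<pi> l i \<in> J \<longrightarrow> i \<in> T})
      \<le> real (card ?F) ^ d' * fact n ^ (d - d')"
    by (metis (no_types, lifting) of_nat_fact of_nat_le_iff of_nat_mult of_nat_power)
  have "real (card ?F * n ^ card J) \<le> real (card T ^ card J * fact n)"
    using card_permutations_preimage_subset[OF J T] of_nat_le_iff by blast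
  then have "real (card ?F) \<le> (real (card T) / real n) ^ card J * fact n"
    using n by (simp add: field_simps power_divide)
  then have "real (card ?F) ^ d' \<le> ((real (card T) / real n) ^ card J * fact n) ^ d'"
    by (intro power_mono) auto
  then have "real (card ?F) ^ d' * fact n ^ (d - d')
      \<le> ((real (card T) / real n) ^ card J * fact n) ^ d' * fact n ^ (d - d')"
    by (intro mult_right_mono) auto
  also have "\<dots> = (real (card T) / real n) ^ (card J * d') * fact n ^ d"
    using d by (simp add: power_mult_distrib power_mult[symmetric] mult.assoc power_add[symmetric])
  finally show ?thesis using 1 by (simp add: card_perm_tuples)
qed

section \<open>Small images of a fixed sparse vector\<close>

text \<open>\<open>X\<close> selects, by one of its ends, each pair of the involution
  \<open>F\<close> that is to be exchanged. Testing \<open>F v\<close> as well moves both ends,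
  which makes the map an involution.\<close>

definition col_swap :: "(nat \<Rightarrow> nat) \<Rightarrow> nat set \<Rightarrow> nat \<Rightarrow> nat" where
  "col_swap F X v = (if v \<in> X \<or> F v \<in> X then F v else v)"

definition swap_cols :: "(nat \<Rightarrow> nat) \<Rightarrow> nat \<Rightarrow> (nat \<times> nat) set \<Rightarrow> (nat \<Rightarrow> nat \<Rightarrow> nat) \<Rightarrow> nat \<Rightarrow> nat \<Rightarrow> nat" where
  "swap_cols F d' \<xi> \<pi> = (\<lambda>l. if l < d' then col_swap F {j. (l, j) \<in> \<xi>} \<circ> \<pi> l else \<pi> l)"

lemma col_swap_involution:
  assumes "\<And>v. F (F v) = v"
  shows "col_swap F X (col_swap F X v) = v"
  using assms by (simp add: col_swap_def)

lemma col_swap_permutes: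
  assumes F: "\<And>v. F (F v) = v" "\<And>v. v \<ge> n \<Longrightarrow> F v = v"
  shows "col_swap F X permutes {..<n}"
proof (rule bij_imp_permutes)
  have "F v < n" if "v < n" for v
    using F that by (metis leI not_less)
  then have "col_swap F X v \<in> {..<n}" if "v \<in> {..<n}" for v
    using that by (auto simp: col_swap_def)
  then show "bij_betw (col_swap F X) {..<n} {..<n}"
    by (intro bij_betw_byWitness[where f' = "col_swap F X"])
       (auto simp: col_swap_involution[OF F(1)])
  show "col_swap F X v = v" if "v \<notin> {..<n}" for v
    using that F(2) by (simp add: col_swap_def)
qed

lemma swap_cols_bij:
  assumes F: "\<And>v. F (F v) = v" "\<And>v. v \<ge> n \<Longrightarrow> F v = v" and d: "d' \<le> d"
  shows "bij_betw (swap_cols F d' \<xi>) (perm_tuples n d) (perm_tuples n d)"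
proof -
  have inv: "swap_cols F d' \<xi> (swap_cols F d' \<xi> \<pi>) = \<pi>" for \<pi>
    by (auto simp: swap_cols_def fun_eq_iff col_swap_involution[OF F(1)])
  have mem: "swap_cols F d' \<xi> \<pi> \<in> perm_tuples n d" if "\<pi> \<in> perm_tuples n d" for \<pi>
  proof -
    have "swap_cols F d' \<xi> \<pi> l permutes {..<n}" if "l < d" for l
      using perm_tuplesD[OF \<open>\<pi> \<in> _\<close> that] col_swap_permutes[of F n] F
      by (auto simp: swap_cols_def intro: permutes_compose)
    moreover have "swap_cols F d' \<xi> \<pi> l = undefined" if "l \<ge> d" for l
      using that d \<open>\<pi> \<in> _\<close> by (auto simp: swap_cols_def perm_tuples_def PiE_iff extensional_def)
    ultimately show ?thesis by (auto simp: perm_tuples_def PiE_iff extensional_def)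
  qed
  show ?thesis
    by (rule bij_betw_byWitness[where f' = "swap_cols F d' \<xi>"]) (use inv mem in auto)
qed

text \<open>The pairs \<open>(l, j)\<close> are the edges of a multigraph on the rows: edge \<open>(l, j)\<close> joins the two rows that
  \<open>\<pi> l\<close> sends to \<open>j\<close> and \<open>F j\<close>, and its orientation \<open>(l, j) \<in> \<xi>\<close> decides which of them receives \<open>y j\<close>. Orientations
  of the edges that are the first (in \<open>l\<close>) to touch some row are determined by the remaining ones.\<close>

lemma card_swap_solutions:
  fixes y c :: "nat \<Rightarrow> complex"
  assumes F: "\<And>v. F (F v) = v" "\<And>j. j \<in> J \<Longrightarrow> F j \<notin> J"
    and J: "J \<subseteq> {..<n}"
    and y: "\<And>j. j \<in> J \<Longrightarrow> cmod (y j) \<ge> 1/2" "\<And>j. j \<in> J \<Longrightarrow> y (F j) = 0"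
    and pi: "\<pi> \<in> perm_tuples n d" and d: "d' \<le> d"
    and cover: "2 * h \<le> card {i. i < n \<and> (\<exists>l<d'. \<pi> l i \<in> J)}"
  shows "real (card {\<xi>\<in>Pow ({..<d'} \<times> J).
            \<forall>i<n. cmod ((\<Sum>l<d. y (swap_cols F d' \<xi> \<pi> l i)) + c i) < 1/4})
         \<le> (1/2) ^ h * real (card (Pow ({..<d'} \<times> J)))"
proof -
  let ?E = "{..<d'} \<times> J"
  define t where "t \<xi> l i = y (swap_cols F d' \<xi> \<pi> l i)" for \<xi> l i
  define Sol where "Sol = {\<xi>\<in>Pow ?E. \<forall>i<n. cmod ((\<Sum>l<d. t \<xi> l i) + c i) < 1/4}"
  define touch where "touch l i \<longleftrightarrow> l < d' \<and> (\<pi> l i \<in> J \<or> F (\<pi> l i) \<in> J)" for l i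
  define ev where "ev l i = (if \<pi> l i \<in> J then \<pi> l i else F (\<pi> l i))" for l i
  define L where "L i = (LEAST l. touch l i)" for i
  define V where "V = {i. i < n \<and> (\<exists>l<d'. \<pi> l i \<in> J)}"
  define W where "W = (\<lambda>i. (L i, ev (L i) i)) ` V"
  have finJ: "finite J" using J finite_subset by blast
  have finE: "finite ?E" using finJ by auto
  have finV: "finite V" by (auto simp: V_def)
  have finW: "finite W" using finV by (auto simp: W_def)
  have touchL: "touch (L i) i" if "i \<in> V" for i
    unfolding L_def by (rule LeastI_ex) (use that in \<open>auto simp: V_def touch_def\<close>)
  have W_E: "W \<subseteq> ?E" using touchL by (fastforce simp: W_def touch_def ev_def)
  \<comment> \<open>An edge joins only two rows, so the rows of \<open>V\<close>, at least
    \<open>2 * h\<close> many, need at least \<open>h\<close> distinct first edges.\<close>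
  have "V \<subseteq> (\<Union>e\<in>W. {i. i < n \<and> \<pi> (fst e) i \<in> {snd e, F (snd e)}})"
  proof
    fix i assume i: "i \<in> V"
    have "\<pi> (L i) i \<in> {ev (L i) i, F (ev (L i) i)}" using F(1) by (auto simp: ev_def)
    then show "i \<in> (\<Union>e\<in>W. {i. i < n \<and> \<pi> (fst e) i \<in> {snd e, F (snd e)}})"
      using i by (force simp: W_def V_def)
  qed
  then have "card V \<le> card (\<Union>e\<in>W. {i. i < n \<and> \<pi> (fst e) i \<in> {snd e, F (snd e)}})"
    by (rule card_mono[rotated]) (use finW in auto)
  also have "\<dots> \<le> (\<Sum>e\<in>W. card {i. i < n \<and> \<pi> (fst e) i \<in> {snd e, F (snd e)}})"
    by (rule card_UN_le[OF finW])
  also have "\<dots> \<le> (\<Sum>e\<in>W. 2)"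
  proof (rule sum_mono)
    fix e assume "e \<in> W"
    then have "fst e < d" using W_E d by auto
    then have "inj (\<pi> (fst e))" using perm_tuplesD[OF pi] permutes_inj by blast
    then have "card {i. i < n \<and> \<pi> (fst e) i \<in> {snd e, F (snd e)}} \<le> card {snd e, F (snd e)}"
      by (intro card_inj_on_le[of "\<pi> (fst e)"]) (auto intro: inj_on_subset)
    also have "\<dots> \<le> 2" by (simp add: card_insert_if)
    finally show "card {i. i < n \<and> \<pi> (fst e) i \<in> {snd e, F (snd e)}} \<le> 2" .
  qed
  finally have hW: "h \<le> card W" using cover by (simp add: V_def)
  have inj: "inj_on (\<lambda>\<xi>. \<xi> - W) Sol"
  proof (rule inj_onI, rule ccontr)
    fix \<xi> \<xi>' assume s: "\<xi> \<in> Sol" "\<xi>' \<in> Sol" and eq: "\<xi> - W = \<xi>' - W" and ne: "\<xi> \<noteq> \<xi>'"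
    have sub: "\<xi> \<subseteq> ?E" "\<xi>' \<subseteq> ?E" using s by (auto simp: Sol_def)
    define D where "D = (\<xi> - \<xi>') \<union> (\<xi>' - \<xi>)"
    have finD: "finite D" by (rule finite_subset[OF _ finE]) (use sub in \<open>auto simp: D_def\<close>)
    have neD: "D \<noteq> {}" using ne by (auto simp: D_def)
    \<comment> \<open>At the highest level where two solutions disagree, the disagreeing edge lies
      in \<open>W\<close>, so it is the first edge at some row \<open>i\<close>. Lower levels do not
      touch row \<open>i\<close> and higher levels agree, so the values at row \<open>i\<close>
      differ by exactly \<open>y j\<close>, of modulus at least 1/2, although both are below
      1/4.\<close>
    define l where "l = Max (fst ` D)"
    have "l \<in> fst ` D" unfolding l_def using finD neD by (intro Max_in) auto
    then obtain j where lj: "(l, j) \<in> D" by auto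
    have "(l, j) \<in> W" using lj eq by (auto simp: D_def)
    then obtain i where i: "i \<in> V" "l = L i" "j = ev l i" by (auto simp: W_def)
    have tl: "touch l i" using touchL[OF i(1)] i by simp
    have ld: "l < d'" "l < d" using tl d by (auto simp: touch_def)
    have same: "t \<xi> l' i = t \<xi>' l' i" if l': "l' < d" "l' \<noteq> l" for l'
    proof (cases "l' < d'")
      case False
      then show ?thesis by (simp add: t_def swap_cols_def)
    next
      case True
      show ?thesis
      proof (cases "l' < l")
        case True
        then have "\<not> touch l' i" using i not_less_Least unfolding L_def by blast
        then show ?thesis using \<open>l' < d'\<close> sub by (auto simp: touch_def t_def swap_cols_def col_swap_def)
      next
        case False
        have "(l', x) \<notin> D" for x
        proof
          assume "(l', x) \<in> D"
          then have "l' \<in> fst ` D" by force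
          then have "l' \<le> l" unfolding l_def using finD by (intro Max_ge) auto
          then show False using False l' by simp
        qed
        then have "{x. (l', x) \<in> \<xi>} = {x. (l', x) \<in> \<xi>'}" by (auto simp: D_def)
        then show ?thesis using \<open>l' < d'\<close> by (simp add: t_def swap_cols_def)
      qed
    qed
    have jJ: "j \<in> J" using tl i by (auto simp: touch_def ev_def)
    have val: "t \<zeta> l i = (if \<pi> l i \<in> J then (if (l, j) \<in> \<zeta> then 0 else y j)
                         else (if (l, j) \<in> \<zeta> then y j else 0))" if "\<zeta> \<subseteq> ?E" for \<zeta>
    proof (cases "\<pi> l i \<in> J")
      case True
      then have j: "\<pi> l i = j" using i by (simp add: ev_def)
      have X: "{x. (l, x) \<in> \<zeta>} \<subseteq> J" using that by auto
      then have "col_swap F {x. (l, x) \<in> \<zeta>} j = (if (l, j) \<in> \<zeta> then F j else j)"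
        using F(2)[OF jJ] by (auto simp: col_swap_def)
      then show ?thesis using True j ld y(2)[OF jJ] by (simp add: t_def swap_cols_def)
    next
      case False
      then have j: "\<pi> l i = F j" using i F(1)[of "\<pi> l i"] by (simp add: ev_def)
      have X: "{x. (l, x) \<in> \<zeta>} \<subseteq> J" using that by auto
      then have "col_swap F {x. (l, x) \<in> \<zeta>} (F j) = (if (l, j) \<in> \<zeta> then j else F j)"
        using F(2)[OF jJ] by (auto simp: col_swap_def F(1))
      then show ?thesis using False j ld y(2)[OF jJ] by (simp add: t_def swap_cols_def)
    qed
    have "(l, j) \<in> \<xi> \<longleftrightarrow> (l, j) \<notin> \<xi>'" using lj by (auto simp: D_def)
    then have dif: "cmod (t \<xi> l i - t \<xi>' l i) = cmod (y j)"
      using val[OF sub(1)] val[OF sub(2)] by auto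
    have "(\<Sum>l<d. t \<xi> l i) - (\<Sum>l<d. t \<xi>' l i) = (\<Sum>l<d. t \<xi> l i - t \<xi>' l i)"
      by (simp add: sum_subtractf)
    also have "\<dots> = (\<Sum>l'\<in>{l}. t \<xi> l' i - t \<xi>' l' i)"
      by (rule sum.mono_neutral_right) (use ld same in auto)
    finally have "cmod (((\<Sum>l<d. t \<xi> l i) + c i) - ((\<Sum>l<d. t \<xi>' l i) + c i)) = cmod (y j)"
      using dif by simp
    moreover have "cmod (((\<Sum>l<d. t \<xi> l i) + c i) - ((\<Sum>l<d. t \<xi>' l i) + c i))
        \<le> cmod ((\<Sum>l<d. t \<xi> l i) + c i) + cmod ((\<Sum>l<d. t \<xi>' l i) + c i)"
      by (rule norm_triangle_ineq4)
    moreover have "cmod ((\<Sum>l<d. t \<xi> l i) + c i) < 1/4" "cmod ((\<Sum>l<d. t \<xi>' l i) + c i) < 1/4"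
      using s i(1) by (auto simp: Sol_def V_def)
    ultimately show False using y(1)[OF jJ] by linarith
  qed
  have "card Sol \<le> card (Pow (?E - W))"
    by (rule card_inj_on_le[OF inj]) (use finE in \<open>auto simp: Sol_def\<close>)
  also have "\<dots> = 2 ^ (card ?E - card W)"
    using finE finW W_E by (simp add: card_Pow card_Diff_subset)
  finally have "real (card Sol) \<le> 2 ^ (card ?E - card W)"
    by (metis of_nat_le_iff of_nat_numeral of_nat_power)
  also have "\<dots> \<le> (2::real) ^ (card ?E - h)" using hW by (intro power_increasing) auto
  also have "\<dots> = (1/2) ^ h * 2 ^ card ?E"
    using hW card_mono[OF finE W_E] by (simp add: power_diff power_one_over field_simps)
  finally show ?thesis using finE unfolding Sol_def t_def by (simp add: card_Pow)
qed

text \<open>A single term of the exponential series at \<open>r\<close>, with e at most 3.\<close>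

lemma power_self_le_fact: "real r ^ r \<le> 3 ^ r * fact r"
proof -
  have "(\<Sum>n\<in>{r}. real r ^ n /\<^sub>R fact n) \<le> (\<Sum>n. real r ^ n /\<^sub>R fact n)"
    by (rule sum_le_suminf) (use summable_exp[of "real r"] in \<open>auto simp: mult.commute\<close>)
  then have "real r ^ r / fact r \<le> exp (real r)"
    by (simp add: exp_def divide_inverse mult.commute)
  also have "exp (real r) = exp 1 ^ r" by (simp flip: exp_of_nat_mult)
  also have "\<dots> \<le> 3 ^ r" by (intro power_mono exp_le) auto
  finally show ?thesis by (simp add: field_simps)
qed

text \<open>Prepared for a union bound over \<open>r\<close>-sets of rows. Of the power
  \<open>2 * r\<close>, one half cancels \<open>n ^ r\<close> and leaves
  \<open>r ^ r / fact r \<le> 3 ^ r\<close>; the other half is at most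
  \<open>(1/6) ^ r\<close>.\<close>

lemma binomial_times_power_le:
  assumes "2 * r \<le> M" "6 * r \<le> n" "n > 0"
  shows "real (n choose r) * (real r / real n) ^ M \<le> (1/2) ^ r"
proof -
  have rn: "real r / real n \<le> 1" using assms by (simp add: field_simps)
  have "real (n choose r) * (real r / real n) ^ M \<le> real (n choose r) * (real r / real n) ^ (r + r)"
    using assms rn by (intro mult_left_mono power_decreasing) auto
  also have "\<dots> \<le> (real n ^ r / fact r) * (real r / real n) ^ (r + r)"
  proof (rule mult_right_mono)
    have "real ((n choose r) * fact r) \<le> real (n ^ r)"
      using binomial_fact_pow of_nat_le_iff by blast
    then show "real (n choose r) \<le> real n ^ r / fact r" by (simp add: field_simps)
  qed auto
  also have "\<dots> = (real r ^ r / fact r) * (real r / real n) ^ r"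
    using assms by (simp add: power_add power_divide field_simps)
  also have "\<dots> \<le> 3 ^ r * (real r / real n) ^ r"
    using power_self_le_fact[of r] by (intro mult_right_mono) (auto simp: field_simps)
  also have "\<dots> = (3 * (real r / real n)) ^ r" by (simp only: power_mult_distrib)
  also have "\<dots> \<le> (1/2) ^ r" using assms by (intro power_mono) (auto simp: field_simps)
  finally show ?thesis .
qed

text \<open>Pairing the large entries with equally many zeros creates the orientations. Either at
  least \<open>2 * h\<close> rows receive a large entry, and then a share of at most
  \<open>(1/2) ^ h\<close> of the orientations is good; or all large entries land in some set of
  \<open>2 * h\<close> rows, which is rare by a union bound over such sets. The two cases give the
  factor 2.\<close>

lemma card_small_image_fixed_vector:
  fixes y c :: "nat \<Rightarrow> complex"
  assumes J: "J \<subseteq> {..<n}" and Z: "Z \<subseteq> {..<n}" and cZ: "card Z = card J"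
    and yJ: "\<And>j. j \<in> J \<Longrightarrow> cmod (y j) \<ge> 1/2" and yZ: "\<And>j. j \<in> Z \<Longrightarrow> y j = 0"
    and d: "d' \<le> d" and n: "n > 0" and h: "4 * h \<le> card J * d'" "12 * h \<le> n"
  shows "real (card {\<pi>\<in>perm_tuples n d. \<forall>i<n. cmod ((\<Sum>l<d. y (\<pi> l i)) + c i) < 1/4})
         \<le> 2 * (1/2) ^ h * real (card (perm_tuples n d))"
proof -
  have finJ: "finite J" "finite Z" using J Z finite_subset by blast+
  have disj: "J \<inter> Z = {}" using yJ yZ by fastforce
  obtain f where f: "bij_betw f J Z" using finJ cZ by (metis finite_same_card_bij)
  define F where "F v = (if v \<in> J then f v else if v \<in> Z then inv_into J f v else v)" for v
  have fJ: "f v \<in> Z" if "v \<in> J" for v using f that by (auto simp: bij_betw_def)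
  have gZ: "inv_into J f v \<in> J" "f (inv_into J f v) = v" if "v \<in> Z" for v
    using f that by (auto simp: bij_betw_def inv_into_into f_inv_into_f)
  have fg: "inv_into J f (f v) = v" if "v \<in> J" for v
    using f that by (auto simp: bij_betw_def)
  have FF: "F (F v) = v" for v
    using fJ[of v] gZ[of v] fg[of v] disj by (auto simp: F_def)
  have Fn: "F v = v" if "v \<ge> n" for v using that J Z by (auto simp: F_def)
  have FJ: "F j \<notin> J" if "j \<in> J" for j using that fJ disj by (auto simp: F_def)
  have yF: "y (F j) = 0" if "j \<in> J" for j using that fJ yZ by (auto simp: F_def)
  let ?\<Omega> = "perm_tuples n d"
  define D where "D = {\<pi>\<in>?\<Omega>. \<not> 2 * h \<le> card {i. i < n \<and> (\<exists>l<d'. \<pi> l i \<in> J)}}"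
  let ?E = "{\<pi>\<in>?\<Omega>. \<forall>i<n. cmod ((\<Sum>l<d. y (\<pi> l i)) + c i) < 1/4}"
  have "real (card ?E) \<le> (1/2)^h * real (card ?\<Omega>) + real (card D)"
  proof (rule card_le_by_averaging[where K = "Pow ({..<d'} \<times> J)" and \<Phi> = "swap_cols F d'"])
    show "bij_betw (swap_cols F d' k) ?\<Omega> ?\<Omega>" for k by (rule swap_cols_bij[OF FF Fn d])
    fix \<pi> assume p: "\<pi> \<in> ?\<Omega> - D"
    then have mem: "swap_cols F d' k \<pi> \<in> ?\<Omega>" for k
      using swap_cols_bij[OF FF Fn d, where \<xi> = k] by (auto simp: bij_betw_def)
    have "real (card {\<xi>\<in>Pow ({..<d'} \<times> J).
            \<forall>i<n. cmod ((\<Sum>l<d. y (swap_cols F d' \<xi> \<pi> l i)) + c i) < 1/4})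
         \<le> (1/2) ^ h * real (card (Pow ({..<d'} \<times> J)))"
      by (rule card_swap_solutions[where F = F and J = J]) (use p FF FJ J yJ yF d in \<open>auto simp: D_def\<close>)
    then show "real (card {k \<in> Pow ({..<d'} \<times> J). swap_cols F d' k \<pi> \<in> ?E})
        \<le> (1/2) ^ h * real (card (Pow ({..<d'} \<times> J)))"
      using mem by simp
  qed (use finJ finite_perm_tuples in \<open>auto simp: D_def\<close>)
  moreover have "real (card D) \<le> (1/2)^h * real (card ?\<Omega>)"
  proof -
    let ?A = "\<lambda>T. {\<pi>\<in>?\<Omega>. \<forall>l<d'. \<forall>i<n. \<pi> l i \<in> J \<longrightarrow> i \<in> T}"
    let ?TT = "{T. T \<subseteq> {..<n} \<and> card T = 2 * h}"
    have finT: "finite ?TT" by simp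
    have "D \<subseteq> (\<Union>T\<in>?TT. ?A T)"
    proof
      fix \<pi> assume p: "\<pi> \<in> D"
      let ?V = "{i. i < n \<and> (\<exists>l<d'. \<pi> l i \<in> J)}"
      have "card ?V \<le> 2 * h" "2 * h \<le> card {..<n}" "?V \<subseteq> {..<n}" using p h by (auto simp: D_def)
      then obtain T where "?V \<subseteq> T" "T \<subseteq> {..<n}" "card T = 2 * h"
        using exists_subset_between[of ?V "2 * h" "{..<n}"] by auto
      then show "\<pi> \<in> (\<Union>T\<in>?TT. ?A T)" using p by (auto simp: D_def)
    qed
    then have "card D \<le> card (\<Union>T\<in>?TT. ?A T)"
      by (rule card_mono[rotated]) (use finT finite_perm_tuples in auto)
    also have "\<dots> \<le> (\<Sum>T\<in>?TT. card (?A T))" by (rule card_UN_le[OF finT])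
    finally have "real (card D) \<le> (\<Sum>T\<in>?TT. real (card (?A T)))"
      by (simp flip: of_nat_sum)
    also have "\<dots> \<le> (\<Sum>T\<in>?TT. (real (2 * h) / real n) ^ (card J * d') * real (card ?\<Omega>))"
    proof (rule sum_mono)
      fix T assume "T \<in> ?TT"
      then show "real (card (?A T)) \<le> (real (2 * h) / real n) ^ (card J * d') * real (card ?\<Omega>)"
        using card_perm_tuples_preimage_subset[OF J, of T, OF _ n d] by auto
    qed
    also have "\<dots> = (real (n choose (2 * h)) * (real (2 * h) / real n) ^ (card J * d')) * real (card ?\<Omega>)"
      by (simp add: n_subsets)
    also have "\<dots> \<le> (1/2) ^ (2 * h) * real (card ?\<Omega>)"
      using h n by (intro mult_right_mono binomial_times_power_le) auto
    also have "\<dots> \<le> (1/2) ^ h * real (card ?\<Omega>)"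
      by (intro mult_right_mono power_decreasing) auto
    finally show ?thesis .
  qed
  ultimately show ?thesis by linarith
qed

section \<open>The Littlewood-Offord inequality\<close>

text \<open>Sperner's theorem by the LYM argument: each permutation sends initial segments to a chain, which
  meets the antichain at most once.\<close>

lemma card_antichain_le:
  assumes sub: "\<A> \<subseteq> Pow {..<N}"
    and anti: "\<And>A B. A \<in> \<A> \<Longrightarrow> B \<in> \<A> \<Longrightarrow> A \<subseteq> B \<Longrightarrow> A = B"
  shows "card \<A> \<le> N choose (N div 2)"
proof -
  let ?P = "{\<sigma>::nat \<Rightarrow> nat. \<sigma> permutes {..<N}}"
  \<comment> \<open>All preimages of \<open>A\<close> lie in the first \<open>card A\<close>
    positions, so by cardinality these positions are sent onto \<open>A\<close>: the chain of
    \<open>\<sigma>\<close> passes through \<open>A\<close>. This has probability 1 / (N choose card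
    A).\<close>
  let ?c = "\<lambda>A. {\<sigma>. \<sigma> permutes {..<N} \<and> (\<forall>i<N. \<sigma> i \<in> A \<longrightarrow> i \<in> {..<card A})}"
  have finA: "finite \<A>" using sub finite_subset by blast
  have finP: "finite ?P" by (simp add: finite_permutations)
  have img: "\<sigma> ` {..<card A} = A" if A: "A \<subseteq> {..<N}" and s: "\<sigma> \<in> ?c A" for \<sigma> A
  proof -
    have p: "\<sigma> permutes {..<N}" using s by auto
    have "A \<subseteq> \<sigma> ` {..<card A}"
    proof
      fix x assume x: "x \<in> A"
      then have "x \<in> \<sigma> ` {..<N}" using A permutes_image[OF p] by auto
      then show "x \<in> \<sigma> ` {..<card A}" using s x by auto
    qed
    moreover have "card (\<sigma> ` {..<card A}) = card A"
      using permutes_inj_on[OF p, of "{..<card A}"] by (simp add: card_image)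
    ultimately show ?thesis
      using card_subset_eq[of "\<sigma> ` {..<card A}" A] by simp
  qed
  have one: "card {A\<in>\<A>. \<sigma> \<in> ?c A} \<le> 1" for \<sigma>
  proof -
    have cmp: "A = B" if "A \<in> \<A>" "B \<in> \<A>" "\<sigma> \<in> ?c A" "\<sigma> \<in> ?c B" "card A \<le> card B" for A B
    proof -
      have "\<sigma> ` {..<card A} \<subseteq> \<sigma> ` {..<card B}" using that by auto
      moreover have "A \<subseteq> {..<N}" "B \<subseteq> {..<N}" using that sub by auto
      ultimately have "A \<subseteq> B" using img[of A \<sigma>] img[of B \<sigma>] that(3,4) by simp
      then show ?thesis using anti that by blast
    qed
    have "A = B" if "A \<in> \<A>" "B \<in> \<A>" "\<sigma> \<in> ?c A" "\<sigma> \<in> ?c B" for A B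
      using cmp[of A B] cmp[of B A] that nat_le_linear[of "card A" "card B"] by blast
    then show ?thesis using finA by (subst card_le_Suc0_iff_eq[unfolded One_nat_def[symmetric]]) auto
  qed
  have "(\<Sum>A\<in>\<A>. card (?c A)) = (\<Sum>A\<in>\<A>. card {\<sigma>\<in>?P. \<sigma> \<in> ?c A})"
    by (intro sum.cong arg_cong[where f = card]) auto
  also have "\<dots> = (\<Sum>\<sigma>\<in>?P. card {A\<in>\<A>. \<sigma> \<in> ?c A})"
    by (rule sum_multicount_gen) (use finA finP in auto)
  also have "\<dots> \<le> (\<Sum>\<sigma>\<in>?P. 1)" by (intro sum_mono one)
  also have "\<dots> = fact N" by (simp add: card_permutations)
  finally have le: "(\<Sum>A\<in>\<A>. card (?c A)) \<le> fact N" .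
  have "card \<A> * fact N = (\<Sum>A\<in>\<A>. fact N)" by simp
  also have "\<dots> \<le> (\<Sum>A\<in>\<A>. card (?c A) * (N choose (N div 2)))"
  proof (rule sum_mono)
    fix A assume "A \<in> \<A>"
    then have A: "A \<subseteq> {..<N}" using sub by auto
    then have "card A \<le> N" using card_mono[OF finite_lessThan A] by simp
    then have "card (?c A) * (N choose card A) = fact N"
      using card_permutations_preimage_subset_eq[OF A, of "{..<card A}"] by simp
    moreover have "card (?c A) * (N choose card A) \<le> card (?c A) * (N choose (N div 2))"
      by (intro mult_le_mono2 binomial_maximum)
    ultimately show "fact N \<le> card (?c A) * (N choose (N div 2))" by simp
  qed
  also have "\<dots> = (\<Sum>A\<in>\<A>. card (?c A)) * (N choose (N div 2))" by (simp only: sum_distrib_right)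
  also have "\<dots> \<le> fact N * (N choose (N div 2))" using le by (rule mult_le_mono1)
  finally show ?thesis by simp
qed

text \<open>The factor \<open>2 * k + 1\<close> lets the induction close, because (2k+1)(2k+3) is at
  most 4(k+1)^2.\<close>

lemma central_binomial_le: "real (2 * k + 1) * real (2 * k choose k) ^ 2 \<le> 16 ^ k"
proof (induction k)
  case 0
  show ?case by simp
next
  case (Suc k)
  have 1: "real (Suc k) * real (2 * Suc k choose Suc k) = 2 * real (2 * k + 1) * real (2 * k choose k)"
  proof -
    have "Suc k * (2 * Suc k choose Suc k) = (2 * k + 2) * (Suc (2 * k) choose k)"
      using Suc_times_binomial_eq[of "Suc (2 * k)" k] by simp
    moreover have "Suc k * (Suc (2 * k) choose k) = (2 * k + 1) * (2 * k choose k)"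
      using binomial_absorb_comp[of "Suc (2 * k)" k] by (simp add: algebra_simps)
    ultimately have "Suc k * (Suc k * (2 * Suc k choose Suc k)) = Suc k * (2 * ((2 * k + 1) * (2 * k choose k)))"
      by (simp add: algebra_simps)
    then have "Suc k * (2 * Suc k choose Suc k) = 2 * ((2 * k + 1) * (2 * k choose k))"
      by (metis mult_cancel1 nat.distinct(1))
    then have "real (Suc k * (2 * Suc k choose Suc k)) = real (2 * ((2 * k + 1) * (2 * k choose k)))"
      by (rule arg_cong)
    then show ?thesis by (simp only: of_nat_mult of_nat_numeral mult.assoc)
  qed
  have "real (Suc k) ^ 2 * (real (2 * Suc k + 1) * real (2 * Suc k choose Suc k) ^ 2)
      = real (2 * k + 3) * (real (Suc k) * real (2 * Suc k choose Suc k)) ^ 2"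
  proof -
    have e: "2 * Suc k + 1 = 2 * k + 3" by simp
    show ?thesis unfolding e power_mult_distrib by (simp only: ac_simps)
  qed
  also have "\<dots> = (4 * real (2 * k + 3) * real (2 * k + 1)) * (real (2 * k + 1) * real (2 * k choose k) ^ 2)"
    unfolding 1 by (simp add: power2_eq_square algebra_simps)
  also have "\<dots> \<le> (16 * real (Suc k) ^ 2) * 16 ^ k"
    by (rule mult_mono[OF _ Suc.IH]) (auto simp: power2_eq_square algebra_simps)
  also have "\<dots> = real (Suc k) ^ 2 * 16 ^ Suc k" by simp
  finally show ?case by (subst (asm) mult_le_cancel_left_pos) auto
qed

text \<open>For odd \<open>N\<close>, twice the middle coefficient is the central coefficient of
  \<open>N + 1\<close>.\<close>

lemma middle_binomial_le: "real (N choose (N div 2)) \<le> 2 ^ N / sqrt (real N + 1)"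
proof -
  have "(real N + 1) * real (N choose (N div 2)) ^ 2 \<le> 4 ^ N"
  proof (cases "even N")
    case True
    then obtain k where N: "N = 2 * k" by blast
    have "(4::real) ^ N = 16 ^ k" by (simp add: N power_mult)
    then show ?thesis using central_binomial_le[of k] N by (simp add: algebra_simps)
  next
    case False
    then obtain k where N: "N = 2 * k + 1" using oddE by blast
    have "Suc (2 * k) choose Suc k = Suc (2 * k) choose k"
      using binomial_symmetric[of k "Suc (2 * k)"] by simp
    then have "2 * Suc k choose Suc k = 2 * (N choose (N div 2))" by (simp add: N)
    then have b: "real (2 * Suc k choose Suc k) = 2 * real (N choose (N div 2))" by simp
    have "4 * ((real N + 2) * real (N choose (N div 2)) ^ 2) \<le> 16 ^ Suc k"
      using central_binomial_le[of "Suc k"] unfolding b by (simp add: N power2_eq_square algebra_simps)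
    also have "(16::real) ^ Suc k = 4 * 4 ^ N" by (simp add: N power_mult)
    finally have "(real N + 2) * real (N choose (N div 2)) ^ 2 \<le> 4 ^ N" by simp
    moreover have "(real N + 1) * real (N choose (N div 2)) ^ 2 \<le> (real N + 2) * real (N choose (N div 2)) ^ 2"
      by (intro mult_right_mono) auto
    ultimately show ?thesis by linarith
  qed
  then have "sqrt ((real N + 1) * real (N choose (N div 2)) ^ 2) \<le> sqrt (4 ^ N)"
    by (rule real_sqrt_le_mono)
  also have "sqrt (4 ^ N) = (2::real) ^ N" by (simp add: real_sqrt_power)
  finally have "sqrt (real N + 1) * real (N choose (N div 2)) \<le> 2 ^ N"
    by (simp only: real_sqrt_mult real_sqrt_abs of_nat_0_le_iff abs_of_nonneg)
  then show ?thesis by (simp add: pos_le_divide_eq mult.commute)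
qed

text \<open>Erdos' reduction to Sperner. Flipping membership at the indices with negative
  \<open>a l\<close> replaces every \<open>a l\<close> by its absolute value, up to a constant
  shift. Strictly nested sets then have sums at least \<open>\<delta>\<close> apart, too far for an
  open interval of length \<open>\<delta>\<close>, so the flipped sets form an antichain.\<close>

lemma card_subset_sums_in_interval:
  fixes a :: "nat \<Rightarrow> real"
  assumes fin: "finite S" and a: "\<And>l. l \<in> S \<Longrightarrow> \<bar>a l\<bar> \<ge> \<delta>" and \<delta>: "\<delta> > 0"
  shows "card {X\<in>Pow S. \<bar>c + (\<Sum>l\<in>X. a l)\<bar> < \<delta> / 2} \<le> card S choose (card S div 2)"
proof -
  let ?C = "{X\<in>Pow S. \<bar>c + (\<Sum>l\<in>X. a l)\<bar> < \<delta> / 2}"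
  obtain f where f: "bij_betw f S {..<card S}"
    using ex_bij_betw_finite_nat[OF fin] by (auto simp: atLeast0LessThan)
  define M where "M = {l\<in>S. a l < 0}"
  define g where "g X = (X - M) \<union> (M - X)" for X
  have finM: "finite M" using fin by (auto simp: M_def)
  have gS: "g X \<subseteq> S" if "X \<subseteq> S" for X using that by (auto simp: g_def M_def)
  have gg: "g (g X) = X" for X by (auto simp: g_def)
  have sums: "(\<Sum>l\<in>X. a l) = (\<Sum>l\<in>g X. \<bar>a l\<bar>) + (\<Sum>l\<in>M. a l)" if X: "X \<subseteq> S" for X
  proof -
    have finX: "finite X" using X fin finite_subset by blast
    have "(\<Sum>l\<in>g X. \<bar>a l\<bar>) = (\<Sum>l\<in>X - M. \<bar>a l\<bar>) + (\<Sum>l\<in>M - X. \<bar>a l\<bar>)"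
      unfolding g_def by (rule sum.union_disjoint) (use finX finM in auto)
    also have "(\<Sum>l\<in>X - M. \<bar>a l\<bar>) = (\<Sum>l\<in>X - M. a l)"
      by (rule sum.cong) (use X in \<open>auto simp: M_def\<close>)
    also have "(\<Sum>l\<in>M - X. \<bar>a l\<bar>) = - (\<Sum>l\<in>M - X. a l)"
      unfolding sum_negf[symmetric] by (rule sum.cong) (auto simp: M_def)
    finally show ?thesis
      using sum.Int_Diff[OF finX, of a M] sum.Int_Diff[OF finM, of a X] by (simp add: Int_commute)
  qed
  have anti: "g X = g Y" if X: "X \<in> ?C" and Y: "Y \<in> ?C" and le: "g X \<subseteq> g Y" for X Y
  proof (rule ccontr)
    assume "g X \<noteq> g Y"
    then obtain l where l: "l \<in> g Y - g X" using le by auto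
    have finY: "finite (g Y)" using gS[of Y] Y fin finite_subset by auto
    have "(\<Sum>l\<in>Y. a l) - (\<Sum>l\<in>X. a l) = (\<Sum>l\<in>g Y. \<bar>a l\<bar>) - (\<Sum>l\<in>g X. \<bar>a l\<bar>)"
      using sums X Y by auto
    also have "\<dots> = (\<Sum>l\<in>g Y - g X. \<bar>a l\<bar>)" using sum_diff[OF finY le, of "\<lambda>l. \<bar>a l\<bar>"] by simp
    also have "\<dots> \<ge> (\<Sum>l\<in>{l}. \<bar>a l\<bar>)"
      by (rule sum_mono2) (use l finY in auto)
    finally have "(\<Sum>l\<in>Y. a l) - (\<Sum>l\<in>X. a l) \<ge> \<bar>a l\<bar>" by simp
    moreover have "\<bar>a l\<bar> \<ge> \<delta>" using a l gS[of Y] Y by auto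
    moreover have "\<bar>c + (\<Sum>l\<in>X. a l)\<bar> < \<delta> / 2" "\<bar>c + (\<Sum>l\<in>Y. a l)\<bar> < \<delta> / 2"
      using X Y by blast+
    ultimately show False by linarith
  qed
  have finj: "inj_on f S" using f by (simp add: bij_betw_def)
  have inj: "inj_on (\<lambda>X. f ` g X) ?C"
  proof (rule inj_onI)
    fix X Y assume h: "X \<in> ?C" "Y \<in> ?C" "f ` g X = f ` g Y"
    then have "g X = g Y" using gS[of X] gS[of Y] inj_on_image_eq_iff[OF finj] by auto
    then show "X = Y" using gg by metis
  qed
  have "card ?C = card ((\<lambda>X. f ` g X) ` ?C)" using inj by (simp add: card_image)
  also have "\<dots> \<le> card S choose (card S div 2)"
  proof (rule card_antichain_le)
    show "(\<lambda>X. f ` g X) ` ?C \<subseteq> Pow {..<card S}"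
    proof (intro subsetI)
      fix A assume "A \<in> (\<lambda>X. f ` g X) ` ?C"
      then obtain X where X: "X \<subseteq> S" "A = f ` g X" by blast
      then have "A \<subseteq> f ` S" using gS by blast
      then show "A \<in> Pow {..<card S}" using f by (simp add: bij_betw_def)
    qed
    fix A B assume "A \<in> (\<lambda>X. f ` g X) ` ?C" "B \<in> (\<lambda>X. f ` g X) ` ?C" and le: "A \<subseteq> B"
    then obtain X Y where XY: "X \<in> ?C" "Y \<in> ?C" "A = f ` g X" "B = f ` g Y" by blast
    have "g X \<subseteq> g Y" using le XY gS[of X] gS[of Y] inj_on_image_subset_iff[OF finj] by auto
    then show "A = B" using anti[OF XY(1,2)] XY by simp
  qed
  finally show ?thesis .
qed

text \<open>Conditioning on the part of \<open>X\<close> outside \<open>R\<close> only shifts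
  \<open>c\<close>; the randomness inside \<open>R\<close> gives the gain.\<close>

lemma card_subset_sums_in_interval_partial:
  fixes a :: "nat \<Rightarrow> real"
  assumes fin: "finite S" and R: "R \<subseteq> S" and a: "\<And>l. l \<in> R \<Longrightarrow> \<bar>a l\<bar> \<ge> \<delta>" and \<delta>: "\<delta> > 0"
  shows "real (card {X\<in>Pow S. \<bar>c + (\<Sum>l\<in>X. a l)\<bar> < \<delta> / 2}) \<le> 2 ^ card S / sqrt (real (card R) + 1)"
proof -
  have finR: "finite R" using fin R finite_subset by blast
  let ?C = "{X\<in>Pow S. \<bar>c + (\<Sum>l\<in>X. a l)\<bar> < \<delta> / 2}"
  let ?D = "\<lambda>Y. {X\<in>Pow R. \<bar>(c + (\<Sum>l\<in>Y. a l)) + (\<Sum>l\<in>X. a l)\<bar> < \<delta> / 2}"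
  have "inj_on (\<lambda>X. (X - R, X \<inter> R)) ?C" by (rule inj_onI) auto
  moreover have "(\<lambda>X. (X - R, X \<inter> R)) ` ?C \<subseteq> Sigma (Pow (S - R)) ?D"
  proof
    fix p assume "p \<in> (\<lambda>X. (X - R, X \<inter> R)) ` ?C"
    then obtain X where X: "X \<in> ?C" "p = (X - R, X \<inter> R)" by blast
    then have "finite X" using fin finite_subset by auto
    then have "(\<Sum>l\<in>X. a l) = (\<Sum>l\<in>X \<inter> R. a l) + (\<Sum>l\<in>X - R. a l)" by (rule sum.Int_Diff)
    then show "p \<in> Sigma (Pow (S - R)) ?D" using X by (auto simp: algebra_simps)
  qed
  ultimately have "card ?C \<le> card (Sigma (Pow (S - R)) ?D)"
    by (rule card_inj_on_le) (use fin finR in auto)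
  also have "\<dots> = (\<Sum>Y\<in>Pow (S - R). card (?D Y))" using fin finR by (subst card_SigmaI) auto
  also have "\<dots> \<le> (\<Sum>Y\<in>Pow (S - R). card R choose (card R div 2))"
    by (intro sum_mono card_subset_sums_in_interval finR a \<delta>)
  also have "\<dots> = 2 ^ (card S - card R) * (card R choose (card R div 2))"
    using fin finR R by (simp add: card_Pow card_Diff_subset)
  finally have "real (card ?C) \<le> 2 ^ (card S - card R) * real (card R choose (card R div 2))"
    by (metis (no_types, lifting) of_nat_le_iff of_nat_mult of_nat_numeral of_nat_power)
  also have "\<dots> \<le> 2 ^ (card S - card R) * (2 ^ card R / sqrt (real (card R) + 1))"
    by (intro mult_left_mono middle_binomial_le) auto
  also have "\<dots> = 2 ^ card S / sqrt (real (card R) + 1)"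
    using card_mono[OF fin R] by (simp flip: power_add)
  finally show ?thesis .
qed

text \<open>A coefficient of modulus at least \<open>\<delta>\<close> has real or imaginary part at
  least \<open>\<delta> / 2\<close> in absolute value, so one of the two projections keeps half of
  the \<open>x\<close> coefficients. The local fact \<open>part\<close> is applied to
  \<open>Re\<close> or \<open>Im\<close>.\<close>

lemma card_complex_subset_sums_in_disc:
  fixes g :: "nat \<Rightarrow> complex"
  assumes fin: "finite S" and \<delta>: "\<delta> > 0"
    and many: "x \<le> card {l\<in>S. cmod (g l) \<ge> \<delta>}"
  shows "real (card {X\<in>Pow S. cmod (c + (\<Sum>l\<in>X. g l)) < \<delta> / 4}) \<le> 2 ^ card S / sqrt (real x / 2 + 1)"
proof -
  let ?C = "{X\<in>Pow S. cmod (c + (\<Sum>l\<in>X. g l)) < \<delta> / 4}"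
  have part: ?thesis if R: "R \<subseteq> S" "x \<le> 2 * card R" and a: "\<And>l. l \<in> R \<Longrightarrow> \<bar>f (g l)\<bar> \<ge> \<delta> / 2"
    and f: "\<And>z. \<bar>f z\<bar> \<le> cmod z" "\<And>z w. f (z + w) = f z + f w" "\<And>h (X::nat set). f (\<Sum>l\<in>X. h l) = (\<Sum>l\<in>X. f (h l))"
    for R :: "nat set" and f :: "complex \<Rightarrow> real"
  proof -
    have "?C \<subseteq> {X\<in>Pow S. \<bar>f c + (\<Sum>l\<in>X. f (g l))\<bar> < (\<delta> / 2) / 2}"
    proof
      fix X assume X: "X \<in> ?C"
      have "\<bar>f (c + (\<Sum>l\<in>X. g l))\<bar> < \<delta> / 4" using f(1) X le_less_trans by blast
      then show "X \<in> {X\<in>Pow S. \<bar>f c + (\<Sum>l\<in>X. f (g l))\<bar> < (\<delta> / 2) / 2}"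
        using X by (simp add: f(2,3))
    qed
    then have "card ?C \<le> card {X\<in>Pow S. \<bar>f c + (\<Sum>l\<in>X. f (g l))\<bar> < (\<delta> / 2) / 2}"
      by (rule card_mono[rotated]) (use fin in auto)
    then have "real (card ?C) \<le> real (card {X\<in>Pow S. \<bar>f c + (\<Sum>l\<in>X. f (g l))\<bar> < (\<delta> / 2) / 2})"
      by simp
    also have "\<dots> \<le> 2 ^ card S / sqrt (real (card R) + 1)"
      by (rule card_subset_sums_in_interval_partial[OF fin R(1) a]) (use \<delta> in auto)
    also have "\<dots> \<le> 2 ^ card S / sqrt (real x / 2 + 1)"
      using R(2) by (intro divide_left_mono real_sqrt_le_mono mult_pos_pos) auto
    finally show ?thesis .
  qed
  let ?A = "{l\<in>S. \<bar>Re (g l)\<bar> \<ge> \<delta> / 2}" and ?B = "{l\<in>S. \<bar>Im (g l)\<bar> \<ge> \<delta> / 2}"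
  have "{l\<in>S. cmod (g l) \<ge> \<delta>} \<subseteq> ?A \<union> ?B"
  proof
    fix l assume l: "l \<in> {l\<in>S. cmod (g l) \<ge> \<delta>}"
    then have "\<delta> \<le> \<bar>Re (g l)\<bar> + \<bar>Im (g l)\<bar>" using cmod_le[of "g l"] by simp
    then have "\<bar>Re (g l)\<bar> \<ge> \<delta> / 2 \<or> \<bar>Im (g l)\<bar> \<ge> \<delta> / 2" by linarith
    then show "l \<in> ?A \<union> ?B" using l by auto
  qed
  then have "card {l\<in>S. cmod (g l) \<ge> \<delta>} \<le> card (?A \<union> ?B)"
    by (rule card_mono[rotated]) (use fin in auto)
  then have "x \<le> card ?A + card ?B" using many card_Un_le[of ?A ?B] by linarith
  then consider "x \<le> 2 * card ?A" | "x \<le> 2 * card ?B" by linarith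
  then show ?thesis
  proof cases
    case 1
    show ?thesis by (rule part[of ?A Re]) (use 1 abs_Re_le_cmod in auto)
  next
    case 2
    show ?thesis by (rule part[of ?B Im]) (use 2 abs_Im_le_cmod in auto)
  qed
qed

section \<open>Exchanging two rows\<close>

definition spread :: "nat \<Rightarrow> nat \<Rightarrow> real \<Rightarrow> (nat \<Rightarrow> complex) \<Rightarrow> bool" where
  "spread n m \<rho> u \<longleftrightarrow> (\<forall>z. m \<le> card {j. j < n \<and> cmod (u j - z) \<ge> \<rho>})"

text \<open>For \<open>j\<close> far from \<open>i\<close> with respect to \<open>w\<close> and \<open>k\<close> far from \<open>i\<close> with respect to \<open>v\<close>, one of the pairs
  \<open>(i, j)\<close>, \<open>(i, k)\<close>, \<open>(j, k)\<close> is separated by both functions.\<close>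

lemma card_doubly_separated_pairs:
  fixes v w :: "nat \<Rightarrow> complex"
  assumes v: "spread n m \<rho> v" and w: "spread n m \<rho> w" and n: "n > 0"
  shows "m * m \<le> 3 * card {(i, j). i < n \<and> j < n \<and> cmod (w i - w j) \<ge> \<rho> / 2 \<and> cmod (v i - v j) \<ge> \<rho> / 2}"
proof -
  let ?G = "{(i, j). i < n \<and> j < n \<and> cmod (w i - w j) \<ge> \<rho> / 2 \<and> cmod (v i - v j) \<ge> \<rho> / 2}"
  define V where "V i = {j. j < n \<and> cmod (v j - v i) \<ge> \<rho>}" for i
  define W where "W i = {j. j < n \<and> cmod (w j - w i) \<ge> \<rho>}" for i
  have fin: "finite (V i)" "finite (W i)" for i by (auto simp: V_def W_def)
  have big: "m \<le> card (V i)" "m \<le> card (W i)" for i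
    using v w by (auto simp: spread_def V_def W_def)
  have finG: "finite ?G" by (rule finite_subset[of _ "{..<n} \<times> {..<n}"]) auto
  let ?H = "?G \<times> {..<n}"
  let ?f1 = "\<lambda>((i, j), k). (i, j, k)" and ?f2 = "\<lambda>((i, k), j). (i, j, k)" and ?f3 = "\<lambda>((j, k), i). (i, j, k)"
  \<comment> \<open>In each of the three cases a separated pair and a free third index determine the
    triple, so a case covers at most \<open>n * card ?G\<close> triples, out of at least
    \<open>n * (m * m)\<close>.\<close>
  have cov: "(SIGMA i:{..<n}. W i \<times> V i) \<subseteq> ?f1 ` ?H \<union> (?f2 ` ?H \<union> ?f3 ` ?H)"
  proof
    fix p assume "p \<in> (SIGMA i:{..<n}. W i \<times> V i)"
    then obtain i j k where p: "p = (i, j, k)" and ijk: "i < n" "j < n" "k < n"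
      and wj: "cmod (w j - w i) \<ge> \<rho>" and vk: "cmod (v k - v i) \<ge> \<rho>"
      by (auto simp: V_def W_def)
    have \<rho>2: "cmod (w i - w j) \<ge> \<rho> / 2" "cmod (v i - v k) \<ge> \<rho> / 2"
      using wj vk norm_ge_zero[of "w j - w i"] norm_ge_zero[of "v k - v i"]
      unfolding norm_minus_commute[of "w i"] norm_minus_commute[of "v i"] by linarith+
    show "p \<in> ?f1 ` ?H \<union> (?f2 ` ?H \<union> ?f3 ` ?H)"
    proof (cases "cmod (v i - v j) \<ge> \<rho> / 2")
      case True
      then have "p = ?f1 ((i, j), k)" "((i, j), k) \<in> ?H" using p ijk \<rho>2 by auto
      then show ?thesis by blast
    next
      case vj: False
      show ?thesis
      proof (cases "cmod (w i - w k) \<ge> \<rho> / 2")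
        case True
        then have "p = ?f2 ((i, k), j)" "((i, k), j) \<in> ?H" using p ijk \<rho>2 by auto
        then show ?thesis by blast
      next
        case wk: False
        have "cmod (w j - w i) \<le> cmod (w j - w k) + cmod (w i - w k)"
          using norm_triangle_ineq4[of "w j - w k" "w i - w k"] by simp
        moreover have "cmod (v k - v i) \<le> cmod (v j - v k) + cmod (v i - v j)"
          using norm_triangle_ineq4[of "v k - v j" "v i - v j"] by (simp add: norm_minus_commute)
        ultimately have "((j, k), i) \<in> ?H" using vj wk wj vk ijk by auto
        moreover have "p = ?f3 ((j, k), i)" using p by simp
        ultimately show ?thesis by blast
      qed
    qed
  qed
  have "n * (m * m) = (\<Sum>i<n. m * m)" by simp
  also have "\<dots> \<le> (\<Sum>i<n. card (W i \<times> V i))"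
    unfolding card_cartesian_product by (intro sum_mono mult_le_mono big)
  also have "\<dots> = card (SIGMA i:{..<n}. W i \<times> V i)" by (subst card_SigmaI) (use fin in auto)
  also have "\<dots> \<le> card (?f1 ` ?H \<union> (?f2 ` ?H \<union> ?f3 ` ?H))"
    by (rule card_mono[OF _ cov]) (use finG in auto)
  also have "\<dots> \<le> card (?f1 ` ?H) + (card (?f2 ` ?H) + card (?f3 ` ?H))"
    using card_Un_le[of "?f1 ` ?H" "?f2 ` ?H \<union> ?f3 ` ?H"] card_Un_le[of "?f2 ` ?H" "?f3 ` ?H"] by linarith
  also have "\<dots> \<le> card ?H + (card ?H + card ?H)"
    by (intro add_mono card_image_le) (use finG in auto)
  also have "\<dots> = n * (3 * card ?G)" by (simp add: card_cartesian_product)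
  finally show ?thesis using n by simp
qed

section \<open>The operator, its transpose, and events for pairs of rows\<close>

definition row_action :: "nat \<Rightarrow> nat \<Rightarrow> (nat \<Rightarrow> nat \<Rightarrow> complex) \<Rightarrow> (nat \<Rightarrow> nat \<Rightarrow> nat) \<Rightarrow> (nat \<Rightarrow> complex) \<Rightarrow> nat \<Rightarrow> complex" where
  "row_action n d B \<pi> x i = (\<Sum>l<d. x (\<pi> l i)) + (\<Sum>j<n. B i j * x j)"

text \<open>Transposing a sum of permutation matrices inverts the permutations. The restriction to
  \<open>{..<d}\<close> keeps the tuple in the extensional product
  \<open>perm_tuples\<close>.\<close>

definition inv_tuple :: "nat \<Rightarrow> (nat \<Rightarrow> nat \<Rightarrow> nat) \<Rightarrow> nat \<Rightarrow> nat \<Rightarrow> nat" where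
  "inv_tuple d \<pi> = (\<lambda>l\<in>{..<d}. Hilbert_Choice.inv (\<pi> l))"

text \<open>The plain transpose, not the adjoint. Writing it as a row action makes every result
  about \<open>u\<close> available for \<open>w\<close>, with \<open>B\<close> transposed.\<close>

definition col_action :: "nat \<Rightarrow> nat \<Rightarrow> (nat \<Rightarrow> nat \<Rightarrow> complex) \<Rightarrow> (nat \<Rightarrow> nat \<Rightarrow> nat) \<Rightarrow> (nat \<Rightarrow> complex) \<Rightarrow> nat \<Rightarrow> complex" where
  "col_action n d B \<pi> w = row_action n d (\<lambda>i j. B j i) (inv_tuple d \<pi>) w"

lemma row_col_action_duality:
  assumes "\<pi> \<in> perm_tuples n d"
  shows "(\<Sum>i<n. w i * row_action n d B \<pi> x i) = (\<Sum>j<n. col_action n d B \<pi> w j * x j)"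
proof -
  have perm: "(\<Sum>i<n. w i * x (\<pi> l i)) = (\<Sum>j<n. w (Hilbert_Choice.inv (\<pi> l) j) * x j)" if "l < d" for l
  proof -
    have p: "\<pi> l permutes {..<n}" using perm_tuplesD[OF assms that] .
    have "(\<Sum>j<n. w (Hilbert_Choice.inv (\<pi> l) j) * x j)
        = (\<Sum>i<n. w (Hilbert_Choice.inv (\<pi> l) (\<pi> l i)) * x (\<pi> l i))"
      using sum.permute[OF p, of "\<lambda>j. w (Hilbert_Choice.inv (\<pi> l) j) * x j"] by (simp add: o_def)
    then show ?thesis using permutes_inverses(2)[OF p] by simp
  qed
  have "(\<Sum>i<n. w i * row_action n d B \<pi> x i)
      = (\<Sum>i<n. \<Sum>l<d. w i * x (\<pi> l i)) + (\<Sum>i<n. \<Sum>j<n. w i * (B i j * x j))"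
    by (simp add: row_action_def distrib_left sum.distrib sum_distrib_left)
  also have "(\<Sum>i<n. \<Sum>l<d. w i * x (\<pi> l i)) = (\<Sum>l<d. \<Sum>i<n. w i * x (\<pi> l i))"
    by (rule sum.swap)
  also have "\<dots> = (\<Sum>l<d. \<Sum>j<n. w (Hilbert_Choice.inv (\<pi> l) j) * x j)"
    by (rule sum.cong) (use perm in auto)
  also have "\<dots> = (\<Sum>j<n. \<Sum>l<d. w (Hilbert_Choice.inv (\<pi> l) j) * x j)" by (rule sum.swap)
  also have "(\<Sum>i<n. \<Sum>j<n. w i * (B i j * x j)) = (\<Sum>j<n. \<Sum>i<n. w i * (B i j * x j))"
    by (rule sum.swap)
  also have "(\<Sum>j<n. \<Sum>l<d. w (Hilbert_Choice.inv (\<pi> l) j) * x j) + (\<Sum>j<n. \<Sum>i<n. w i * (B i j * x j))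
      = (\<Sum>j<n. col_action n d B \<pi> w j * x j)"
    by (simp add: col_action_def row_action_def inv_tuple_def distrib_right sum.distrib sum_distrib_right) (simp add: mult_ac)
  finally show ?thesis .
qed

text \<open>The exchange acts on arguments, whereas \<open>swap_cols\<close> acts on values; hence
  only the rows \<open>a\<close> and \<open>b\<close> of the matrix change.\<close>

definition swap_rows :: "nat \<Rightarrow> nat \<Rightarrow> nat set \<Rightarrow> (nat \<Rightarrow> nat \<Rightarrow> nat) \<Rightarrow> nat \<Rightarrow> nat \<Rightarrow> nat" where
  "swap_rows a b \<xi> \<pi> = (\<lambda>l. if l \<in> \<xi> then \<pi> l \<circ> Transposition.transpose a b else \<pi> l)"

lemma swap_rows_bij:
  assumes "a < n" "b < n" "\<xi> \<subseteq> {..<d}"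
  shows "bij_betw (swap_rows a b \<xi>) (perm_tuples n d) (perm_tuples n d)"
proof -
  have inv: "swap_rows a b \<xi> (swap_rows a b \<xi> \<pi>) = \<pi>" for \<pi>
    by (auto simp: swap_rows_def fun_eq_iff)
  have mem: "swap_rows a b \<xi> \<pi> \<in> perm_tuples n d" if "\<pi> \<in> perm_tuples n d" for \<pi>
  proof -
    have "swap_rows a b \<xi> \<pi> l permutes {..<n}" if "l < d" for l
      using perm_tuplesD[OF \<open>\<pi> \<in> _\<close> that] permutes_swap_id[of a "{..<n}" b] assms
      by (auto simp: swap_rows_def intro: permutes_compose)
    moreover have "swap_rows a b \<xi> \<pi> l = undefined" if "l \<ge> d" for l
      using that assms \<open>\<pi> \<in> _\<close> by (auto simp: swap_rows_def perm_tuples_def PiE_iff extensional_def)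
    ultimately show ?thesis by (auto simp: perm_tuples_def PiE_iff extensional_def)
  qed
  show ?thesis
    by (rule bij_betw_byWitness[where f' = "swap_rows a b \<xi>"]) (use inv mem in auto)
qed

definition near_null :: "nat \<Rightarrow> nat \<Rightarrow> (nat \<Rightarrow> nat \<Rightarrow> complex) \<Rightarrow> real \<Rightarrow> (nat \<Rightarrow> nat \<Rightarrow> nat) \<Rightarrow> (nat \<Rightarrow> complex) \<Rightarrow> bool" where
  "near_null n d B t \<pi> u \<longleftrightarrow> (\<forall>i<n. cmod (u i) \<le> 1) \<and> (\<forall>i<n. cmod (row_action n d B \<pi> u i) \<le> t)"

definition left_near_null :: "nat \<Rightarrow> nat \<Rightarrow> (nat \<Rightarrow> nat \<Rightarrow> complex) \<Rightarrow> real \<Rightarrow> (nat \<Rightarrow> nat \<Rightarrow> nat) \<Rightarrow> (nat \<Rightarrow> complex) \<Rightarrow> bool" where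
  "left_near_null n d B t \<pi> w \<longleftrightarrow> (\<forall>i<n. cmod (w i) \<le> 1) \<and> (\<forall>j<n. cmod (col_action n d B \<pi> w j) \<le> t)"

text \<open>\<open>u\<close> and \<open>w\<close> are bound inside the event because they may depend
  on \<open>\<pi>\<close>. The last condition supplies \<open>x\<close> Littlewood-Offord
  coefficients among the first \<open>d'\<close> permutations.\<close>

definition pair_event :: "nat \<Rightarrow> nat \<Rightarrow> nat \<Rightarrow> (nat \<Rightarrow> nat \<Rightarrow> complex) \<Rightarrow> real \<Rightarrow> real \<Rightarrow> nat \<Rightarrow> nat \<Rightarrow> nat \<Rightarrow> (nat \<Rightarrow> nat \<Rightarrow> nat) set" where
  "pair_event n d d' B t \<rho> x a b = {\<pi>\<in>perm_tuples n d. \<exists>u w.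
     near_null n d B t \<pi> u \<and> left_near_null n d B t \<pi> w \<and> cmod (w a - w b) \<ge> \<rho> / 2 \<and>
     x \<le> card {l\<in>{..<d'}. cmod (u (\<pi> l a) - u (\<pi> l b)) \<ge> \<rho> / 2}}"

lemma sum_remove_two:
  fixes f :: "nat \<Rightarrow> 'a::ab_group_add"
  assumes "a < n" "b < n" "a \<noteq> b"
  shows "(\<Sum>i<n. f i) = f a + f b + (\<Sum>i\<in>{..<n} - {a, b}. f i)"
proof -
  have "(\<Sum>i<n. f i) = (\<Sum>i\<in>{..<n} - {a, b}. f i) + (\<Sum>i\<in>{a, b}. f i)"
    by (rule sum.subset_diff) (use assms in auto)
  then show ?thesis using assms by (simp add: algebra_simps)
qed

text \<open>Let p, q be the values at rows a, b. Duality makes the \<open>w\<close>-weighted sum of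
  all rows small, and the other rows are small themselves, so w_a p + w_b q is small, as is p + q.
  Since 2 (w_a p + w_b q) = (w_a + w_b)(p + q) + (w_a - w_b)(p - q), the separation of w_a and w_b
  makes p - q small too.\<close>

lemma row_difference_small:
  assumes ab: "a < n" "b < n" "a \<noteq> b" and pi: "\<pi> \<in> perm_tuples n d"
    and u: "\<And>i. i < n \<Longrightarrow> cmod (u i) \<le> 1"
    and w: "left_near_null n d B t \<pi> w" and sep: "cmod (w a - w b) \<ge> \<rho> / 2"
    and rest: "\<And>i. i < n \<Longrightarrow> i \<noteq> a \<Longrightarrow> i \<noteq> b \<Longrightarrow> cmod (row_action n d B \<pi> u i) \<le> t"
    and plus: "cmod (row_action n d B \<pi> u a + row_action n d B \<pi> u b) \<le> 2 * t"
    and t: "t \<ge> 0" and \<rho>: "\<rho> > 0" and small: "64 * real n * t < \<rho>\<^sup>2"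
  shows "cmod (row_action n d B \<pi> u a - row_action n d B \<pi> u b) < \<rho> / 4"
proof -
  let ?T = "row_action n d B \<pi> u"
  define p q where "p = ?T a" and "q = ?T b"
  define R where "R = (\<Sum>i\<in>{..<n} - {a, b}. w i * ?T i)"
  have w1: "cmod (w i) \<le> 1" if "i < n" for i using w that by (simp add: left_near_null_def)
  have n: "real n \<ge> 1" using ab by simp
  have "cmod (\<Sum>j<n. col_action n d B \<pi> w j * u j) \<le> (\<Sum>j<n. t)"
  proof (rule sum_norm_le)
    fix j assume "j \<in> {..<n}"
    then show "cmod (col_action n d B \<pi> w j * u j) \<le> t"
      using mult_mono[of "cmod (col_action n d B \<pi> w j)" t "cmod (u j)" 1] w u[of j] t
      by (simp add: left_near_null_def norm_mult)
  qed
  then have tot: "cmod (\<Sum>i<n. w i * ?T i) \<le> real n * t"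
    using row_col_action_duality[OF pi, of w B u] by simp
  have "cmod R \<le> (\<Sum>i\<in>{..<n} - {a, b}. t)"
    unfolding R_def
  proof (rule sum_norm_le)
    fix i assume i: "i \<in> {..<n} - {a, b}"
    then show "cmod (w i * ?T i) \<le> t"
      using mult_mono[of "cmod (w i)" 1 "cmod (?T i)" t] w1[of i] rest[of i] t by (simp add: norm_mult)
  qed
  also have "\<dots> \<le> (\<Sum>i<n. t)" using t by (intro sum_mono2) auto
  finally have R: "cmod R \<le> real n * t" by simp
  have dec: "(\<Sum>i<n. w i * ?T i) = w a * p + w b * q + R"
    unfolding R_def p_def q_def by (rule sum_remove_two[OF ab])
  have "(w a - w b) * (p - q) = 2 * ((\<Sum>i<n. w i * ?T i) - R) - (w a + w b) * (p + q)"
    unfolding dec by (simp add: algebra_simps)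
  then have "cmod ((w a - w b) * (p - q)) \<le> cmod (2 * ((\<Sum>i<n. w i * ?T i) - R)) + cmod ((w a + w b) * (p + q))"
    using norm_triangle_ineq4 by metis
  also have "cmod (2 * ((\<Sum>i<n. w i * ?T i) - R)) \<le> 2 * (real n * t + real n * t)"
    unfolding norm_mult norm_numeral
    by (intro mult_left_mono order_trans[OF norm_triangle_ineq4 add_mono[OF tot R]]) simp
  also have "cmod ((w a + w b) * (p + q)) \<le> 2 * (2 * t)"
    unfolding norm_mult
    using norm_triangle_ineq[of "w a" "w b"] w1[of a] w1[of b] ab plus
    by (intro mult_mono) (auto simp: p_def q_def)
  finally have "cmod (w a - w b) * cmod (p - q) \<le> 4 * real n * t + 4 * t" by (simp add: norm_mult mult_ac)
  also have "\<dots> \<le> 8 * real n * t" using mult_right_mono[OF n t] by (simp add: mult_ac)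
  finally have "\<rho> / 2 * cmod (p - q) \<le> 8 * real n * t"
    using mult_right_mono[OF sep norm_ge_zero[of "p - q"]] by linarith
  also have "\<dots> < \<rho> / 2 * (\<rho> / 4)" using small by (simp add: power2_eq_square)
  finally show ?thesis using \<rho> by (simp add: p_def q_def)
qed

text \<open>The vector \<open>u\<close> may be taken from a single configuration of exchanges: the other rows, and the sum of the rows
  \<open>a\<close> and \<open>b\<close>, do not see the exchanges, so only \<open>w\<close> has to vary.\<close>

lemma card_pair_event_le:
  assumes ab: "a < n" "b < n" and d: "d' \<le> d"
    and t: "t \<ge> 0" and \<rho>: "\<rho> > 0" and small: "64 * real n * t < \<rho>\<^sup>2"
  shows "real (card (pair_event n d d' B t \<rho> x a b)) \<le> 1 / sqrt (real x / 2 + 1) * real (card (perm_tuples n d))"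
proof (cases "a = b")
  case True
  then have "pair_event n d d' B t \<rho> x a b = {}" using \<rho> by (auto simp: pair_event_def)
  then show ?thesis by simp
next
  case ne: False
  let ?\<Omega> = "perm_tuples n d" and ?E = "pair_event n d d' B t \<rho> x a b"
  let ?sw = "swap_rows a b"
  have "real (card ?E) \<le> 1 / sqrt (real x / 2 + 1) * real (card ?\<Omega>) + real (card ({} :: (nat \<Rightarrow> nat \<Rightarrow> nat) set))"
  proof (rule card_le_by_averaging[where K = "Pow {..<d'}" and \<Phi> = ?sw])
    show bij: "bij_betw (?sw \<xi>) ?\<Omega> ?\<Omega>" if "\<xi> \<in> Pow {..<d'}" for \<xi>
      by (rule swap_rows_bij[OF ab]) (use that d in auto)
    fix \<pi> assume "\<pi> \<in> ?\<Omega> - {}"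
    then have pi: "\<pi> \<in> ?\<Omega>" by simp
    show "real (card {\<xi>\<in>Pow {..<d'}. ?sw \<xi> \<pi> \<in> ?E}) \<le> 1 / sqrt (real x / 2 + 1) * real (card (Pow {..<d'}))"
    proof (cases "\<exists>\<xi>\<in>Pow {..<d'}. ?sw \<xi> \<pi> \<in> ?E")
      case False
      then have "{\<xi>\<in>Pow {..<d'}. ?sw \<xi> \<pi> \<in> ?E} = {}" by blast
      then show ?thesis by (simp only: card.empty) simp
    next
      case True
      then obtain \<xi>0 where \<xi>0: "\<xi>0 \<subseteq> {..<d'}" "?sw \<xi>0 \<pi> \<in> ?E" by auto
      then obtain u where u: "near_null n d B t (?sw \<xi>0 \<pi>) u"
        and many0: "x \<le> card {l\<in>{..<d'}. cmod (u (?sw \<xi>0 \<pi> l a) - u (?sw \<xi>0 \<pi> l b)) \<ge> \<rho> / 2}"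
        by (auto simp: pair_event_def)
      define g where "g l = u (\<pi> l a) - u (\<pi> l b)" for l
      have swab: "?sw \<xi> \<pi> l a = (if l \<in> \<xi> then \<pi> l b else \<pi> l a)"
                 "?sw \<xi> \<pi> l b = (if l \<in> \<xi> then \<pi> l a else \<pi> l b)" for \<xi> l
        by (auto simp: swap_rows_def)
      have swi: "?sw \<xi> \<pi> l i = \<pi> l i" if "i \<noteq> a" "i \<noteq> b" for \<xi> l i
        using that by (auto simp: swap_rows_def)
      \<comment> \<open>An exchange at \<open>l\<close> only flips the sign of \<open>g l\<close>,
        so the lower bounds seen at \<open>\<xi>0\<close> are bounds on \<open>g\<close> itself. The
        increments below are \<open>-2 * g l\<close>, which turns \<open>\<rho> / 2\<close> into
        \<open>\<rho>\<close>.\<close>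
      have "{l\<in>{..<d'}. cmod (u (?sw \<xi>0 \<pi> l a) - u (?sw \<xi>0 \<pi> l b)) \<ge> \<rho> / 2} = {l\<in>{..<d'}. cmod (-2 * g l) \<ge> \<rho>}"
      proof -
        have "cmod (-2 * g l) = 2 * cmod (u (\<pi> l a) - u (\<pi> l b))" for l
          unfolding norm_mult g_def by simp
        then show ?thesis by (auto simp: swab norm_minus_commute)
      qed
      then have many: "x \<le> card {l\<in>{..<d'}. cmod (-2 * g l) \<ge> \<rho>}" using many0 by simp
      define c where "c = row_action n d B \<pi> u a - row_action n d B \<pi> u b"
      have plus: "row_action n d B (?sw \<xi> \<pi>) u a + row_action n d B (?sw \<xi> \<pi>) u b = row_action n d B \<pi> u a + row_action n d B \<pi> u b" for \<xi>
      proof -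
        have "(\<Sum>l<d. u (?sw \<xi> \<pi> l a)) + (\<Sum>l<d. u (?sw \<xi> \<pi> l b)) = (\<Sum>l<d. u (\<pi> l a)) + (\<Sum>l<d. u (\<pi> l b))"
          unfolding sum.distrib[symmetric] by (rule sum.cong) (auto simp: swab)
        then show ?thesis by (simp add: row_action_def algebra_simps)
      qed
      have minus: "row_action n d B (?sw \<xi> \<pi>) u a - row_action n d B (?sw \<xi> \<pi>) u b = c + (\<Sum>l\<in>\<xi>. -2 * g l)"
        if "\<xi> \<subseteq> {..<d'}" for \<xi>
      proof -
        have "(\<Sum>l<d. u (?sw \<xi> \<pi> l a)) - (\<Sum>l<d. u (?sw \<xi> \<pi> l b))
            = (\<Sum>l<d. g l + (if l \<in> \<xi> then -2 * g l else 0))"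
          unfolding sum_subtractf[symmetric] by (rule sum.cong) (auto simp: swab g_def)
        also have "\<dots> = (\<Sum>l<d. g l) + (\<Sum>l\<in>\<xi>. -2 * g l)"
        proof -
          have "(\<Sum>l<d. (if l \<in> \<xi> then -2 * g l else 0)) = (\<Sum>l\<in>\<xi>. -2 * g l)"
            by (rule sum.mono_neutral_cong_right) (use that d in auto)
          then show ?thesis by (simp only: sum.distrib)
        qed
        finally show ?thesis by (simp add: c_def row_action_def g_def sum_subtractf algebra_simps)
      qed
      have "{\<xi>\<in>Pow {..<d'}. ?sw \<xi> \<pi> \<in> ?E} \<subseteq> {\<xi>\<in>Pow {..<d'}. cmod (c + (\<Sum>l\<in>\<xi>. -2 * g l)) < \<rho> / 4}"
      proof
        fix \<xi> assume "\<xi> \<in> {\<xi>\<in>Pow {..<d'}. ?sw \<xi> \<pi> \<in> ?E}"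
        then have \<xi>: "\<xi> \<subseteq> {..<d'}" "?sw \<xi> \<pi> \<in> ?E" by auto
        then obtain w where w: "left_near_null n d B t (?sw \<xi> \<pi>) w" and sep: "cmod (w a - w b) \<ge> \<rho> / 2"
          by (auto simp: pair_event_def)
        have "cmod (row_action n d B (?sw \<xi> \<pi>) u a - row_action n d B (?sw \<xi> \<pi>) u b) < \<rho> / 4"
        proof (rule row_difference_small[OF ab ne _ _ w sep])
          show "?sw \<xi> \<pi> \<in> ?\<Omega>" using \<xi> by (auto simp: pair_event_def)
          show "cmod (u i) \<le> 1" if "i < n" for i using u that by (simp add: near_null_def)
          show "cmod (row_action n d B (?sw \<xi> \<pi>) u i) \<le> t" if "i < n" "i \<noteq> a" "i \<noteq> b" for i
          proof -
            have "row_action n d B (?sw \<xi> \<pi>) u i = row_action n d B (?sw \<xi>0 \<pi>) u i" using that by (simp add: row_action_def swi)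
            then show ?thesis using u that by (simp add: near_null_def)
          qed
          have "cmod (row_action n d B (?sw \<xi>0 \<pi>) u a) \<le> t" "cmod (row_action n d B (?sw \<xi>0 \<pi>) u b) \<le> t"
            using u ab by (auto simp: near_null_def)
          then show "cmod (row_action n d B (?sw \<xi> \<pi>) u a + row_action n d B (?sw \<xi> \<pi>) u b) \<le> 2 * t"
            unfolding plus[of \<xi>] plus[of \<xi>0, symmetric]
            using norm_triangle_ineq[of "row_action n d B (?sw \<xi>0 \<pi>) u a" "row_action n d B (?sw \<xi>0 \<pi>) u b"] by linarith
        qed (use t \<rho> small in auto)
        then show "\<xi> \<in> {\<xi>\<in>Pow {..<d'}. cmod (c + (\<Sum>l\<in>\<xi>. -2 * g l)) < \<rho> / 4}"
          using minus[OF \<xi>(1)] \<xi>(1) by simp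
      qed
      then have "card {\<xi>\<in>Pow {..<d'}. ?sw \<xi> \<pi> \<in> ?E} \<le> card {\<xi>\<in>Pow {..<d'}. cmod (c + (\<Sum>l\<in>\<xi>. -2 * g l)) < \<rho> / 4}"
        by (rule card_mono[rotated]) auto
      then have "real (card {\<xi>\<in>Pow {..<d'}. ?sw \<xi> \<pi> \<in> ?E}) \<le> real (card {\<xi>\<in>Pow {..<d'}. cmod (c + (\<Sum>l\<in>\<xi>. -2 * g l)) < \<rho> / 4})"
        by (rule of_nat_mono)
      also have "\<dots> \<le> 2 ^ card {..<d'} / sqrt (real x / 2 + 1)"
        by (rule card_complex_subset_sums_in_disc[OF _ \<rho> many]) auto
      finally show ?thesis by (simp add: card_Pow)
    qed
  qed (auto simp: finite_perm_tuples pair_event_def)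
  then show ?thesis by simp
qed

definition spread_event :: "nat \<Rightarrow> nat \<Rightarrow> (nat \<Rightarrow> nat \<Rightarrow> complex) \<Rightarrow> real \<Rightarrow> real \<Rightarrow> nat \<Rightarrow> (nat \<Rightarrow> nat \<Rightarrow> nat) set" where
  "spread_event n d B t \<rho> m = {\<pi>\<in>perm_tuples n d. \<exists>u w.
     near_null n d B t \<pi> u \<and> left_near_null n d B t \<pi> w \<and> spread n m \<rho> u \<and> spread n m \<rho> w}"

lemma spread_permute:
  assumes "p permutes {..<n}" "spread n m \<rho> u"
  shows "spread n m \<rho> (\<lambda>i. u (p i))"
  unfolding spread_def
proof
  fix z
  have "bij_betw p {j. j < n \<and> cmod (u (p j) - z) \<ge> \<rho>} {j. j < n \<and> cmod (u j - z) \<ge> \<rho>}"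
  proof (rule bij_betw_byWitness[where f' = "Hilbert_Choice.inv p"])
    show "p ` {j. j < n \<and> cmod (u (p j) - z) \<ge> \<rho>} \<subseteq> {j. j < n \<and> cmod (u j - z) \<ge> \<rho>}"
      using permutes_in_image[OF assms(1)] by auto
    show "Hilbert_Choice.inv p ` {j. j < n \<and> cmod (u j - z) \<ge> \<rho>} \<subseteq> {j. j < n \<and> cmod (u (p j) - z) \<ge> \<rho>}"
      using permutes_in_image[OF permutes_inv[OF assms(1)]] permutes_inverses(1)[OF assms(1)] by auto
  qed (use permutes_inverses[OF assms(1)] in auto)
  then have "card {j. j < n \<and> cmod (u (p j) - z) \<ge> \<rho>} = card {j. j < n \<and> cmod (u j - z) \<ge> \<rho>}"
    by (rule bij_betw_same_card)
  then show "m \<le> card {j. j < n \<and> cmod (u (p j) - z) \<ge> \<rho>}"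
    using assms(2) by (simp add: spread_def)
qed

text \<open>Double counting of permutations and pairs. Each \<open>l\<close> contributes at least
  m^2/3 pairs separated by both \<open>w\<close> and \<open>u\<close> composed with
  \<open>\<pi> l\<close>. Pairs with fewer than \<open>x\<close> such \<open>l\<close> account for
  at most x n^2, at most half of the total d' m^2/3; the other half, at most d' per pair, needs
  m^2/6 pairs.\<close>

lemma many_pair_events:
  assumes "\<pi> \<in> spread_event n d B t \<rho> m" and d: "d' \<le> d" "d' > 0" and n: "n > 0"
    and x: "6 * x * n\<^sup>2 \<le> d' * m\<^sup>2"
  shows "m\<^sup>2 \<le> 6 * card {(a, b). a < n \<and> b < n \<and> \<pi> \<in> pair_event n d d' B t \<rho> x a b}"
proof -
  from assms(1) obtain u w where pi: "\<pi> \<in> perm_tuples n d"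
    and nn: "near_null n d B t \<pi> u" "left_near_null n d B t \<pi> w"
    and sp: "spread n m \<rho> u" "spread n m \<rho> w" by (auto simp: spread_event_def)
  let ?N = "{..<n} \<times> {..<n}"
  define S where "S = {(a, b). a < n \<and> b < n \<and> cmod (w a - w b) \<ge> \<rho> / 2}"
  define X where "X p = {l\<in>{..<d'}. cmod (u (\<pi> l (fst p)) - u (\<pi> l (snd p))) \<ge> \<rho> / 2}" for p
  define G where "G = {p\<in>S. x \<le> card (X p)}"
  have finS: "finite S" by (rule finite_subset[of _ ?N]) (auto simp: S_def)
  have finG: "finite G" using finS by (auto simp: G_def)
  have "d' * m\<^sup>2 = (\<Sum>l<d'. m * m)" by (simp add: power2_eq_square)
  also have "\<dots> \<le> (\<Sum>l<d'. 3 * card {p\<in>S. l \<in> X p})"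
  proof (rule sum_mono)
    fix l assume l: "l \<in> {..<d'}"
    have "spread n m \<rho> (\<lambda>i. u (\<pi> l i))"
      using spread_permute perm_tuplesD[OF pi, of l] l d sp by auto
    then have "m * m \<le> 3 * card {(i, j). i < n \<and> j < n \<and> cmod (w i - w j) \<ge> \<rho> / 2 \<and> cmod (u (\<pi> l i) - u (\<pi> l j)) \<ge> \<rho> / 2}"
      by (rule card_doubly_separated_pairs[OF _ sp(2) n])
    also have "{(i, j). i < n \<and> j < n \<and> cmod (w i - w j) \<ge> \<rho> / 2 \<and> cmod (u (\<pi> l i) - u (\<pi> l j)) \<ge> \<rho> / 2}
        = {p\<in>S. l \<in> X p}" using l by (auto simp: S_def X_def)
    finally show "m * m \<le> 3 * card {p\<in>S. l \<in> X p}" .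
  qed
  also have "\<dots> = 3 * (\<Sum>l<d'. card {p\<in>S. l \<in> X p})" by (rule sum_distrib_left[symmetric])
  also have "(\<Sum>l<d'. card {p\<in>S. l \<in> X p}) = (\<Sum>p\<in>S. card {l\<in>{..<d'}. l \<in> X p})"
    by (rule sum_multicount_gen) (use finS in auto)
  also have "\<dots> = (\<Sum>p\<in>S. card (X p))"
    by (intro sum.cong arg_cong[where f = card]) (auto simp: X_def)
  also have "\<dots> = (\<Sum>p\<in>S - G. card (X p)) + (\<Sum>p\<in>G. card (X p))"
    by (rule sum.subset_diff[OF _ finS]) (auto simp: G_def)
  also have "(\<Sum>p\<in>S - G. card (X p)) \<le> (\<Sum>p\<in>S - G. x)"
    by (rule sum_mono) (auto simp: G_def)
  also have "\<dots> \<le> (\<Sum>p\<in>?N. x)"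
    by (rule sum_mono2) (auto simp: S_def)
  also have "\<dots> = x * n\<^sup>2" by (simp add: power2_eq_square)
  also have "(\<Sum>p\<in>G. card (X p)) \<le> (\<Sum>p\<in>G. d')"
  proof (rule sum_mono)
    fix p
    have "card (X p) \<le> card {..<d'}" by (rule card_mono) (auto simp: X_def)
    then show "card (X p) \<le> d'" by simp
  qed
  finally have "d' * m\<^sup>2 \<le> 3 * (x * n\<^sup>2 + card G * d')" by simp
  moreover have "6 * (x * n\<^sup>2) \<le> d' * m\<^sup>2" using x by (simp only: mult.assoc)
  moreover have "A \<le> 3 * (X + Y) \<Longrightarrow> 6 * X \<le> A \<Longrightarrow> A \<le> 6 * Y" for A X Y :: nat by presburger
  ultimately have "d' * m\<^sup>2 \<le> 6 * (card G * d')" by blast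
  then have "d' * m\<^sup>2 \<le> d' * (6 * card G)" by (simp only: ac_simps)
  then have "m\<^sup>2 \<le> 6 * card G" using d by simp
  also have "card G \<le> card {(a, b). a < n \<and> b < n \<and> \<pi> \<in> pair_event n d d' B t \<rho> x a b}"
  proof (rule card_mono)
    show "finite {(a, b). a < n \<and> b < n \<and> \<pi> \<in> pair_event n d d' B t \<rho> x a b}"
      by (rule finite_subset[of _ ?N]) auto
    show "G \<subseteq> {(a, b). a < n \<and> b < n \<and> \<pi> \<in> pair_event n d d' B t \<rho> x a b}"
    proof clarify
      fix a b assume "(a, b) \<in> G"
      then have "a < n" "b < n" "cmod (w a - w b) \<ge> \<rho> / 2"
        "x \<le> card {l\<in>{..<d'}. cmod (u (\<pi> l a) - u (\<pi> l b)) \<ge> \<rho> / 2}"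
        by (simp_all add: G_def S_def X_def)
      then show "a < n \<and> b < n \<and> \<pi> \<in> pair_event n d d' B t \<rho> x a b"
        using nn pi unfolding pair_event_def by blast
    qed
  qed
  finally show ?thesis by simp
qed

text \<open>Every tuple of the event lies in at least m^2/6 of the n^2 pair events, so the average
  of their bounds is multiplied by 6 (n/m)^2.\<close>

lemma card_spread_event_le:
  assumes d: "d' \<le> d" "d' > 0" and n: "n > 0" and m: "m > 0"
    and x: "6 * x * n\<^sup>2 \<le> d' * m\<^sup>2"
    and t: "t \<ge> 0" and \<rho>: "\<rho> > 0" and small: "64 * real n * t < \<rho>\<^sup>2"
  shows "real (card (spread_event n d B t \<rho> m))
         \<le> 6 * (real n / real m)\<^sup>2 / sqrt (real x / 2 + 1) * real (card (perm_tuples n d))"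
proof -
  let ?E = "spread_event n d B t \<rho> m" and ?N = "{..<n} \<times> {..<n}"
  let ?P = "\<lambda>p. pair_event n d d' B t \<rho> x (fst p) (snd p)"
  have finE: "finite ?E" using finite_perm_tuples by (auto simp: spread_event_def)
  have "card ?E * m\<^sup>2 = (\<Sum>\<pi>\<in>?E. m\<^sup>2)" by simp
  also have "\<dots> \<le> (\<Sum>\<pi>\<in>?E. 6 * card {p\<in>?N. \<pi> \<in> ?P p})"
  proof (rule sum_mono)
    fix \<pi> assume "\<pi> \<in> ?E"
    then have "m\<^sup>2 \<le> 6 * card {(a, b). a < n \<and> b < n \<and> \<pi> \<in> pair_event n d d' B t \<rho> x a b}"
      by (rule many_pair_events[OF _ d n x])
    also have "{(a, b). a < n \<and> b < n \<and> \<pi> \<in> pair_event n d d' B t \<rho> x a b} = {p\<in>?N. \<pi> \<in> ?P p}" by auto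
    finally show "m\<^sup>2 \<le> 6 * card {p\<in>?N. \<pi> \<in> ?P p}" .
  qed
  also have "\<dots> = 6 * (\<Sum>\<pi>\<in>?E. card {p\<in>?N. \<pi> \<in> ?P p})" by (rule sum_distrib_left[symmetric])
  also have "(\<Sum>\<pi>\<in>?E. card {p\<in>?N. \<pi> \<in> ?P p}) = (\<Sum>p\<in>?N. card {\<pi>\<in>?E. \<pi> \<in> ?P p})"
    by (rule sum_multicount_gen) (use finE in auto)
  also have "\<dots> \<le> (\<Sum>p\<in>?N. card (?P p))"
    by (intro sum_mono card_mono) (auto simp: pair_event_def finite_perm_tuples)
  finally have "real (card ?E * m\<^sup>2) \<le> real (6 * (\<Sum>p\<in>?N. card (?P p)))"
    by (simp only: of_nat_le_iff)
  also have "\<dots> = 6 * (\<Sum>p\<in>?N. real (card (?P p)))" by (simp only: of_nat_mult of_nat_sum of_nat_numeral)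
  also have "\<dots> \<le> 6 * (\<Sum>p\<in>?N. 1 / sqrt (real x / 2 + 1) * real (card (perm_tuples n d)))"
    by (intro mult_left_mono sum_mono card_pair_event_le d t \<rho> small) auto
  also have "\<dots> = 6 * real n ^ 2 * (1 / sqrt (real x / 2 + 1) * real (card (perm_tuples n d)))"
    by (simp add: power2_eq_square)
  finally have "real (card ?E) * real m ^ 2 \<le> \<dots>" by simp
  then have "real (card ?E) \<le> 6 * real n ^ 2 * (1 / sqrt (real x / 2 + 1) * real (card (perm_tuples n d))) / real m ^ 2"
    using m by (subst pos_le_divide_eq) auto
  then show ?thesis by (simp add: power_divide mult.commute)
qed

section \<open>Nets of sparse vectors\<close>

definition sparse_fns :: "nat \<Rightarrow> nat \<Rightarrow> complex set \<Rightarrow> (nat \<Rightarrow> complex) set" where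
  "sparse_fns n m V = {y. \<exists>H\<subseteq>{..<n}. card H \<le> m \<and> (\<forall>i\<in>H. y i \<in> V) \<and> (\<forall>i. i \<notin> H \<longrightarrow> y i = 0)}"

text \<open>One more support point means overwriting one entry, with \<open>n * card V\<close>
  choices. An empty support is written as overwriting entry 0 by the value 0, hence
  \<open>0 \<in> V\<close> and \<open>n > 0\<close>.\<close>

lemma card_sparse_fns_le:
  assumes "finite V" "0 \<in> V" "n > 0"
  shows "finite (sparse_fns n m V) \<and> card (sparse_fns n m V) \<le> (n * card V) ^ m"
proof (induction m)
  case 0
  have "sparse_fns n 0 V \<subseteq> {\<lambda>_. 0}"
  proof
    fix y assume "y \<in> sparse_fns n 0 V"
    then obtain H where H: "H \<subseteq> {..<n}" "card H = 0" "\<forall>i. i \<notin> H \<longrightarrow> y i = 0"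
      by (auto simp: sparse_fns_def)
    then have "H = {}" using finite_subset[OF H(1)] by simp
    then show "y \<in> {\<lambda>_. 0}" using H by auto
  qed
  then show ?case using finite_subset card_mono[of "{\<lambda>_. 0}" "sparse_fns n 0 V"] by fastforce
next
  case (Suc m)
  let ?f = "\<lambda>(y, i, v). (y(i := v) :: nat \<Rightarrow> complex)"
  let ?D = "sparse_fns n m V \<times> {..<n} \<times> V"
  have sub: "sparse_fns n (Suc m) V \<subseteq> ?f ` ?D"
  proof
    fix y assume "y \<in> sparse_fns n (Suc m) V"
    then obtain H where H: "H \<subseteq> {..<n}" "card H \<le> Suc m" "\<forall>i\<in>H. y i \<in> V" "\<forall>i. i \<notin> H \<longrightarrow> y i = 0"
      by (auto simp: sparse_fns_def)
    show "y \<in> ?f ` ?D"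
    proof (cases "H = {}")
      case True
      then have "y \<in> sparse_fns n m V" "y 0 = 0" using H unfolding sparse_fns_def by auto
      moreover have "y = ?f (y, 0, 0)" using \<open>y 0 = 0\<close> by auto
      ultimately show ?thesis using assms by blast
    next
      case False
      then obtain i where i: "i \<in> H" by auto
      have "finite H" using H(1) finite_subset by blast
      then have "card (H - {i}) \<le> m" using i H(2) by simp
      then have "y(i := 0) \<in> sparse_fns n m V"
        unfolding sparse_fns_def using H by (intro CollectI exI[of _ "H - {i}"]) auto
      moreover have "y = ?f (y(i := 0), i, y i)" by auto
      ultimately show ?thesis using i H by blast
    qed
  qed
  have fin: "finite ?D" using Suc assms by auto
  have "card (sparse_fns n (Suc m) V) \<le> card ?D"
    using card_mono[OF finite_imageI[OF fin] sub] card_image_le[OF fin, of ?f] by linarith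
  also have "\<dots> = card (sparse_fns n m V) * (n * card V)" by (simp add: card_cartesian_product)
  also have "\<dots> \<le> (n * card V) ^ m * (n * card V)" using Suc by (intro mult_le_mono1) auto
  finally show ?case using finite_subset[OF sub finite_imageI[OF fin]] by (simp add: mult.commute)
qed

definition grid_round :: "real \<Rightarrow> complex \<Rightarrow> complex" where
  "grid_round \<eta> z = Complex (\<eta> / 2 * of_int \<lfloor>2 * Re z / \<eta>\<rfloor>) (\<eta> / 2 * of_int \<lfloor>2 * Im z / \<eta>\<rfloor>)"

text \<open>The \<open>+ 1\<close> covers negative coordinates, whose floor can be one below the
  negated floor of the opposite number.\<close>

definition grid :: "real \<Rightarrow> real \<Rightarrow> complex set" where
  "grid \<eta> R = (\<lambda>(a, b). Complex (\<eta> / 2 * of_int a) (\<eta> / 2 * of_int b)) `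
     ({- (\<lfloor>2 * R / \<eta>\<rfloor> + 1) .. \<lfloor>2 * R / \<eta>\<rfloor> + 1} \<times> {- (\<lfloor>2 * R / \<eta>\<rfloor> + 1) .. \<lfloor>2 * R / \<eta>\<rfloor> + 1})"

lemma grid_round_error:
  assumes "\<eta> > 0"
  shows "cmod (z - grid_round \<eta> z) \<le> \<eta>"
proof -
  have r: "\<bar>x - \<eta> / 2 * of_int \<lfloor>2 * x / \<eta>\<rfloor>\<bar> \<le> \<eta> / 2" for x
  proof -
    have "\<bar>2 * x / \<eta> - of_int \<lfloor>2 * x / \<eta>\<rfloor>\<bar> \<le> 1" by linarith
    then have "\<eta> / 2 * \<bar>2 * x / \<eta> - of_int \<lfloor>2 * x / \<eta>\<rfloor>\<bar> \<le> \<eta> / 2 * 1"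
      using assms by (intro mult_left_mono) auto
    moreover have "\<eta> / 2 * \<bar>2 * x / \<eta> - of_int \<lfloor>2 * x / \<eta>\<rfloor>\<bar> = \<bar>\<eta> / 2 * (2 * x / \<eta> - of_int \<lfloor>2 * x / \<eta>\<rfloor>)\<bar>"
      using assms by (simp add: abs_mult)
    moreover have "\<eta> / 2 * (2 * x / \<eta> - of_int \<lfloor>2 * x / \<eta>\<rfloor>) = x - \<eta> / 2 * of_int \<lfloor>2 * x / \<eta>\<rfloor>"
      using assms by (simp add: right_diff_distrib)
    ultimately show ?thesis by simp
  qed
  have "cmod (z - grid_round \<eta> z) \<le> \<bar>Re (z - grid_round \<eta> z)\<bar> + \<bar>Im (z - grid_round \<eta> z)\<bar>" by (rule cmod_le)
  also have "\<dots> \<le> \<eta> / 2 + \<eta> / 2" using r[of "Re z"] r[of "Im z"] by (intro add_mono) (auto simp: grid_round_def)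
  finally show ?thesis by simp
qed

lemma grid_round_in_grid:
  assumes "\<eta> > 0" "cmod z \<le> R"
  shows "grid_round \<eta> z \<in> grid \<eta> R"
proof -
  have f: "\<lfloor>2 * x / \<eta>\<rfloor> \<in> {- (\<lfloor>2 * R / \<eta>\<rfloor> + 1) .. \<lfloor>2 * R / \<eta>\<rfloor> + 1}" if "\<bar>x\<bar> \<le> R" for x
  proof -
    have "2 * x / \<eta> \<le> 2 * R / \<eta>" "- (2 * R / \<eta>) \<le> 2 * x / \<eta>"
      using that assms(1) by (auto simp: divide_simps)
    then show ?thesis by (simp add: floor_le_iff le_floor_iff) linarith
  qed
  have "\<bar>Re z\<bar> \<le> R" "\<bar>Im z\<bar> \<le> R" using assms(2) abs_Re_le_cmod[of z] abs_Im_le_cmod[of z] by auto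
  then show ?thesis using f unfolding grid_round_def grid_def by (intro image_eqI[of _ _ "(\<lfloor>2 * Re z / \<eta>\<rfloor>, \<lfloor>2 * Im z / \<eta>\<rfloor>)"]) auto
qed

lemma card_grid_le:
  assumes "\<eta> > 0" "\<eta> \<le> 1/4" "R \<ge> 1"
  shows "finite (grid \<eta> R)" "0 \<in> grid \<eta> R" "real (card (grid \<eta> R)) \<le> 25 * (R / \<eta>)\<^sup>2"
proof -
  show fin: "finite (grid \<eta> R)" by (simp add: grid_def)
  have "grid_round \<eta> 0 \<in> grid \<eta> R" by (rule grid_round_in_grid) (use assms in auto)
  then show "0 \<in> grid \<eta> R" by (simp add: grid_round_def zero_complex.code[symmetric])
  let ?K = "\<lfloor>2 * R / \<eta>\<rfloor> + 1"
  have R\<eta>: "R / \<eta> \<ge> 4" using assms by (simp add: pos_le_divide_eq)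
  have K0: "?K \<ge> 0" using assms by simp
  have "card (grid \<eta> R) \<le> card ({- ?K .. ?K} \<times> {- ?K .. ?K})"
    unfolding grid_def by (rule card_image_le) auto
  then have 1: "real (card (grid \<eta> R)) \<le> real (card {- ?K .. ?K}) ^ 2"
    by (simp only: card_cartesian_product power2_eq_square flip: of_nat_mult)
  have "real (card {- ?K .. ?K}) = 2 * real_of_int ?K + 1" using K0 by simp
  also have "\<dots> \<le> 5 * (R / \<eta>)"
  proof -
    have "real_of_int ?K \<le> 2 * (R / \<eta>) + 1" by simp
    moreover have "k \<le> 2 * r + 1 \<Longrightarrow> 4 \<le> r \<Longrightarrow> 2 * k + 1 \<le> 5 * r" for k r :: real by linarith
    ultimately show ?thesis using R\<eta> by blast
  qed
  finally have "real (card {- ?K .. ?K}) ^ 2 \<le> (5 * (R / \<eta>)) ^ 2" by (rule power_mono) simp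
  also have "\<dots> = 25 * (R / \<eta>)\<^sup>2" unfolding power_mult_distrib by simp
  finally show "real (card (grid \<eta> R)) \<le> 25 * (R / \<eta>)\<^sup>2" using 1 by linarith
qed

text \<open>The few entries above \<open>1/\<eta>\<close> are counted separately by \<open>m1\<close>: they may be as large as \<open>R\<close> and are costly in a net,
  while the remaining at most \<open>m'\<close> entries only range over \<open>[\<eta>, 1/\<eta>]\<close>.\<close>

definition peaked :: "nat \<Rightarrow> nat \<Rightarrow> nat \<Rightarrow> nat \<Rightarrow> real \<Rightarrow> real \<Rightarrow> (nat \<Rightarrow> complex) \<Rightarrow> bool" where
  "peaked n m1 m m' \<eta> R x \<longleftrightarrow> m \<le> card {i. i < n \<and> cmod (x i) \<ge> 1} \<and>
     card {i. i < n \<and> cmod (x i) \<ge> \<eta>} \<le> m' \<and> card {i. i < n \<and> cmod (x i) > 1 / \<eta>} \<le> m1 \<and>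
     (\<forall>i<n. cmod (x i) \<le> R)"

lemma row_action_diff_le:
  assumes pi: "\<pi> \<in> perm_tuples n d" and B: "\<And>i j. i < n \<Longrightarrow> j < n \<Longrightarrow> cmod (B i j) \<le> b"
    and i: "i < n" and xy: "\<And>j. j < n \<Longrightarrow> cmod (x j - y j) \<le> e" and e: "e \<ge> 0"
  shows "cmod (row_action n d B \<pi> x i - row_action n d B \<pi> y i) \<le> (real d + real n * b) * e"
proof -
  have "row_action n d B \<pi> x i - row_action n d B \<pi> y i
      = (\<Sum>l<d. x (\<pi> l i) - y (\<pi> l i)) + (\<Sum>j<n. B i j * (x j - y j))"
    by (simp add: row_action_def sum_subtractf algebra_simps)
  also have "cmod \<dots> \<le> cmod (\<Sum>l<d. x (\<pi> l i) - y (\<pi> l i)) + cmod (\<Sum>j<n. B i j * (x j - y j))"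
    by (rule norm_triangle_ineq)
  also have "\<dots> \<le> (\<Sum>l<d. e) + (\<Sum>j<n. b * e)"
  proof (intro add_mono sum_norm_le)
    fix l assume "l \<in> {..<d}"
    then have "\<pi> l i < n" using perm_tuplesD[OF pi, of l] permutes_in_image[of "\<pi> l" "{..<n}" i] i by auto
    then show "cmod (x (\<pi> l i) - y (\<pi> l i)) \<le> e" by (rule xy)
  next
    fix j assume "j \<in> {..<n}"
    then show "cmod (B i j * (x j - y j)) \<le> b * e"
      unfolding norm_mult using B[OF i, of j] xy[of j] norm_ge_zero[of "B i j"]
      by (intro mult_mono) (auto intro: order_trans[OF norm_ge_zero])
  qed
  finally show ?thesis by (simp add: algebra_simps)
qed

text \<open>Rounding sends the at most \<open>m1\<close> huge entries to \<open>y1\<close> on a grid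
  of radius \<open>R\<close>, the at most \<open>m'\<close> moderate ones to \<open>y2\<close> on a
  grid of radius \<open>1 / \<eta>\<close>, and those below \<open>\<eta>\<close> to 0. The error
  \<open>\<eta>\<close> changes the image by at most 1/16 and leaves \<open>m\<close> entries of
  modulus at least 1/2, so the bound for a fixed vector applies to each such net point. The two
  powers count the net.\<close>

lemma card_peaked_near_null_le:
  assumes B: "\<And>i j. i < n \<Longrightarrow> j < n \<Longrightarrow> cmod (B i j) \<le> b" and \<Lambda>: "(real d + real n * b) * \<eta> \<le> 1/16"
    and \<eta>: "\<eta> > 0" "\<eta> \<le> 1/4" and R: "R \<ge> 1" and n: "n > 0" and d: "d' \<le> d"
    and h: "4 * h \<le> m * d'" "12 * h \<le> n" and room: "m1 + m + m' \<le> n"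
  shows "real (card {\<pi>\<in>perm_tuples n d. \<exists>x. peaked n m1 m m' \<eta> R x \<and> (\<forall>i<n. cmod (row_action n d B \<pi> x i) \<le> 1/16)})
    \<le> (25 * real n * (R / \<eta>)\<^sup>2) ^ m1 * (25 * real n * (1 / \<eta>\<^sup>2)\<^sup>2) ^ m' * (2 * (1/2) ^ h) * real (card (perm_tuples n d))"
proof -
  let ?\<Omega> = "perm_tuples n d"
  let ?E = "{\<pi>\<in>?\<Omega>. \<exists>x. peaked n m1 m m' \<eta> R x \<and> (\<forall>i<n. cmod (row_action n d B \<pi> x i) \<le> 1/16)}"
  let ?N1 = "sparse_fns n m1 (grid \<eta> R)" and ?N2 = "sparse_fns n m' (grid \<eta> (1 / \<eta>))"
  have R2: "1 / \<eta> \<ge> 1" using \<eta> by (simp add: pos_le_divide_eq)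
  note g1 = card_grid_le[OF \<eta> R] and g2 = card_grid_le[OF \<eta> R2]
  note N1 = card_sparse_fns_le[OF g1(1,2) n, of m1] and N2 = card_sparse_fns_le[OF g2(1,2) n, of m']
  define Y where "Y = {p \<in> ?N1 \<times> ?N2. m \<le> card {i. i < n \<and> cmod (fst p i + snd p i) \<ge> 1/2}}"
  define ev where "ev p = {\<pi>\<in>?\<Omega>. \<forall>i<n. cmod (row_action n d B \<pi> (\<lambda>i. fst p i + snd p i) i) < 1/4}" for p
  have finY: "finite Y" unfolding Y_def using N1 N2 by auto
  have "card Y \<le> card (?N1 \<times> ?N2)" unfolding Y_def by (rule card_mono) (use N1 N2 in auto)
  then have "card Y \<le> (n * card (grid \<eta> R)) ^ m1 * (n * card (grid \<eta> (1 / \<eta>))) ^ m'"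
    unfolding card_cartesian_product using mult_le_mono[OF conjunct2[OF N1] conjunct2[OF N2]] by linarith
  then have "real (card Y) \<le> real ((n * card (grid \<eta> R)) ^ m1 * (n * card (grid \<eta> (1 / \<eta>))) ^ m')"
    by (rule of_nat_mono)
  also have "\<dots> = (real n * real (card (grid \<eta> R))) ^ m1 * (real n * real (card (grid \<eta> (1 / \<eta>)))) ^ m'" by simp
  also have "\<dots> \<le> (real n * (25 * (R / \<eta>)\<^sup>2)) ^ m1 * (real n * (25 * (1 / \<eta> / \<eta>)\<^sup>2)) ^ m'"
    by (intro mult_mono power_mono mult_left_mono g1 g2) auto
  also have "\<dots> = (25 * real n * (R / \<eta>)\<^sup>2) ^ m1 * (25 * real n * (1 / \<eta>\<^sup>2)\<^sup>2) ^ m'"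
    by (simp add: power2_eq_square mult_ac)
  finally have cardY: "real (card Y) \<le> \<dots>" .
  have "?E \<subseteq> (\<Union>p\<in>Y. ev p)"
  proof
    fix \<pi> assume "\<pi> \<in> ?E"
    then obtain x where pi: "\<pi> \<in> ?\<Omega>" and pk: "peaked n m1 m m' \<eta> R x"
      and Tx: "\<And>i. i < n \<Longrightarrow> cmod (row_action n d B \<pi> x i) \<le> 1/16" by blast
    define y1 where "y1 i = (if i < n \<and> cmod (x i) > 1 / \<eta> then grid_round \<eta> (x i) else 0)" for i
    define y2 where "y2 i = (if i < n \<and> cmod (x i) \<ge> \<eta> \<and> cmod (x i) \<le> 1 / \<eta> then grid_round \<eta> (x i) else 0)" for i
    let ?y = "\<lambda>i. y1 i + y2 i"
    have y1N: "y1 \<in> ?N1" unfolding sparse_fns_def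
      using pk \<eta> by (intro CollectI exI[of _ "{i. i < n \<and> cmod (x i) > 1 / \<eta>}"])
        (auto simp: y1_def peaked_def intro!: grid_round_in_grid)
    have y2N: "y2 \<in> ?N2" unfolding sparse_fns_def
    proof (intro CollectI exI[of _ "{i. i < n \<and> cmod (x i) \<ge> \<eta> \<and> cmod (x i) \<le> 1 / \<eta>}"] conjI)
      have "card {i. i < n \<and> cmod (x i) \<ge> \<eta> \<and> cmod (x i) \<le> 1 / \<eta>} \<le> card {i. i < n \<and> cmod (x i) \<ge> \<eta>}"
        by (rule card_mono) auto
      then show "card {i. i < n \<and> cmod (x i) \<ge> \<eta> \<and> cmod (x i) \<le> 1 / \<eta>} \<le> m'"
        using pk by (simp add: peaked_def)
    qed (use \<eta> in \<open>auto simp: y2_def intro!: grid_round_in_grid\<close>)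
    have close: "cmod (x i - ?y i) \<le> \<eta>" if "i < n" for i
    proof -
      consider "cmod (x i) > 1 / \<eta>" | "cmod (x i) \<ge> \<eta>" "cmod (x i) \<le> 1 / \<eta>" | "cmod (x i) < \<eta>" "cmod (x i) \<le> 1 / \<eta>"
        by linarith
      then show ?thesis
        by cases (use that grid_round_error[OF \<eta>(1), of "x i"] in \<open>auto simp: y1_def y2_def\<close>)
    qed
    have "m \<le> card {i. i < n \<and> cmod (x i) \<ge> 1}" using pk by (simp add: peaked_def)
    also have "\<dots> \<le> card {i. i < n \<and> cmod (?y i) \<ge> 1/2}"
    proof (rule card_mono)
      show "{i. i < n \<and> cmod (x i) \<ge> 1} \<subseteq> {i. i < n \<and> cmod (?y i) \<ge> 1/2}"
      proof
        fix i assume "i \<in> {i. i < n \<and> cmod (x i) \<ge> 1}"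
        then have i: "i < n" "cmod (x i) \<ge> 1" by auto
        have "cmod (x i) \<le> cmod (x i - ?y i) + cmod (?y i)"
          using norm_triangle_ineq[of "x i - ?y i" "?y i"] by simp
        then have "cmod (?y i) \<ge> 1/2" using close[OF i(1)] i \<eta> by linarith
        then show "i \<in> {i. i < n \<and> cmod (?y i) \<ge> 1/2}" using i by simp
      qed
    qed simp
    finally have "m \<le> card {i. i < n \<and> cmod (?y i) \<ge> 1/2}" .
    then have "(y1, y2) \<in> Y" using y1N y2N by (simp add: Y_def)
    moreover have "\<pi> \<in> ev (y1, y2)"
    proof -
      have "cmod (row_action n d B \<pi> ?y i) < 1/4" if i: "i < n" for i
      proof -
        have "cmod (row_action n d B \<pi> x i - row_action n d B \<pi> ?y i) \<le> 1/16"
          by (rule order_trans[OF row_action_diff_le[OF pi _ i _ less_imp_le[OF \<eta>(1)]] \<Lambda>]) (use B close in auto)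
        moreover have "cmod (row_action n d B \<pi> ?y i) \<le> cmod (row_action n d B \<pi> x i) + cmod (row_action n d B \<pi> x i - row_action n d B \<pi> ?y i)"
          using norm_triangle_ineq4[of "row_action n d B \<pi> x i" "row_action n d B \<pi> x i - row_action n d B \<pi> ?y i"] by simp
        ultimately show ?thesis using Tx[OF i] by linarith
      qed
      then show ?thesis using pi by (simp add: ev_def)
    qed
    ultimately show "\<pi> \<in> (\<Union>p\<in>Y. ev p)" by blast
  qed
  then have "card ?E \<le> card (\<Union>p\<in>Y. ev p)"
    by (rule card_mono[rotated]) (use finY finite_perm_tuples in \<open>auto simp: ev_def\<close>)
  also have "\<dots> \<le> (\<Sum>p\<in>Y. card (ev p))" by (rule card_UN_le[OF finY])
  finally have "real (card ?E) \<le> (\<Sum>p\<in>Y. real (card (ev p)))" by (simp flip: of_nat_sum)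
  also have "\<dots> \<le> (\<Sum>p\<in>Y. 2 * (1/2) ^ h * real (card ?\<Omega>))"
  proof (rule sum_mono)
    fix p assume p: "p \<in> Y"
    let ?y = "\<lambda>i. fst p i + snd p i"
    from p obtain H1 H2 where H: "H1 \<subseteq> {..<n}" "card H1 \<le> m1" "\<forall>i. i \<notin> H1 \<longrightarrow> fst p i = 0"
      "H2 \<subseteq> {..<n}" "card H2 \<le> m'" "\<forall>i. i \<notin> H2 \<longrightarrow> snd p i = 0"
      by (auto simp: Y_def sparse_fns_def)
    obtain J where J: "J \<subseteq> {i. i < n \<and> cmod (?y i) \<ge> 1/2}" "card J = m"
      using p obtain_subset_with_card_n[of m "{i. i < n \<and> cmod (?y i) \<ge> 1/2}"] by (auto simp: Y_def)
    \<comment> \<open>Outside both supports, \<open>room\<close> leaves \<open>m\<close> zeros to be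
      exchanged with the large entries.\<close>
    have "card (H1 \<union> H2) \<le> m1 + m'" using card_Un_le[of H1 H2] H by linarith
    moreover have "card ({..<n} - (H1 \<union> H2)) = n - card (H1 \<union> H2)"
      using H finite_subset[OF H(1)] finite_subset[OF H(4)] by (subst card_Diff_subset) auto
    ultimately have "m \<le> card ({..<n} - (H1 \<union> H2))" using room by linarith
    then obtain Z where Z: "Z \<subseteq> {..<n} - (H1 \<union> H2)" "card Z = m"
      using obtain_subset_with_card_n[of m "{..<n} - (H1 \<union> H2)"] by auto
    have "real (card {\<pi>\<in>perm_tuples n d. \<forall>i<n. cmod ((\<Sum>l<d. ?y (\<pi> l i)) + (\<Sum>j<n. B i j * ?y j)) < 1/4})
         \<le> 2 * (1/2) ^ h * real (card (perm_tuples n d))"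
    proof (rule card_small_image_fixed_vector[where J = J and Z = Z])
      show "?y j = 0" if "j \<in> Z" for j
      proof -
        have "j \<notin> H1" "j \<notin> H2" using that Z by auto
        then show ?thesis using H by simp
      qed
    qed (use J Z d n h in auto)
    then show "real (card (ev p)) \<le> 2 * (1/2) ^ h * real (card ?\<Omega>)"
      by (simp add: ev_def row_action_def)
  qed
  also have "\<dots> = real (card Y) * (2 * (1/2) ^ h * real (card ?\<Omega>))" by simp
  also have "\<dots> \<le> ((25 * real n * (R / \<eta>)\<^sup>2) ^ m1 * (25 * real n * (1 / \<eta>\<^sup>2)\<^sup>2) ^ m') * (2 * (1/2) ^ h * real (card ?\<Omega>))"
    by (rule mult_right_mono[OF cardY]) simp
  finally show ?thesis by (simp only: mult.assoc)
qed

section \<open>Decay of the order statistics\<close>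

text \<open>An order statistic counted with multiplicity, without sorting; meaningful for m between
  1 and n.\<close>

definition kth_largest :: "nat \<Rightarrow> (nat \<Rightarrow> complex) \<Rightarrow> nat \<Rightarrow> real" where
  "kth_largest n x m = Max {s \<in> (\<lambda>i. cmod (x i)) ` {..<n}. m \<le> card {i. i < n \<and> cmod (x i) \<ge> s}}"

lemma kth_largest_card_ge:
  assumes "m \<le> n" "n > 0"
  shows "m \<le> card {i. i < n \<and> cmod (x i) \<ge> kth_largest n x m}"
proof -
  let ?S = "{s \<in> (\<lambda>i. cmod (x i)) ` {..<n}. m \<le> card {i. i < n \<and> cmod (x i) \<ge> s}}"
  let ?I = "(\<lambda>i. cmod (x i)) ` {..<n}"
  have "Min ?I \<in> ?I" using assms by (intro Min_in) auto
  moreover have "{i. i < n \<and> cmod (x i) \<ge> Min ?I} = {..<n}" by auto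
  ultimately have "Min ?I \<in> ?S" using assms by simp
  then have "Max ?S \<in> ?S" by (intro Max_in) auto
  then show ?thesis unfolding kth_largest_def by blast
qed

lemma card_greater_kth_largest:
  assumes "m > 0"
  shows "card {i. i < n \<and> cmod (x i) > kth_largest n x m} < m"
proof (rule ccontr)
  let ?S = "{s \<in> (\<lambda>i. cmod (x i)) ` {..<n}. m \<le> card {i. i < n \<and> cmod (x i) \<ge> s}}"
  let ?U = "{i. i < n \<and> cmod (x i) > kth_largest n x m}"
  let ?s = "Min ((\<lambda>i. cmod (x i)) ` ?U)"
  assume "\<not> card ?U < m"
  then have m: "m \<le> card ?U" by simp
  then have "?U \<noteq> {}" using assms by (metis card.empty le_zero_eq less_not_refl)
  then have s: "?s \<in> (\<lambda>i. cmod (x i)) ` ?U" by (intro Min_in) auto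
  have "card ?U \<le> card {i. i < n \<and> cmod (x i) \<ge> ?s}" by (rule card_mono) auto
  then have "?s \<in> ?S" using s m by auto
  then have "?s \<le> kth_largest n x m" unfolding kth_largest_def by (intro Max_ge) auto
  then show False using s by auto
qed

lemma card_ge_above_kth_largest:
  assumes "m > 0" "s > kth_largest n x m"
  shows "card {i. i < n \<and> cmod (x i) \<ge> s} < m"
proof -
  have "card {i. i < n \<and> cmod (x i) \<ge> s} \<le> card {i. i < n \<and> cmod (x i) > kth_largest n x m}"
    by (rule card_mono) (use assms in auto)
  then show ?thesis using card_greater_kth_largest[OF assms(1), of n x] by linarith
qed

lemma le_first_largest:
  assumes "i < n"
  shows "cmod (x i) \<le> kth_largest n x 1"
proof -
  have "{i. i < n \<and> cmod (x i) > kth_largest n x 1} = {}"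
    using card_greater_kth_largest[of 1 n x] by simp
  then show ?thesis using assms by (metis (mono_tags, lifting) empty_Collect_eq not_less)
qed

lemma row_action_divide: "row_action n d B \<pi> (\<lambda>i. x i / c) i = row_action n d B \<pi> x i / c"
  by (simp add: row_action_def sum_divide_distrib add_divide_distrib)

text \<open>The vector is thought of as divided by its \<open>f k\<close>-th largest modulus. Slow
  decay up to step \<open>k\<close> then bounds all entries by \<open>(1 / \<eta>) ^ k\<close> and
  leaves fewer than \<open>f (k - 1)\<close> of them above \<open>1 / \<eta>\<close>. At
  \<open>k = 0\<close> the divisor is the maximum, so none is above.\<close>

definition peak_event :: "nat \<Rightarrow> nat \<Rightarrow> (nat \<Rightarrow> nat \<Rightarrow> complex) \<Rightarrow> real \<Rightarrow> (nat \<Rightarrow> nat) \<Rightarrow> nat \<Rightarrow> (nat \<Rightarrow> nat \<Rightarrow> nat) set" where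
  "peak_event n d B \<eta> f k = {\<pi>\<in>perm_tuples n d. \<exists>x.
     peaked n (if k = 0 then 0 else f (k - 1)) (f k) (f (Suc k)) \<eta> ((1 / \<eta>) ^ k) x \<and>
     (\<forall>i<n. cmod (row_action n d B \<pi> x i) \<le> 1/16)}"

text \<open>The first drop of the order statistics by more than a factor \<open>\<eta>\<close>
  would, after normalisation, be a peak. Without peaks, \<open>K\<close> steps lose at most
  \<open>\<eta> ^ K\<close> from the maximum, which is at least \<open>s\<close>.\<close>

lemma no_peak_imp_slow_decay:
  assumes n: "n > 0" and f: "f 0 = 1" "\<And>k. k \<le> K \<Longrightarrow> 1 \<le> f k \<and> f k \<le> n"
    and \<eta>: "0 < \<eta>" "\<eta> \<le> 1" and pi: "\<pi> \<in> perm_tuples n d"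
    and nopeak: "\<And>k. k < K \<Longrightarrow> \<pi> \<notin> peak_event n d B \<eta> f k"
    and Tx: "\<And>i. i < n \<Longrightarrow> cmod (row_action n d B \<pi> x i) \<le> t"
    and s: "0 < s" "\<exists>i<n. cmod (x i) \<ge> s" and t: "16 * t \<le> \<eta> ^ K * s"
  shows "f K \<le> card {i. i < n \<and> cmod (x i) \<ge> \<eta> ^ K * s}"
proof -
  define a where "a k = kth_largest n x (f k)" for k
  have a0: "cmod (x i) \<le> a 0" if "i < n" for i
    using le_first_largest[OF that, of x] by (simp add: a_def f)
  then have a0s: "a 0 \<ge> s" using s(2) by (meson order_trans)
  \<comment> \<open>All earlier ratios are carried along: the ratio just before step
    \<open>k\<close> controls how many entries exceed \<open>1 / \<eta>\<close> after normalisation.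
    The lower bound on \<open>a k\<close> keeps the image below 1/16 after division by
    \<open>a k\<close>.\<close>
  have main: "k \<le> K \<Longrightarrow> \<eta> ^ k * a 0 \<le> a k \<and> (\<forall>j<k. \<eta> * a j \<le> a (Suc j))" for k
  proof (induction k)
    case 0
    then show ?case by simp
  next
    case (Suc k)
    then have IH: "\<eta> ^ k * a 0 \<le> a k" "\<And>j. j < k \<Longrightarrow> \<eta> * a j \<le> a (Suc j)" and k: "k < K" by auto
    have "\<eta> ^ K * s \<le> \<eta> ^ k * a 0"
      using a0s \<eta> s k by (intro mult_mono power_decreasing) auto
    then have ak: "\<eta> ^ K * s \<le> a k" using IH by linarith
    have "\<eta> ^ K * s > 0" using \<eta> s by simp
    then have ak0: "a k > 0" using ak by linarith
    have step: "\<eta> * a k \<le> a (Suc k)"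
    proof (rule ccontr)
      assume "\<not> \<eta> * a k \<le> a (Suc k)"
      then have drop: "\<eta> * a k > a (Suc k)" by simp
      let ?y = "\<lambda>i. x i / of_real (a k)"
      have ny: "cmod (?y i) = cmod (x i) / a k" for i using ak0 by (simp add: norm_divide)
      have "\<pi> \<in> peak_event n d B \<eta> f k"
        unfolding peak_event_def
      proof (intro CollectI conjI exI[of _ ?y] pi)
        show "peaked n (if k = 0 then 0 else f (k - 1)) (f k) (f (Suc k)) \<eta> ((1 / \<eta>) ^ k) ?y"
          unfolding peaked_def
        proof (intro conjI allI impI)
          have "{i. i < n \<and> cmod (?y i) \<ge> 1} = {i. i < n \<and> cmod (x i) \<ge> a k}"
            using ak0 by (auto simp: ny pos_le_divide_eq)
          then show "f k \<le> card {i. i < n \<and> cmod (?y i) \<ge> 1}"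
            using kth_largest_card_ge[of "f k" n x] f(2)[of k] k n by (simp add: a_def)
          have "{i. i < n \<and> cmod (?y i) \<ge> \<eta>} = {i. i < n \<and> cmod (x i) \<ge> \<eta> * a k}"
            using ak0 by (auto simp: ny pos_le_divide_eq)
          then show "card {i. i < n \<and> cmod (?y i) \<ge> \<eta>} \<le> f (Suc k)"
            using card_ge_above_kth_largest[of "f (Suc k)" n x "\<eta> * a k"] drop f(2)[of "Suc k"] k
            by (simp add: a_def)
          show "card {i. i < n \<and> cmod (?y i) > 1 / \<eta>} \<le> (if k = 0 then 0 else f (k - 1))"
          proof (cases k)
            case 0
            have "cmod (?y i) \<le> 1 / \<eta>" if "i < n" for i
            proof -
              have "cmod (?y i) \<le> 1" unfolding ny using a0[OF that] ak0 0 by (simp add: pos_divide_le_eq)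
              also have "1 \<le> 1 / \<eta>" using \<eta> by simp
              finally show ?thesis .
            qed
            then have "{i. i < n \<and> cmod (?y i) > 1 / \<eta>} = {}" by fastforce
            then show ?thesis by (simp only: card.empty)
          next
            case (Suc j)
            have aj: "\<eta> * a j \<le> a k" using IH(2)[of j] Suc by simp
            have "{i. i < n \<and> cmod (?y i) > 1 / \<eta>} \<subseteq> {i. i < n \<and> cmod (x i) > kth_largest n x (f j)}"
            proof
              fix i assume i: "i \<in> {i. i < n \<and> cmod (?y i) > 1 / \<eta>}"
              then have "a k < \<eta> * cmod (x i)" using ak0 \<eta> by (auto simp: ny field_simps)
              then have "\<eta> * a j < \<eta> * cmod (x i)" using aj by linarith
              then show "i \<in> {i. i < n \<and> cmod (x i) > kth_largest n x (f j)}"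
                using i \<eta> by (simp add: a_def)
            qed
            then have "card {i. i < n \<and> cmod (?y i) > 1 / \<eta>} \<le> card {i. i < n \<and> cmod (x i) > kth_largest n x (f j)}"
              by (rule card_mono[rotated]) auto
            also have "\<dots> < f j" using card_greater_kth_largest[of "f j" n x] f(2)[of j] k Suc by simp
            finally show ?thesis using Suc by simp
          qed
          fix i assume i: "i < n"
          have "\<eta> ^ k * cmod (x i) \<le> \<eta> ^ k * a 0" using a0[OF i] \<eta> by (intro mult_left_mono) auto
          then have "\<eta> ^ k * cmod (x i) \<le> a k" using IH(1) by linarith
          then show "cmod (?y i) \<le> (1 / \<eta>) ^ k"
            using ak0 \<eta> by (simp add: ny power_one_over field_simps)
        qed
        show "\<forall>i<n. cmod (row_action n d B \<pi> ?y i) \<le> 1/16"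
        proof (intro allI impI)
          fix i assume "i < n"
          then have "16 * cmod (row_action n d B \<pi> x i) \<le> a k" using Tx[of i] t ak by linarith
          then show "cmod (row_action n d B \<pi> ?y i) \<le> 1/16"
            using ak0 by (simp add: row_action_divide norm_divide field_simps)
        qed
      qed
      then show False using nopeak k by blast
    qed
    have "\<eta> ^ Suc k * a 0 \<le> \<eta> * a k" using mult_left_mono[OF IH(1), of \<eta>] \<eta> by (simp add: mult.assoc)
    then have "\<eta> ^ Suc k * a 0 \<le> a (Suc k)" using step by linarith
    moreover have "\<forall>j<Suc k. \<eta> * a j \<le> a (Suc j)" using IH(2) step less_Suc_eq by auto
    ultimately show ?case by blast
  qed
  have "\<eta> ^ K * s \<le> \<eta> ^ K * a 0" using a0s \<eta> by (intro mult_left_mono) auto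
  then have "\<eta> ^ K * s \<le> a K" using main[of K] by linarith
  then have "card {i. i < n \<and> cmod (x i) \<ge> a K} \<le> card {i. i < n \<and> cmod (x i) \<ge> \<eta> ^ K * s}"
    by (intro card_mono) auto
  then show ?thesis using kth_largest_card_ge[of "f K" n x] f(2)[of K] n by (simp add: a_def)
qed

text \<open>Zero row sums give \<open>u\<close> and \<open>u - z\<close> the same image, and the
  peak events quantify over all vectors, so every \<open>z\<close> is handled at once without a
  union bound over \<open>z\<close>.\<close>

lemma no_peak_imp_spread:
  assumes n: "n > 0" and f: "f 0 = 1" "\<And>k. k \<le> K \<Longrightarrow> 1 \<le> f k \<and> f k \<le> n"
    and \<eta>: "0 < \<eta>" "\<eta> \<le> 1" and pi: "\<pi> \<in> perm_tuples n d"
    and nopeak: "\<And>k. k < K \<Longrightarrow> \<pi> \<notin> peak_event n d B \<eta> f k"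
    and rows: "\<And>i. i < n \<Longrightarrow> of_nat d + (\<Sum>j<n. B i j) = 0"
    and Tu: "\<And>i. i < n \<Longrightarrow> cmod (row_action n d B \<pi> u i) \<le> t"
    and s: "0 < s" "\<And>z. \<exists>i<n. cmod (u i - z) \<ge> s" and t: "16 * t \<le> \<eta> ^ K * s"
  shows "spread n (f K) (\<eta> ^ K * s) u"
  unfolding spread_def
proof
  fix z
  have "row_action n d B \<pi> (\<lambda>i. u i - z) i = row_action n d B \<pi> u i" if "i < n" for i
  proof -
    have "row_action n d B \<pi> (\<lambda>i. u i - z) i = row_action n d B \<pi> u i - z * (of_nat d + (\<Sum>j<n. B i j))"
      by (simp add: row_action_def sum_subtractf right_diff_distrib algebra_simps sum_distrib_left)
    then show ?thesis using rows[OF that] by simp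
  qed
  then show "f K \<le> card {j. j < n \<and> cmod (u j - z) \<ge> \<eta> ^ K * s}"
    by (intro no_peak_imp_slow_decay[OF n f \<eta> pi nopeak, where t = t]) (use Tu s t in auto)
qed

text \<open>Inversion preserves the uniform measure, so peak events of the transposed problem obey
  the same bounds.\<close>

lemma inv_tuple_bij: "bij_betw (inv_tuple d) (perm_tuples n d) (perm_tuples n d)"
proof (rule bij_betw_byWitness[where f' = "inv_tuple d"])
  have "inv_tuple d (inv_tuple d \<pi>) = \<pi>" if "\<pi> \<in> perm_tuples n d" for \<pi>
  proof
    fix l
    show "inv_tuple d (inv_tuple d \<pi>) l = \<pi> l"
    proof (cases "l < d")
      case True
      then show ?thesis using permutes_inv_inv[OF perm_tuplesD[OF that True]] by (simp add: inv_tuple_def)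
    next
      case False
      then show ?thesis using that by (auto simp: inv_tuple_def perm_tuples_def PiE_iff extensional_def)
    qed
  qed
  then show "\<forall>a\<in>perm_tuples n d. inv_tuple d (inv_tuple d a) = a"
    "\<forall>a'\<in>perm_tuples n d. inv_tuple d (inv_tuple d a') = a'" by blast+
  have "inv_tuple d \<pi> \<in> perm_tuples n d" if "\<pi> \<in> perm_tuples n d" for \<pi>
    using permutes_inv[OF perm_tuplesD[OF that]]
    by (auto simp: inv_tuple_def perm_tuples_def PiE_iff extensional_def)
  then show "inv_tuple d ` perm_tuples n d \<subseteq> perm_tuples n d"
    "inv_tuple d ` perm_tuples n d \<subseteq> perm_tuples n d" by blast+
qed

lemma near_null_pair_cases:
  assumes n: "n > 0" and f: "f 0 = 1" "\<And>k. k \<le> K \<Longrightarrow> 1 \<le> f k \<and> f k \<le> n"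
    and \<eta>: "0 < \<eta>" "\<eta> \<le> 1" and pi: "\<pi> \<in> perm_tuples n d"
    and rows: "\<And>i. i < n \<Longrightarrow> of_nat d + (\<Sum>j<n. B i j) = 0"
    and cols: "\<And>j. j < n \<Longrightarrow> of_nat d + (\<Sum>i<n. B i j) = 0"
    and u: "near_null n d B t \<pi> u" and w: "left_near_null n d B t \<pi> w"
    and s: "0 < s" "\<And>z. \<exists>i<n. cmod (u i - z) \<ge> s" "\<And>z. \<exists>i<n. cmod (w i - z) \<ge> s"
    and t: "16 * t \<le> \<eta> ^ K * s"
  shows "\<pi> \<in> (\<Union>k<K. peak_event n d B \<eta> f k)
       \<or> inv_tuple d \<pi> \<in> (\<Union>k<K. peak_event n d (\<lambda>i j. B j i) \<eta> f k)
       \<or> \<pi> \<in> spread_event n d B t (\<eta> ^ K * s) (f K)"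
proof -
  have "\<pi> \<in> spread_event n d B t (\<eta> ^ K * s) (f K)"
    if 1: "\<pi> \<notin> (\<Union>k<K. peak_event n d B \<eta> f k)"
      and 2: "inv_tuple d \<pi> \<notin> (\<Union>k<K. peak_event n d (\<lambda>i j. B j i) \<eta> f k)"
  proof -
    have "spread n (f K) (\<eta> ^ K * s) u"
      by (rule no_peak_imp_spread[where t = t and B = B and f = f and K = K]) (use n f \<eta> pi 1 u s t rows in \<open>auto simp: near_null_def\<close>)
    moreover have "inv_tuple d \<pi> \<in> perm_tuples n d" using inv_tuple_bij pi by (auto simp: bij_betw_def)
    then have "spread n (f K) (\<eta> ^ K * s) w"
      by (intro no_peak_imp_spread[where t = t and B = "\<lambda>i j. B j i" and f = f and K = K and \<pi> = "inv_tuple d \<pi>"])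
         (use n f \<eta> 2 w s t cols in \<open>auto simp: left_near_null_def col_action_def\<close>)
    ultimately show ?thesis using pi u w unfolding spread_event_def by blast
  qed
  then show ?thesis by blast
qed

lemma card_inv_tuple_vimage:
  assumes "E \<subseteq> perm_tuples n d"
  shows "card {\<pi>\<in>perm_tuples n d. inv_tuple d \<pi> \<in> E} = card E"
proof -
  have "bij_betw (inv_tuple d) {\<pi>\<in>perm_tuples n d. inv_tuple d \<pi> \<in> E} E"
    using inv_tuple_bij[of d n] assms unfolding bij_betw_def inj_on_def by auto
  then show ?thesis by (rule bij_betw_same_card)
qed

section \<open>Reduction to mean-zero vectors\<close>

lemma sum_norm_sq_add_const:
  fixes u :: "nat \<Rightarrow> complex"
  assumes "(\<Sum>i<n. u i) = 0"
  shows "(\<Sum>i<n. (cmod (u i + z))\<^sup>2) = (\<Sum>i<n. (cmod (u i))\<^sup>2) + real n * (cmod z)\<^sup>2"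
proof -
  have re: "(\<Sum>i<n. Re (u i)) = 0" "(\<Sum>i<n. Im (u i)) = 0"
    using arg_cong[OF assms, of Re] arg_cong[OF assms, of Im] by simp_all
  have "(\<Sum>i<n. (cmod (u i + z))\<^sup>2)
      = (\<Sum>i<n. (cmod (u i))\<^sup>2 + (cmod z)\<^sup>2 + (2 * Re z * Re (u i) + 2 * Im z * Im (u i)))"
  proof (rule sum.cong)
    fix i
    show "(cmod (u i + z))\<^sup>2 = (cmod (u i))\<^sup>2 + (cmod z)\<^sup>2 + (2 * Re z * Re (u i) + 2 * Im z * Im (u i))"
      unfolding cmod_power2 by (simp add: power2_eq_square algebra_simps)
  qed simp
  also have "\<dots> = (\<Sum>i<n. (cmod (u i))\<^sup>2) + real n * (cmod z)\<^sup>2"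
    using re by (simp add: sum.distrib flip: sum_distrib_left)
  finally show ?thesis .
qed

text \<open>By Pythagoras a mean-zero unit vector has Euclidean distance at least 1 from every
  constant vector, which entries all below 1/n cannot reach.\<close>

lemma mean_zero_unit_separated:
  fixes u :: "nat \<Rightarrow> complex"
  assumes "(\<Sum>i<n. u i) = 0" "(\<Sum>i<n. (cmod (u i))\<^sup>2) = 1" "n > 0"
  shows "\<exists>i<n. cmod (u i - z) \<ge> 1 / real n"
proof (rule ccontr)
  assume "\<not> ?thesis"
  then have lt: "cmod (u i - z) < 1 / real n" if "i < n" for i using that by auto
  have "1 \<le> (\<Sum>i<n. (cmod (u i + (- z)))\<^sup>2)"
    using sum_norm_sq_add_const[OF assms(1), of "- z"] assms(2) by simp
  also have "\<dots> < (\<Sum>i<n. (1 / real n)\<^sup>2)"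
    by (rule sum_strict_mono) (use lt assms in \<open>auto intro!: power_strict_mono\<close>)
  also have "\<dots> = 1 / real n" using assms by (simp add: power2_eq_square)
  also have "\<dots> \<le> 1" using assms by simp
  finally show False by simp
qed

section \<open>From a unit vector to mean-zero vectors on both sides\<close>

definition mat_action :: "nat \<Rightarrow> (nat \<Rightarrow> nat \<Rightarrow> complex) \<Rightarrow> (nat \<Rightarrow> complex) \<Rightarrow> nat \<Rightarrow> complex" where
  "mat_action n A x i = (\<Sum>j<n. A i j * x j)"

lemma sum_mat_action:
  assumes "\<And>j. j < n \<Longrightarrow> (\<Sum>i<n. A i j) = \<kappa>"
  shows "(\<Sum>i<n. mat_action n A x i) = \<kappa> * (\<Sum>j<n. x j)"
proof -
  have "(\<Sum>i<n. mat_action n A x i) = (\<Sum>j<n. \<Sum>i<n. A i j * x j)"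
    unfolding mat_action_def by (rule sum.swap)
  also have "\<dots> = (\<Sum>j<n. \<kappa> * x j)"
    by (rule sum.cong) (use assms in \<open>auto simp flip: sum_distrib_right\<close>)
  finally show ?thesis by (simp add: sum_distrib_left)
qed

text \<open>\<open>A\<close> preserves constants, where it is multiplication by
  \<open>\<kappa>\<close>, and mean-zero vectors, so squared norms split. As
  \<open>\<tau> \<le> cmod \<kappa>\<close>, the constant part of \<open>v\<close> is shrunk by no
  more than the factor \<open>\<tau>\<close>, and the small image must be due to the mean-zero
  part.\<close>

lemma near_null_mean_zero:
  fixes v :: "nat \<Rightarrow> complex"
  assumes n: "n > 0" and rows: "\<And>i. i < n \<Longrightarrow> (\<Sum>j<n. A i j) = \<kappa>" and cols: "\<And>j. j < n \<Longrightarrow> (\<Sum>i<n. A i j) = \<kappa>"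
    and v: "(\<Sum>i<n. (cmod (v i))\<^sup>2) = 1"
    and small: "(\<Sum>i<n. (cmod (mat_action n A v i))\<^sup>2) < \<tau>\<^sup>2" and \<tau>: "0 \<le> \<tau>" "\<tau> \<le> cmod \<kappa>" "\<tau> \<le> t"
  shows "\<exists>u. (\<Sum>i<n. u i) = 0 \<and> (\<Sum>i<n. (cmod (u i))\<^sup>2) = 1 \<and> (\<Sum>i<n. (cmod (mat_action n A u i))\<^sup>2) < t\<^sup>2"
proof -
  define \<alpha> where "\<alpha> = (\<Sum>i<n. v i) / of_nat n"
  define v' where "v' i = v i - \<alpha>" for i
  have mean: "(\<Sum>i<n. v' i) = 0" using n by (simp add: v'_def sum_subtractf \<alpha>_def)
  have Av: "mat_action n A v i = mat_action n A v' i + \<alpha> * \<kappa>" if "i < n" for i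
  proof -
    have "mat_action n A v i = mat_action n A v' i + (\<Sum>j<n. A i j) * \<alpha>"
      unfolding mat_action_def sum_distrib_right sum.distrib[symmetric]
      by (rule sum.cong) (auto simp: v'_def algebra_simps)
    then show ?thesis using rows[OF that] by simp
  qed
  have e1: "(\<Sum>i<n. (cmod (v' i))\<^sup>2) + real n * (cmod \<alpha>)\<^sup>2 = 1"
    using sum_norm_sq_add_const[OF mean, of \<alpha>] v by (simp add: v'_def)
  have "(\<Sum>i<n. mat_action n A v' i) = 0" using sum_mat_action[OF cols, where x = v'] mean by simp
  then have e2: "(\<Sum>i<n. (cmod (mat_action n A v i))\<^sup>2) = (\<Sum>i<n. (cmod (mat_action n A v' i))\<^sup>2) + real n * (cmod (\<alpha> * \<kappa>))\<^sup>2"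
    using sum_norm_sq_add_const[of "mat_action n A v'" n "\<alpha> * \<kappa>"] Av by simp
  let ?r = "\<Sum>i<n. (cmod (v' i))\<^sup>2"
  have "\<tau>\<^sup>2 * (real n * (cmod \<alpha>)\<^sup>2) \<le> (cmod \<kappa>)\<^sup>2 * (real n * (cmod \<alpha>)\<^sup>2)"
    using \<tau> by (intro mult_right_mono power_mono) auto
  also have "\<dots> = real n * (cmod (\<alpha> * \<kappa>))\<^sup>2" by (simp add: norm_mult power_mult_distrib)
  finally have "(\<Sum>i<n. (cmod (mat_action n A v' i))\<^sup>2) < \<tau>\<^sup>2 - \<tau>\<^sup>2 * (real n * (cmod \<alpha>)\<^sup>2)"
    using small e2 by linarith
  also have "\<dots> = \<tau>\<^sup>2 * (1 - real n * (cmod \<alpha>)\<^sup>2)" by (simp add: algebra_simps)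
  also have "1 - real n * (cmod \<alpha>)\<^sup>2 = ?r" using e1 by linarith
  finally have lt: "(\<Sum>i<n. (cmod (mat_action n A v' i))\<^sup>2) < \<tau>\<^sup>2 * ?r" .
  \<comment> \<open>The strict inequality also excludes a vanishing mean-zero part, so it can be
    normalised.\<close>
  have "0 \<le> (\<Sum>i<n. (cmod (mat_action n A v' i))\<^sup>2)" by (intro sum_nonneg) auto
  then have "\<tau>\<^sup>2 * ?r > 0" using lt by linarith
  then have r: "?r > 0" by (simp add: zero_less_mult_iff sum_nonneg)
  define u where "u i = v' i / of_real (sqrt ?r)" for i
  have sq: "(sqrt ?r)\<^sup>2 = ?r" "sqrt ?r > 0" using r by simp_all
  have "(\<Sum>i<n. u i) = 0" using mean by (simp add: u_def flip: sum_divide_distrib)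
  moreover have "(\<Sum>i<n. (cmod (u i))\<^sup>2) = 1"
  proof -
    have "(\<Sum>i<n. (cmod (u i))\<^sup>2) = (\<Sum>i<n. (cmod (v' i))\<^sup>2 / ?r)"
      using sq by (intro sum.cong) (auto simp: u_def norm_divide power_divide)
    then show ?thesis using r by (simp flip: sum_divide_distrib)
  qed
  moreover have "(\<Sum>i<n. (cmod (mat_action n A u i))\<^sup>2) < t\<^sup>2"
  proof -
    have "mat_action n A u i = mat_action n A v' i / of_real (sqrt ?r)" for i
      by (simp add: mat_action_def u_def sum_divide_distrib)
    then have "(\<Sum>i<n. (cmod (mat_action n A u i))\<^sup>2) = (\<Sum>i<n. (cmod (mat_action n A v' i))\<^sup>2 / ?r)"
      using sq by (intro sum.cong) (auto simp: norm_divide power_divide)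
    also have "\<dots> = (\<Sum>i<n. (cmod (mat_action n A v' i))\<^sup>2) / ?r" by (simp flip: sum_divide_distrib)
    also have "\<dots> < \<tau>\<^sup>2" using lt r by (simp add: pos_divide_less_eq)
    also have "\<dots> \<le> t\<^sup>2" using \<tau> by (intro power_mono) auto
    finally show ?thesis .
  qed
  ultimately show ?thesis by blast
qed

lemma square_mat_inj_imp_surj:
  fixes C :: "complex mat"
  assumes C: "C \<in> carrier_mat n n"
    and inj: "\<And>v. v \<in> carrier_vec n \<Longrightarrow> C *\<^sub>v v = 0\<^sub>v n \<Longrightarrow> v = 0\<^sub>v n"
    and b: "b \<in> carrier_vec n"
  shows "\<exists>y\<in>carrier_vec n. C *\<^sub>v y = b"
proof -
  have "det C \<noteq> 0" using det_0_iff_vec_prod_zero[OF C] inj by blast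
  then obtain D where D: "D \<in> carrier_mat n n" "C * D = 1\<^sub>m n"
    using det_non_zero_imp_unit[OF C] by (auto simp: Units_def ring_mat_def)
  have "C *\<^sub>v (D *\<^sub>v b) = b"
    using assoc_mult_mat_vec[OF C D(1) b] D(2) b by simp
  then show ?thesis using D b by (intro bexI[of _ "D *\<^sub>v b"]) auto
qed

lemma inj_imp_surj_fun:
  fixes A :: "nat \<Rightarrow> nat \<Rightarrow> complex"
  assumes inj: "\<And>v. (\<And>i. i < n \<Longrightarrow> mat_action n A v i = 0) \<Longrightarrow> (\<And>i. i < n \<Longrightarrow> v i = 0)"
  shows "\<exists>y. \<forall>i<n. mat_action n A y i = b i"
proof -
  let ?C = "mat n n (\<lambda>(i, j). A i j)"
  have mv: "(?C *\<^sub>v v) $ i = mat_action n A (($) v) i" if "i < n" "v \<in> carrier_vec n" for v i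
    using that by (auto simp: mat_action_def scalar_prod_def lessThan_atLeast0 intro!: sum.cong)
  have "\<exists>y\<in>carrier_vec n. ?C *\<^sub>v y = vec n b"
  proof (rule square_mat_inj_imp_surj)
    fix v assume v: "v \<in> carrier_vec n" "?C *\<^sub>v v = 0\<^sub>v n"
    have "mat_action n A (($) v) i = 0" if "i < n" for i using mv[OF that v(1)] v(2) that by simp
    then have "v $ i = 0" if "i < n" for i using inj that by blast
    then show "v = 0\<^sub>v n" using v(1) by (intro eq_vecI) auto
  qed auto
  then obtain y where y: "y \<in> carrier_vec n" "?C *\<^sub>v y = vec n b" by blast
  then have "mat_action n A (($) y) i = b i" if "i < n" for i using mv[OF that y(1)] that by simp
  then show ?thesis by blast
qed

text \<open>Duality replaces a singular value decomposition. If the transpose were bounded below by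
  \<open>t\<close> on mean-zero vectors, it would be invertible there; the solution y of A^T y =
  conj u would have norm at most 1/t, and 1 = y . A u would be at most |y| |A u| < 1.\<close>

lemma left_near_null_mean_zero:
  fixes u :: "nat \<Rightarrow> complex"
  assumes n: "n > 0" and rows: "\<And>i. i < n \<Longrightarrow> (\<Sum>j<n. A i j) = \<kappa>" and cols: "\<And>j. j < n \<Longrightarrow> (\<Sum>i<n. A i j) = \<kappa>"
    and t: "t > 0" and u0: "(\<Sum>i<n. u i) = 0" and u1: "(\<Sum>i<n. (cmod (u i))\<^sup>2) = 1"
    and small: "(\<Sum>i<n. (cmod (mat_action n A u i))\<^sup>2) < t\<^sup>2"
  shows "\<exists>w. (\<Sum>i<n. w i) = 0 \<and> (\<Sum>i<n. (cmod (w i))\<^sup>2) = 1 \<and>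
             (\<Sum>j<n. (cmod (mat_action n (\<lambda>i j. A j i) w j))\<^sup>2) < t\<^sup>2"
proof (rule ccontr)
  let ?AT = "\<lambda>i j. A j i"
  assume no: "\<not> ?thesis"
  have low: "t\<^sup>2 * (\<Sum>i<n. (cmod (w i))\<^sup>2) \<le> (\<Sum>j<n. (cmod (mat_action n ?AT w j))\<^sup>2)"
    if w: "(\<Sum>i<n. w i) = 0" for w
  proof (cases "(\<Sum>i<n. (cmod (w i))\<^sup>2) = 0")
    case True
    then show ?thesis by (simp add: sum_nonneg)
  next
    case False
    let ?r = "\<Sum>i<n. (cmod (w i))\<^sup>2"
    have r: "?r > 0" using False sum_nonneg[of "{..<n}" "\<lambda>i. (cmod (w i))\<^sup>2"] by auto
    define x where "x i = w i / of_real (sqrt ?r)" for i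
    have sq: "(sqrt ?r)\<^sup>2 = ?r" "sqrt ?r > 0" using r by simp_all
    have "(\<Sum>i<n. x i) = 0" using w by (simp add: x_def flip: sum_divide_distrib)
    moreover have "(\<Sum>i<n. (cmod (x i))\<^sup>2) = 1"
    proof -
      have "(\<Sum>i<n. (cmod (x i))\<^sup>2) = (\<Sum>i<n. (cmod (w i))\<^sup>2 / ?r)"
        using sq by (intro sum.cong) (auto simp: x_def norm_divide power_divide)
      then show ?thesis using r by (simp flip: sum_divide_distrib)
    qed
    ultimately have "t\<^sup>2 \<le> (\<Sum>j<n. (cmod (mat_action n ?AT x j))\<^sup>2)" using no by (meson not_less)
    also have "\<dots> = (\<Sum>j<n. (cmod (mat_action n ?AT w j))\<^sup>2 / ?r)"
    proof (rule sum.cong)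
      fix j
      have "mat_action n ?AT x j = mat_action n ?AT w j / of_real (sqrt ?r)"
        by (simp add: mat_action_def x_def sum_divide_distrib)
      then show "(cmod (mat_action n ?AT x j))\<^sup>2 = (cmod (mat_action n ?AT w j))\<^sup>2 / ?r"
        using sq by (simp add: norm_divide power_divide)
    qed simp
    also have "\<dots> = (\<Sum>j<n. (cmod (mat_action n ?AT w j))\<^sup>2) / ?r" by (simp flip: sum_divide_distrib)
    finally show ?thesis using r by (simp add: pos_le_divide_eq)
  qed
  \<comment> \<open>Changing the eigenvalue on the constants to 1 makes the transpose injective on all of C^n.\<close>
  define D where "D j i = A i j - \<kappa> / of_nat n + 1 / of_nat n" for i j
  have D: "mat_action n D y j = mat_action n ?AT y j + (1 - \<kappa>) / of_nat n * (\<Sum>i<n. y i)" for y j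
    unfolding mat_action_def sum_distrib_left sum.distrib[symmetric]
    by (rule sum.cong) (auto simp: D_def diff_divide_distrib algebra_simps)
  have sumD: "(\<Sum>j<n. mat_action n D y j) = (\<Sum>i<n. y i)" for y
  proof -
    have "(\<Sum>j<n. mat_action n D y j) = 1 * (\<Sum>i<n. y i)"
      by (rule sum_mat_action) (use rows n in \<open>auto simp: D_def sum.distrib sum_subtractf\<close>)
    then show ?thesis by simp
  qed
  have DAT: "mat_action n D y j = mat_action n ?AT y j" if "(\<Sum>i<n. y i) = 0" for y j using D that by simp
  have "\<exists>y. \<forall>i<n. mat_action n D y i = cnj (u i)"
  proof (rule inj_imp_surj_fun)
    fix v i assume v: "\<And>i. i < n \<Longrightarrow> mat_action n D v i = 0" and i: "i < n"
    have v0: "(\<Sum>i<n. v i) = 0" using sumD[of v] v by simp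
    then have "(\<Sum>j<n. (cmod (mat_action n ?AT v j))\<^sup>2) = 0" using v DAT[OF v0] by simp
    then have "t\<^sup>2 * (\<Sum>i<n. (cmod (v i))\<^sup>2) \<le> 0" using low[OF v0] by simp
    then have "(\<Sum>i<n. (cmod (v i))\<^sup>2) \<le> 0" using t by (simp add: mult_le_0_iff)
    then have "(\<Sum>i<n. (cmod (v i))\<^sup>2) = 0" by (intro antisym sum_nonneg) auto
    then show "v i = 0" using i by (simp add: sum_nonneg_eq_0_iff)
  qed
  then obtain y where y: "\<And>j. j < n \<Longrightarrow> mat_action n D y j = cnj (u j)" by blast
  \<comment> \<open>\<open>D\<close> preserves the sum of the entries, so \<open>y\<close> is
    mean-zero like \<open>cnj u\<close>, and there \<open>D\<close> agrees with the
    transpose.\<close>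
  have "(\<Sum>i<n. y i) = (\<Sum>j<n. cnj (u j))" using sumD[of y] y by simp
  also have "\<dots> = cnj (\<Sum>j<n. u j)" by simp
  finally have y0: "(\<Sum>i<n. y i) = 0" using u0 by simp
  have ATy: "mat_action n ?AT y j = cnj (u j)" if "j < n" for j using DAT[OF y0] y[OF that] by simp
  have "t\<^sup>2 * (\<Sum>i<n. (cmod (y i))\<^sup>2) \<le> (\<Sum>j<n. (cmod (u j))\<^sup>2)" using low[OF y0] ATy by simp
  then have ly: "t\<^sup>2 * (\<Sum>i<n. (cmod (y i))\<^sup>2) \<le> 1" using u1 by simp
  have "(\<Sum>j<n. mat_action n ?AT y j * u j) = (\<Sum>i<n. y i * mat_action n A u i)"
  proof -
    have "(\<Sum>j<n. mat_action n ?AT y j * u j) = (\<Sum>j<n. \<Sum>i<n. A i j * y i * u j)"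
      by (simp add: mat_action_def sum_distrib_right)
    also have "\<dots> = (\<Sum>i<n. \<Sum>j<n. A i j * y i * u j)" by (rule sum.swap)
    also have "\<dots> = (\<Sum>i<n. y i * mat_action n A u i)"
      by (simp add: mat_action_def sum_distrib_left mult_ac)
    finally show ?thesis .
  qed
  moreover have "(\<Sum>j<n. mat_action n ?AT y j * u j) = 1"
  proof -
    have "(\<Sum>j<n. mat_action n ?AT y j * u j) = (\<Sum>j<n. of_real ((cmod (u j))\<^sup>2))"
      by (rule sum.cong) (use ATy complex_norm_square in \<open>auto simp: mult.commute\<close>)
    also have "\<dots> = of_real (\<Sum>j<n. (cmod (u j))\<^sup>2)" by (simp only: of_real_sum)
    finally show ?thesis using u1 by simp
  qed
  ultimately have "1 = cmod (\<Sum>i<n. y i * mat_action n A u i)" by simp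
  also have "\<dots> \<le> (\<Sum>i<n. \<bar>cmod (y i)\<bar> * \<bar>cmod (mat_action n A u i)\<bar>)"
    by (rule sum_norm_le) (simp add: norm_mult)
  also have "\<dots> \<le> L2_set (\<lambda>i. cmod (y i)) {..<n} * L2_set (\<lambda>i. cmod (mat_action n A u i)) {..<n}"
    by (rule L2_set_mult_ineq)
  also have "\<dots> = sqrt ((\<Sum>i<n. (cmod (y i))\<^sup>2) * (\<Sum>i<n. (cmod (mat_action n A u i))\<^sup>2))"
    by (simp add: L2_set_def real_sqrt_mult)
  finally have ge: "1 \<le> (\<Sum>i<n. (cmod (y i))\<^sup>2) * (\<Sum>i<n. (cmod (mat_action n A u i))\<^sup>2)"
    by simp
  have "(\<Sum>i<n. (cmod (y i))\<^sup>2) \<noteq> 0" using ge by auto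
  then have "(\<Sum>i<n. (cmod (y i))\<^sup>2) > 0" using sum_nonneg[of "{..<n}" "\<lambda>i. (cmod (y i))\<^sup>2"] by auto
  then have "(\<Sum>i<n. (cmod (y i))\<^sup>2) * (\<Sum>i<n. (cmod (mat_action n A u i))\<^sup>2) < (\<Sum>i<n. (cmod (y i))\<^sup>2) * t\<^sup>2"
    using small by (intro mult_strict_left_mono)
  then show False using ge ly by (simp add: mult.commute)
qed

lemma sum_sq_bound_imp_entry_bound:
  fixes f :: "nat \<Rightarrow> complex"
  assumes "(\<Sum>i<n. (cmod (f i))\<^sup>2) \<le> t\<^sup>2" "i < n" "t \<ge> 0"
  shows "cmod (f i) \<le> t"
proof -
  have "(cmod (f i))\<^sup>2 \<le> (\<Sum>i<n. (cmod (f i))\<^sup>2)" using assms by (intro member_le_sum) auto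
  then show ?thesis using assms by (meson order_trans power2_le_imp_le)
qed

lemma mult_mat_vec_entry:
  assumes "M \<in> carrier_mat n n" "v \<in> carrier_vec n" "i < n"
  shows "(M *\<^sub>v v) $ i = mat_action n (\<lambda>i j. M $$ (i, j)) (($) v) i"
  using assms by (auto simp: mat_action_def scalar_prod_def lessThan_atLeast0 intro!: sum.cong)

lemma S_mat_carrier: "S_mat n d \<pi> \<in> carrier_mat n n"
  by (simp add: S_mat_def)

lemma S_mat_entry: "i < n \<Longrightarrow> j < n \<Longrightarrow> S_mat n d \<pi> $$ (i, j) = (\<Sum>l<d. if \<pi> l i = j then 1 else 0)"
  by (simp add: S_mat_def perm_mat_def)

section \<open>The concrete matrix: centring, row and column sums, entry bounds\<close>

context
  fixes n d :: nat and Z :: "complex mat" and \<zeta> :: complex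
  assumes n: "n > 0" and Z: "Z \<in> carrier_mat n n"
    and Z1: "Z *\<^sub>v (ones_vec n) = \<zeta> \<cdot>\<^sub>v (ones_vec n)"
    and ZT1: "mat_adjoint Z *\<^sub>v (ones_vec n) = cnj \<zeta> \<cdot>\<^sub>v (ones_vec n)"
begin

definition centred :: "nat \<Rightarrow> nat \<Rightarrow> complex" where
  "centred i j = Z $$ (i, j) - (of_nat d + \<zeta>) / of_nat n"

lemma Z_row_sum: "i < n \<Longrightarrow> (\<Sum>j<n. Z $$ (i, j)) = \<zeta>"
proof -
  assume i: "i < n"
  have "(Z *\<^sub>v ones_vec n) $ i = (\<Sum>j<n. Z $$ (i, j))"
    using mult_mat_vec_entry[OF Z _ i, of "ones_vec n"] by (simp add: ones_vec_def mat_action_def)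
  then show ?thesis using Z1 i by (simp add: ones_vec_def)
qed

lemma Z_col_sum: "j < n \<Longrightarrow> (\<Sum>i<n. Z $$ (i, j)) = \<zeta>"
proof -
  assume j: "j < n"
  have Zc: "mat_adjoint Z \<in> carrier_mat n n" using Z by (simp add: mat_adjoint_def mat_of_rows_def)
  have "(mat_adjoint Z *\<^sub>v ones_vec n) $ j = (\<Sum>i<n. mat_adjoint Z $$ (j, i))"
    using mult_mat_vec_entry[OF Zc _ j, of "ones_vec n"] by (simp add: ones_vec_def mat_action_def)
  also have "\<dots> = (\<Sum>i<n. cnj (Z $$ (i, j)))"
    by (rule sum.cong) (use j Z in \<open>auto simp: mat_adjoint_def mat_of_rows_def conjugate_vec_def\<close>)
  also have "\<dots> = cnj (\<Sum>i<n. Z $$ (i, j))" by simp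
  finally have "cnj (\<Sum>i<n. Z $$ (i, j)) = cnj \<zeta>" using ZT1 j by (simp add: ones_vec_def)
  then show ?thesis by (simp only: complex_cnj_cancel_iff)
qed

lemma centred_row_sum: "i < n \<Longrightarrow> of_nat d + (\<Sum>j<n. centred i j) = 0"
  using Z_row_sum[of i] n by (simp add: centred_def sum_subtractf)

lemma centred_col_sum: "j < n \<Longrightarrow> of_nat d + (\<Sum>i<n. centred i j) = 0"
  using Z_col_sum[of j] n by (simp add: centred_def sum_subtractf)

lemma mat_action_S_plus_Z:
  assumes pi: "\<pi> \<in> perm_tuples n d" and i: "i < n"
  shows "mat_action n (\<lambda>i j. (S_mat n d \<pi> + Z) $$ (i, j)) x i
       = row_action n d centred \<pi> x i + (of_nat d + \<zeta>) / of_nat n * (\<Sum>j<n. x j)"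
proof -
  have "mat_action n (\<lambda>i j. (S_mat n d \<pi> + Z) $$ (i, j)) x i
      = (\<Sum>j<n. (\<Sum>l<d. (if \<pi> l i = j then 1 else 0) * x j) + Z $$ (i, j) * x j)"
    unfolding mat_action_def using i Z
    by (intro sum.cong) (auto simp: S_mat_entry sum_distrib_right distrib_right)
  also have "\<dots> = (\<Sum>l<d. \<Sum>j<n. (if \<pi> l i = j then 1 else 0) * x j) + (\<Sum>j<n. Z $$ (i, j) * x j)"
    unfolding sum.distrib by (subst sum.swap) simp
  also have "(\<Sum>l<d. \<Sum>j<n. (if \<pi> l i = j then 1 else 0) * x j) = (\<Sum>l<d. x (\<pi> l i))"
  proof (rule sum.cong)
    fix l assume "l \<in> {..<d}"
    then have "\<pi> l i \<in> {..<n}" using permutes_in_image[OF perm_tuplesD[OF pi, of l], of i] i by auto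
    then have "(\<Sum>j<n. if \<pi> l i = j then x j else 0) = x (\<pi> l i)" by (subst sum.delta') auto
    moreover have "(\<Sum>j<n. (if \<pi> l i = j then 1 else 0) * x j) = (\<Sum>j<n. if \<pi> l i = j then x j else 0)"
      by (rule sum.cong) auto
    ultimately show "(\<Sum>j<n. (if \<pi> l i = j then 1 else 0) * x j) = x (\<pi> l i)" by simp
  qed simp
  also have "(\<Sum>j<n. Z $$ (i, j) * x j) = (\<Sum>j<n. centred i j * x j) + (of_nat d + \<zeta>) / of_nat n * (\<Sum>j<n. x j)"
    unfolding sum_distrib_left sum.distrib[symmetric]
    by (rule sum.cong) (auto simp: centred_def left_diff_distrib)
  finally show ?thesis by (simp add: row_action_def)
qed

lemma mat_action_S_plus_Z_transpose:
  assumes pi: "\<pi> \<in> perm_tuples n d" and j: "j < n"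
  shows "mat_action n (\<lambda>i j. (S_mat n d \<pi> + Z) $$ (j, i)) w j
       = col_action n d centred \<pi> w j + (of_nat d + \<zeta>) / of_nat n * (\<Sum>i<n. w i)"
proof -
  have "mat_action n (\<lambda>i j. (S_mat n d \<pi> + Z) $$ (j, i)) w j
      = (\<Sum>i<n. (\<Sum>l<d. (if \<pi> l i = j then 1 else 0) * w i) + Z $$ (i, j) * w i)"
    unfolding mat_action_def using j Z
    by (intro sum.cong) (auto simp: S_mat_entry sum_distrib_right distrib_right)
  also have "\<dots> = (\<Sum>l<d. \<Sum>i<n. (if \<pi> l i = j then 1 else 0) * w i) + (\<Sum>i<n. Z $$ (i, j) * w i)"
    unfolding sum.distrib by (subst sum.swap) simp
  also have "(\<Sum>l<d. \<Sum>i<n. (if \<pi> l i = j then 1 else 0) * w i) = (\<Sum>l<d. w (inv_tuple d \<pi> l j))"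
  proof (rule sum.cong)
    fix l assume l: "l \<in> {..<d}"
    then have p: "\<pi> l permutes {..<n}" using perm_tuplesD[OF pi, of l] by simp
    then have mem: "Hilbert_Choice.inv (\<pi> l) j \<in> {..<n}"
      using permutes_in_image[OF permutes_inv[OF p], of j] j by auto
    have "(\<Sum>i<n. (if \<pi> l i = j then 1 else 0) * w i) = (\<Sum>i<n. if Hilbert_Choice.inv (\<pi> l) j = i then w i else 0)"
      by (rule sum.cong) (use permutes_inv_eq[OF p] in auto)
    also have "\<dots> = w (Hilbert_Choice.inv (\<pi> l) j)" using mem by (subst sum.delta') auto
    finally show "(\<Sum>i<n. (if \<pi> l i = j then 1 else 0) * w i) = w (inv_tuple d \<pi> l j)"
      using l by (simp add: inv_tuple_def)
  qed simp
  also have "(\<Sum>i<n. Z $$ (i, j) * w i) = (\<Sum>i<n. centred i j * w i) + (of_nat d + \<zeta>) / of_nat n * (\<Sum>i<n. w i)"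
    unfolding sum_distrib_left sum.distrib[symmetric]
    by (rule sum.cong) (auto simp: centred_def left_diff_distrib)
  finally show ?thesis by (simp add: col_action_def row_action_def)
qed

lemma small_sv_imp_near_null_pair:
  assumes pi: "\<pi> \<in> perm_tuples n d" and t: "t > 0"
    and sv: "smallest_sv (S_mat n d \<pi> + Z) < min t (cmod (of_nat d + \<zeta>))"
  shows "\<exists>u w. near_null n d centred t \<pi> u \<and> left_near_null n d centred t \<pi> w \<and>
           (\<forall>z. \<exists>i<n. cmod (u i - z) \<ge> 1 / real n) \<and> (\<forall>z. \<exists>i<n. cmod (w i - z) \<ge> 1 / real n)"
proof -
  let ?M = "S_mat n d \<pi> + Z"
  let ?A = "\<lambda>i j. ?M $$ (i, j)"
  let ?\<tau> = "min t (cmod (of_nat d + \<zeta>))"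
  have M: "?M \<in> carrier_mat n n" using Z S_mat_carrier by simp
  \<comment> \<open>The infimum is over a nonempty set, so some unit vector lies below the
    threshold.\<close>
  have "vnorm2 (unit_vec n 0) = 1"
  proof -
    have "(\<Sum>i<n. (cmod (unit_vec n 0 $ i))\<^sup>2) = (\<Sum>i<n. if i = 0 then 1 else 0)"
      by (rule sum.cong) auto
    also have "\<dots> = (1::real)" using n by simp
    finally show ?thesis by (simp add: vnorm2_def)
  qed
  then have "{vnorm2 (?M *\<^sub>v u) | u. u \<in> carrier_vec (dim_col ?M) \<and> vnorm2 u = 1} \<noteq> {}"
    using M Z by (auto intro!: exI[of _ "unit_vec n 0"])
  then obtain v where v: "v \<in> carrier_vec n" "vnorm2 v = 1" "vnorm2 (?M *\<^sub>v v) < ?\<tau>"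
    using cInf_lessD[OF _ sv[unfolded smallest_sv_def]] Z by auto
  have v1: "(\<Sum>i<n. (cmod (v $ i))\<^sup>2) = 1" using v by (simp add: vnorm2_def)
  have "(\<Sum>i<n. (cmod ((?M *\<^sub>v v) $ i))\<^sup>2) < ?\<tau>\<^sup>2"
  proof -
    have "vnorm2 (?M *\<^sub>v v) = sqrt (\<Sum>i<n. (cmod ((?M *\<^sub>v v) $ i))\<^sup>2)"
      using Z by (simp add: vnorm2_def)
    then have "sqrt (\<Sum>i<n. (cmod ((?M *\<^sub>v v) $ i))\<^sup>2) < ?\<tau>" using v(3) by simp
    then have "(sqrt (\<Sum>i<n. (cmod ((?M *\<^sub>v v) $ i))\<^sup>2))\<^sup>2 < ?\<tau>\<^sup>2"
      by (intro power_strict_mono) (auto intro: sum_nonneg)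
    then show ?thesis by (simp add: sum_nonneg)
  qed
  then have small: "(\<Sum>i<n. (cmod (mat_action n ?A (($) v) i))\<^sup>2) < ?\<tau>\<^sup>2"
    using mult_mat_vec_entry[OF M v(1)] by simp
  \<comment> \<open>The decomposition is evaluated at the all-ones vector, which the centred
    operator kills.\<close>
  have rows: "(\<Sum>j<n. ?A i j) = of_nat d + \<zeta>" if "i < n" for i
    using mat_action_S_plus_Z[OF pi that, of "\<lambda>_. 1"] centred_row_sum[OF that] n
    by (simp add: mat_action_def row_action_def)
  have cols: "(\<Sum>i<n. ?A i j) = of_nat d + \<zeta>" if "j < n" for j
    using mat_action_S_plus_Z_transpose[OF pi that, of "\<lambda>_. 1"] centred_col_sum[OF that] n
    by (simp add: mat_action_def col_action_def row_action_def)
  obtain u where u: "(\<Sum>i<n. u i) = 0" "(\<Sum>i<n. (cmod (u i))\<^sup>2) = 1" "(\<Sum>i<n. (cmod (mat_action n ?A u i))\<^sup>2) < t\<^sup>2"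
    using near_null_mean_zero[OF n rows cols v1 small, of t] t by auto
  obtain w where w: "(\<Sum>i<n. w i) = 0" "(\<Sum>i<n. (cmod (w i))\<^sup>2) = 1"
    "(\<Sum>j<n. (cmod (mat_action n (\<lambda>i j. ?A j i) w j))\<^sup>2) < t\<^sup>2"
    using left_near_null_mean_zero[OF n rows cols t u] by auto
  have "near_null n d centred t \<pi> u"
    unfolding near_null_def
  proof (intro conjI allI impI)
    fix i assume i: "i < n"
    show "cmod (u i) \<le> 1" using sum_sq_bound_imp_entry_bound[of u n 1 i] u i by simp
    show "cmod (row_action n d centred \<pi> u i) \<le> t"
      using sum_sq_bound_imp_entry_bound[of "mat_action n ?A u" n t i] u i t mat_action_S_plus_Z[OF pi i, of u] by simp
  qed
  moreover have "left_near_null n d centred t \<pi> w"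
    unfolding left_near_null_def
  proof (intro conjI allI impI)
    fix i assume i: "i < n"
    show "cmod (w i) \<le> 1" using sum_sq_bound_imp_entry_bound[of w n 1 i] w i by simp
    show "cmod (col_action n d centred \<pi> w i) \<le> t"
      using sum_sq_bound_imp_entry_bound[of "mat_action n (\<lambda>i j. ?A j i) w" n t i] w i t mat_action_S_plus_Z_transpose[OF pi i, of w] by simp
  qed
  ultimately show ?thesis
    using mean_zero_unit_separated[OF u(1,2) n] mean_zero_unit_separated[OF w(1,2) n] by blast
qed

text \<open>Homogeneity extends the bound from unit vectors to the unit ball. Boundedness of the set
  comes first, by the crude sum of all entries, because only then is \<open>Sup\<close> an upper
  bound.\<close>

lemma vnorm2_le_of_norm_perp1:
  assumes x: "x \<in> carrier_vec n" "(\<Sum>i<n. x $ i) = 0" "vnorm2 x \<le> 1"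
  shows "vnorm2 (Z *\<^sub>v x) \<le> norm_perp1 Z"
proof -
  let ?S = "{vnorm2 (Z *\<^sub>v u) | u. u \<in> carrier_vec (dim_col Z) \<and> vnorm2 u = 1 \<and> (\<Sum>i<dim_col Z. u $ i) = 0}"
  have vL2: "vnorm2 v = L2_set (\<lambda>i. cmod (v $ i)) {..<dim_vec v}" for v by (simp add: vnorm2_def L2_set_def)
  have dims: "dim_col Z = n" "dim_row Z = n" using Z by auto
  have "vnorm2 (Z *\<^sub>v u) \<le> (\<Sum>i<n. \<Sum>j<n. cmod (Z $$ (i, j)))" if u: "u \<in> carrier_vec n" "vnorm2 u = 1" for u
  proof -
    have uj: "cmod (u $ j) \<le> 1" if "j < n" for j
      using member_le_L2_set[of "{..<n}" j "\<lambda>i. cmod (u $ i)"] u that vL2[of u] by simp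
    have "vnorm2 (Z *\<^sub>v u) \<le> (\<Sum>i<n. cmod ((Z *\<^sub>v u) $ i))"
    proof -
      have "dim_vec (Z *\<^sub>v u) = n" using dims by simp
      then show ?thesis unfolding vL2 by (simp only:) (rule L2_set_le_sum, simp)
    qed
    also have "\<dots> \<le> (\<Sum>i<n. \<Sum>j<n. cmod (Z $$ (i, j)))"
    proof (rule sum_mono)
      fix i assume "i \<in> {..<n}"
      then have "cmod ((Z *\<^sub>v u) $ i) = cmod (\<Sum>j<n. Z $$ (i, j) * u $ j)"
        using mult_mat_vec_entry[OF Z u(1), of i] by (simp add: mat_action_def)
      also have "\<dots> \<le> (\<Sum>j<n. cmod (Z $$ (i, j)))"
      proof (rule sum_norm_le)
        fix j assume "j \<in> {..<n}"
        then show "cmod (Z $$ (i, j) * u $ j) \<le> cmod (Z $$ (i, j))"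
          using mult_left_mono[OF uj[of j], of "cmod (Z $$ (i, j))"] by (simp add: norm_mult)
      qed
      finally show "cmod ((Z *\<^sub>v u) $ i) \<le> (\<Sum>j<n. cmod (Z $$ (i, j)))" .
    qed
    finally show ?thesis .
  qed
  then have bdd: "bdd_above (insert 0 ?S)"
    unfolding bdd_above_insert using dims by (intro bdd_aboveI[of _ "\<Sum>i<n. \<Sum>j<n. cmod (Z $$ (i, j))"]) auto
  have N0: "0 \<le> norm_perp1 Z" unfolding norm_perp1_def by (rule cSup_upper[OF _ bdd]) simp
  show ?thesis
  proof (cases "vnorm2 x = 0")
    case True
    then have "x $ i = 0" if "i < n" for i
      using x(1) that by (simp add: vL2 L2_set_eq_0_iff)
    then have "vnorm2 (Z *\<^sub>v x) = 0"
      using dims mult_mat_vec_entry[OF Z x(1)] by (simp add: vnorm2_def mat_action_def)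
    then show ?thesis using N0 by simp
  next
    case False
    let ?r = "vnorm2 x"
    have r: "?r > 0" using False by (simp add: vL2 L2_set_nonneg order_less_le)
    define u where "u = (1 / complex_of_real ?r) \<cdot>\<^sub>v x"
    have scal: "vnorm2 (c \<cdot>\<^sub>v v) = cmod c * vnorm2 v" for c v
      by (auto simp: vL2 norm_mult L2_set_right_distrib intro!: L2_set_cong)
    have u: "u \<in> carrier_vec n" "vnorm2 u = 1" using x r by (auto simp: u_def scal norm_divide)
    have "(\<Sum>i<n. u $ i) = 0"
    proof -
      have "(\<Sum>i<n. u $ i) = (\<Sum>i<n. 1 / complex_of_real ?r * x $ i)"
        using x(1) by (intro sum.cong) (auto simp: u_def)
      then show ?thesis using x(2) by (simp flip: sum_distrib_left sum_divide_distrib)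
    qed
    then have "vnorm2 (Z *\<^sub>v u) \<in> insert 0 ?S" using u dims by blast
    then have le: "vnorm2 (Z *\<^sub>v u) \<le> norm_perp1 Z" unfolding norm_perp1_def by (rule cSup_upper[OF _ bdd])
    have "Z *\<^sub>v x = of_real ?r \<cdot>\<^sub>v (Z *\<^sub>v u)"
      using r x(1) Z by (simp add: u_def mult_mat_vec smult_smult_assoc)
    then have "vnorm2 (Z *\<^sub>v x) = ?r * vnorm2 (Z *\<^sub>v u)" using r by (simp add: scal)
    also have "\<dots> \<le> 1 * vnorm2 (Z *\<^sub>v u)"
      by (intro mult_right_mono x(3)) (simp add: vL2 L2_set_nonneg)
    finally show ?thesis using le by simp
  qed
qed

text \<open>The test vector is e_j minus its mean: it is mean-zero, of norm at most 1, and entry i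
  of its image is Z_ij - \<zeta>/n. The centring thus removes the uncontrolled
  \<open>\<zeta>\<close>.\<close>

lemma centred_entry_bound:
  assumes ij: "i < n" "j < n"
  shows "cmod (centred i j) \<le> norm_perp1 Z + real d / real n"
proof -
  define x where "x = vec n (\<lambda>k. (if k = j then 1 else 0) - 1 / complex_of_nat n)"
  have x: "x \<in> carrier_vec n" by (simp add: x_def)
  have x0: "(\<Sum>k<n. x $ k) = 0"
  proof -
    have "(\<Sum>k<n. x $ k) = (\<Sum>k<n. (if k = j then 1 else 0) - 1 / complex_of_nat n)"
      by (rule sum.cong) (auto simp: x_def)
    then show ?thesis using ij n by (simp add: sum_subtractf)
  qed
  have "(\<Sum>k<n. (cmod (x $ k))\<^sup>2) \<le> 1"
  proof -
    have "(\<Sum>k<n. (cmod (x $ k + 1 / complex_of_nat n))\<^sup>2) = (\<Sum>k<n. if k = j then 1 else 0)"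
      by (rule sum.cong) (auto simp: x_def)
    also have "\<dots> = (1::real)" using ij by simp
    finally have "(\<Sum>k<n. (cmod (x $ k))\<^sup>2) + real n * (cmod (1 / complex_of_nat n))\<^sup>2 = 1"
      using sum_norm_sq_add_const[OF x0, of "1 / complex_of_nat n"] by simp
    moreover have "real n * (cmod (1 / complex_of_nat n))\<^sup>2 \<ge> 0" by simp
    ultimately show ?thesis by linarith
  qed
  then have "vnorm2 x \<le> 1" using x by (simp add: vnorm2_def)
  then have le: "vnorm2 (Z *\<^sub>v x) \<le> norm_perp1 Z" using vnorm2_le_of_norm_perp1[OF x x0] by simp
  have "(Z *\<^sub>v x) $ i = Z $$ (i, j) - \<zeta> / of_nat n"
  proof -
    have "(Z *\<^sub>v x) $ i = (\<Sum>k<n. (if k = j then Z $$ (i, k) else 0) - Z $$ (i, k) / of_nat n)"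
      unfolding mult_mat_vec_entry[OF Z x ij(1)] mat_action_def
      by (rule sum.cong) (auto simp: x_def right_diff_distrib)
    then show ?thesis using Z_row_sum[OF ij(1)] ij by (simp add: sum_subtractf flip: sum_divide_distrib)
  qed
  moreover have "cmod ((Z *\<^sub>v x) $ i) \<le> vnorm2 (Z *\<^sub>v x)"
    using member_le_L2_set[of "{..<n}" i "\<lambda>i. cmod ((Z *\<^sub>v x) $ i)"] ij Z by (simp add: vnorm2_def L2_set_def)
  ultimately have "cmod (Z $$ (i, j) - \<zeta> / of_nat n) \<le> norm_perp1 Z" using le by simp
  moreover have "centred i j = (Z $$ (i, j) - \<zeta> / of_nat n) - of_nat d / of_nat n"
    by (simp add: centred_def add_divide_distrib)
  ultimately show ?thesis
    using norm_triangle_ineq4[of "Z $$ (i, j) - \<zeta> / of_nat n" "of_nat d / of_nat n"] by (simp add: norm_divide)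
qed

end

section \<open>Choice of parameters\<close>

text \<open>With L = ln n, a huge entry costs at most exp(36 \<gamma> L K) net points and a moderate
  one exp(36 \<gamma> L), from 25 n \<le> n^3 and \<eta>^(-4) = n^(32 \<gamma>). The constant 108 =
  3 * 36 limits the entropy to h/3, against 2^(-h) \<le> exp(-2h/3); the remaining h/3 is at least
  36 L.\<close>

lemma card_peak_event_le:
  fixes n d N :: nat and \<gamma> :: real
  assumes n: "n \<ge> 5" and \<gamma>: "\<gamma> \<ge> 1" and \<eta>: "\<eta> = real n powr (- 8 * \<gamma>)"
    and B: "\<And>i j. i < n \<Longrightarrow> j < n \<Longrightarrow> cmod (B i j) \<le> b" and \<Lambda>: "(real d + real n * b) * \<eta> \<le> 1/16"
    and N: "N \<le> d" and k: "k < K"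
    and h: "4 * h \<le> f k * N" "12 * h \<le> n"
    and room: "(if k = 0 then 0 else f (k - 1)) + f k + f (Suc k) \<le> n" and f1: "f (Suc k) \<ge> 1"
    and ent: "108 * \<gamma> * ln (real n) * (real K * real (if k = 0 then 0 else f (k - 1)) + real (f (Suc k))) \<le> real h"
  shows "real (card (peak_event n d B \<eta> f k)) \<le> 2 * exp (- 36 * ln (real n)) * real (card (perm_tuples n d))"
proof -
  define L where "L = ln (real n)"
  define m1 where "m1 = (if k = 0 then 0 else f (k - 1))"
  define m' where "m' = f (Suc k)"
  have n0: "real n > 0" using n by simp
  have L0: "L > 0" using n by (simp add: L_def)
  have nL: "real n = exp L" using n0 by (simp add: L_def)
  have \<eta>L: "\<eta> = exp (- (8 * \<gamma> * L))" using n0 by (simp add: \<eta> powr_def L_def)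
  have \<eta>0: "\<eta> > 0" by (simp add: \<eta>L)
  have "\<eta> \<le> real n powr (-1)" unfolding \<eta> using n \<gamma> by (intro powr_mono) auto
  also have "\<dots> = 1 / real n" using n0 by (simp add: powr_minus divide_inverse)
  also have "\<dots> \<le> 1/4" using n by (simp add: divide_le_eq)
  finally have \<eta>4: "\<eta> \<le> 1/4" .
  have i\<eta>: "1 / \<eta> = exp (8 * \<gamma> * L)" by (simp add: \<eta>L exp_minus field_simps)
  have R1: "(1 / \<eta>) ^ k \<ge> 1" using \<eta>0 \<eta>4 by (intro one_le_power) (simp add: pos_le_divide_eq)
  have n25: "25 \<le> exp (2 * L)"
  proof -
    have "exp (2 * L) = real n * real n" by (simp add: nL flip: exp_add)
    moreover have "real n * real n \<ge> 5 * 5" using n by (intro mult_mono) auto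
    ultimately show ?thesis by simp
  qed
  have \<gamma>L: "L \<le> \<gamma> * L" using mult_right_mono[OF \<gamma>, of L] L0 by simp
  have F1: "25 * real n * ((1 / \<eta>) ^ k / \<eta>)\<^sup>2 \<le> exp (36 * \<gamma> * L * real K)"
  proof -
    have "(1 / \<eta>) ^ k / \<eta> = (1 / \<eta>) ^ Suc k" by simp
    also have "\<dots> = exp (real (Suc k) * (8 * \<gamma> * L))" unfolding i\<eta> by (rule exp_of_nat_mult[symmetric])
    finally have "((1 / \<eta>) ^ k / \<eta>)\<^sup>2 = exp (2 * (real (Suc k) * (8 * \<gamma> * L)))"
      by (simp add: power2_eq_square flip: exp_add)
    then have "25 * real n * ((1 / \<eta>) ^ k / \<eta>)\<^sup>2 \<le> exp (2 * L) * exp L * exp (2 * (real (Suc k) * (8 * \<gamma> * L)))"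
      unfolding nL using n25 by (intro mult_mono) auto
    also have "\<dots> = exp (3 * L + 16 * (real (Suc k) * (\<gamma> * L)))"
      unfolding exp_add[symmetric] by (simp add: algebra_simps)
    also have "\<dots> \<le> exp (36 * \<gamma> * L * real K)"
    proof -
      have kK: "real (Suc k) \<le> real K" "1 \<le> real K" using k by auto
      have "real (Suc k) * (\<gamma> * L) \<le> real K * (\<gamma> * L)"
        using kK \<gamma> L0 by (intro mult_right_mono) auto
      moreover have "1 * (\<gamma> * L) \<le> real K * (\<gamma> * L)"
        using kK \<gamma> L0 by (intro mult_right_mono) auto
      ultimately have "3 * L + 16 * (real (Suc k) * (\<gamma> * L)) \<le> 36 * (real K * (\<gamma> * L))"
        using \<gamma>L L0 by linarith
      then show ?thesis by (simp add: mult_ac)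
    qed
    finally show ?thesis .
  qed
  have F2: "25 * real n * (1 / \<eta>\<^sup>2)\<^sup>2 \<le> exp (36 * \<gamma> * L)"
  proof -
    have "(1 / \<eta>\<^sup>2)\<^sup>2 = exp (8 * \<gamma> * L) * exp (8 * \<gamma> * L) * (exp (8 * \<gamma> * L) * exp (8 * \<gamma> * L))"
      unfolding i\<eta>[symmetric] by (simp add: power2_eq_square)
    then have "25 * real n * (1 / \<eta>\<^sup>2)\<^sup>2 \<le> exp (2 * L) * exp L * (exp (8 * \<gamma> * L) * exp (8 * \<gamma> * L) * (exp (8 * \<gamma> * L) * exp (8 * \<gamma> * L)))"
      unfolding nL using n25 by (intro mult_mono) auto
    also have "\<dots> = exp (3 * L + 32 * (\<gamma> * L))"
      unfolding exp_add[symmetric] by (simp add: algebra_simps)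
    also have "\<dots> \<le> exp (36 * \<gamma> * L)" using \<gamma>L L0 by (simp add: mult.assoc)
    finally show ?thesis .
  qed
  have ent': "108 * (\<gamma> * L * (real K * real m1 + real m')) \<le> real h"
    using ent by (simp add: L_def m1_def m'_def mult_ac)
  have "1 * (\<gamma> * L) \<le> real m' * (\<gamma> * L)" using f1 \<gamma> L0 by (intro mult_right_mono) (auto simp: m'_def)
  moreover have "0 \<le> \<gamma> * L * (real K * real m1)" using \<gamma> L0 by simp
  ultimately have hL: "108 * L \<le> real h" using ent' \<gamma>L unfolding distrib_left by (simp add: mult_ac)
  have half: "(1/2::real) ^ h \<le> exp (- (2/3 * real h))"
  proof -
    have "(1/2::real) = exp (- ln 2)" by (simp add: exp_minus)
    then have "(1/2::real) ^ h = exp (real h * (- ln 2))" by (metis exp_of_nat_mult)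
    also have "\<dots> \<le> exp (real h * (- (2/3)))"
      using ln2_ge_two_thirds by (intro iffD2[OF exp_le_cancel_iff] mult_left_mono) auto
    finally show ?thesis by (simp add: mult.commute)
  qed
  have "real (card (peak_event n d B \<eta> f k))
      \<le> (25 * real n * ((1 / \<eta>) ^ k / \<eta>)\<^sup>2) ^ m1 * (25 * real n * (1 / \<eta>\<^sup>2)\<^sup>2) ^ m' * (2 * (1/2) ^ h) * real (card (perm_tuples n d))"
    unfolding peak_event_def m1_def[symmetric] m'_def[symmetric]
    by (rule card_peaked_near_null_le[OF B \<Lambda> \<eta>0 \<eta>4 R1 _ N h])
       (use n room in \<open>auto simp: m1_def m'_def\<close>)
  also have "\<dots> \<le> (2 * exp (- 36 * L)) * real (card (perm_tuples n d))"
  proof (rule mult_right_mono)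
    have "(25 * real n * ((1 / \<eta>) ^ k / \<eta>)\<^sup>2) ^ m1 * (25 * real n * (1 / \<eta>\<^sup>2)\<^sup>2) ^ m' * (2 * (1/2) ^ h)
        \<le> exp (36 * \<gamma> * L * real K) ^ m1 * exp (36 * \<gamma> * L) ^ m' * (2 * exp (- (2/3 * real h)))"
      using half by (intro mult_mono power_mono F1 F2) auto
    also have "\<dots> = 2 * exp (36 * (\<gamma> * L * (real K * real m1 + real m')) - 2/3 * real h)"
      by (simp add: exp_of_nat_mult[symmetric] exp_add[symmetric] mult.left_commute[of _ 2]) (simp add: algebra_simps)
    also have "\<dots> \<le> 2 * exp (- 36 * L)" using ent' hL by simp
    finally show "(25 * real n * ((1 / \<eta>) ^ k / \<eta>)\<^sup>2) ^ m1 * (25 * real n * (1 / \<eta>\<^sup>2)\<^sup>2) ^ m' * (2 * (1/2) ^ h)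
        \<le> 2 * exp (- 36 * L)" .
  qed simp
  finally show ?thesis by (simp add: L_def)
qed

text \<open>\<open>big\<close> says that the bound to be proved is below 1, so sqrt N exceeds a
  large multiple of Q ln n. Then \<open>q\<close> is sqrt N rounded down, \<open>m\<close> is n / (Q
  ln n) rounded down, and \<open>K\<close> is the least exponent with \<open>m \<le> q ^ K\<close>,
  so that K - 1 is at most ln n / ln q \<le> 4 log_N n.\<close>

lemma scale_parameters:
  fixes n N :: nat and \<gamma> Q C :: real
  assumes \<gamma>: "\<gamma> \<ge> 1" and Q: "Q = 6000 * \<gamma>" and C: "C = 20 + 192 * Q ^ 3"
    and n: "n \<ge> 2" and N: "1 \<le> N" "N \<le> n" and big: "C * ln (real n) ^ 4 < sqrt (real N)"
  obtains q m K :: nat where "n \<ge> 24" "ln (real n) \<ge> 1" "N \<ge> 3" "2 \<le> q" "q\<^sup>2 \<le> N"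
    "868 * \<gamma> * ln (real n) \<le> real q" "1 \<le> m" "3 * m \<le> n" "real m \<le> real n / (Q * ln (real n))"
    "real n / real m \<le> 2 * Q * ln (real n)"
    "m \<le> q ^ K" "\<And>k. k < K \<Longrightarrow> q ^ k < m" "K \<le> q" "real K \<le> 5 * log (real N) (real n)" "real K \<le> 5 * ln (real n)"
proof -
  define L where "L = ln (real n)"
  define r where "r = sqrt (real N)"
  have Q6: "Q \<ge> 6000" using Q \<gamma> by simp
  have "Q \<le> Q ^ 3" using Q6 by (intro self_le_power) auto
  then have CQ: "C \<ge> 192 * Q" using C by simp
  \<comment> \<open>The logarithm is bounded below for \<open>n \<ge> 2\<close>, so
    \<open>big\<close> forces sqrt N > 1000. This excludes \<open>N = 1\<close>, where
    \<open>log\<close> to base 1 has the default value 0.\<close>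
  have Lln2: "L \<ge> 2/3" using n ln2_ge_two_thirds ln_le_cancel_iff[of 2 "real n"] unfolding L_def by linarith
  have "(2/3::real) ^ 4 \<le> L ^ 4" using Lln2 by (intro power_mono) auto
  then have "1/6 \<le> L ^ 4" by (simp add: power4_eq_xxxx)
  then have "C * (1/6) \<le> C * L ^ 4" using CQ Q6 by (intro mult_left_mono) auto
  then have "r > 1000" using big CQ Q6 unfolding r_def L_def by linarith
  have r2: "r * r = real N" by (simp add: r_def)
  have "r \<le> r * r" using \<open>r > 1000\<close> by simp
  then have N1000: "real N > 1000" using r2 \<open>r > 1000\<close> by linarith
  then have n1000: "real n > 1000" using N by simp
  have "1 \<le> ln (3::real)" using exp_le by (simp add: ln_ge_iff)
  also have "ln 3 \<le> ln (real N)" using N1000 by simp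
  finally have lnN: "ln (real N) \<ge> 1" .
  have NL: "ln (real N) \<le> L" using N N1000 by (simp add: L_def)
  then have L1: "L \<ge> 1" using lnN by linarith
  have "L \<le> L ^ 4" using L1 by (intro self_le_power) auto
  then have "C * L \<le> C * L ^ 4" using CQ Q6 by (intro mult_left_mono) auto
  then have rL: "r > C * L" using big unfolding r_def L_def by linarith
  have "192 * Q * L \<le> C * L" using CQ L1 by (intro mult_right_mono) auto
  then have rQ: "192 * (Q * L) < r" using rL by (simp add: mult.assoc)
  define q where "q = nat \<lfloor>r\<rfloor>"
  have q: "real q \<le> r" "r < real q + 1" using \<open>r > 1000\<close> by (auto simp: q_def) 
  have q2: "real q * real q \<le> real N" using q \<open>r > 1000\<close> mult_mono[of "real q" r "real q" r] r2 by auto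
  have q_half: "real q \<ge> r / 2" using q \<open>r > 1000\<close> by linarith
  have QL: "Q * L = 6000 * (\<gamma> * L)" by (simp add: Q)
  have \<gamma>L: "\<gamma> * L \<ge> L" using mult_right_mono[OF \<gamma>, of L] L1 by simp
  have q868: "868 * \<gamma> * L \<le> real q" using q_half rQ QL \<gamma>L L1 by (simp only: mult.assoc)
  define m where "m = nat \<lfloor>real n / (Q * L)\<rfloor>"
  have QL0: "Q * L \<ge> 6000" using QL \<gamma>L L1 by linarith
  have "2 * (Q * L) \<le> real n" using rQ \<open>r \<le> r * r\<close> r2 N QL0 by linarith
  then have two: "real n / (Q * L) \<ge> 2" using QL0 by (simp add: pos_le_divide_eq)
  have m: "real m \<le> real n / (Q * L)" "real n / (Q * L) < real m + 1"
    using two by (auto simp: m_def)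
  then have m_half: "real m \<ge> real n / (Q * L) / 2" and m1: "real m \<ge> 1"
  proof -
    have "y < x + 1 \<Longrightarrow> 2 \<le> y \<Longrightarrow> y / 2 \<le> x" "y < x + 1 \<Longrightarrow> 2 \<le> y \<Longrightarrow> 1 \<le> x" for x y :: real by linarith+
    then show "real m \<ge> real n / (Q * L) / 2" "real m \<ge> 1" using m(2) two by blast+
  qed
  have "real n / (Q * L) \<le> real n / 3" using QL0 by (intro divide_left_mono) auto
  then have m3: "3 * real m \<le> real n" using m by linarith
  have ratio: "real n / real m \<le> 2 * Q * L"
  proof -
    have "real n \<le> 2 * real m * (Q * L)" using m_half QL0 by (simp add: pos_divide_le_eq)
    then show ?thesis using m1 by (simp add: pos_divide_le_eq mult_ac)
  qed
  have q_2: "2 \<le> q" using q \<open>r > 1000\<close> by linarith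
  have ex: "\<exists>k. m \<le> q ^ k"
  proof
    have "m < 2 ^ m" by (rule less_exp)
    also have "(2::nat) ^ m \<le> q ^ m" using q_2 by (intro power_mono) auto
    finally show "m \<le> q ^ m" by simp
  qed
  define K where "K = (LEAST k. m \<le> q ^ k)"
  have K1: "m \<le> q ^ K" unfolding K_def using ex by (rule LeastI_ex)
  have K2: "q ^ k < m" if "k < K" for k using not_less_Least[of k "\<lambda>k. m \<le> q ^ k"] that by (auto simp: K_def)
  \<comment> \<open>Rounding at most halves \<open>r\<close>, and halving costs at most half of ln
    r, as ln r \<ge> 2 ln 2; moreover ln r is half of ln N.\<close>
  have lnq: "ln (real q) \<ge> ln (real N) / 4"
  proof -
    have "ln (real N) = 2 * ln r" using \<open>r > 1000\<close> by (simp add: r2[symmetric] ln_mult)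
    moreover have "ln (r / 2) = ln r - ln 2" using \<open>r > 1000\<close> by (simp add: ln_div)
    moreover have "ln r \<ge> 2 * ln 2"
    proof -
      have "2 * ln 2 = ln (2 * 2 :: real)" by (subst ln_mult) auto
      also have "\<dots> \<le> ln r" using \<open>r > 1000\<close> by (subst ln_le_cancel_iff) auto
      finally show ?thesis .
    qed
    moreover have "ln (r / 2) \<le> ln (real q)" using q_half \<open>r > 1000\<close> q_2 by (subst ln_le_cancel_iff) auto
    ultimately show ?thesis by linarith
  qed
  have logL: "log (real N) (real n) = L / ln (real N)" by (simp add: log_def L_def)
  have l1: "L / ln (real N) \<ge> 1" using NL lnN by (simp add: pos_le_divide_eq)
  have K5: "real K \<le> 5 * (L / ln (real N))"
  proof (cases K)
    case 0
    then show ?thesis using l1 by simp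
  next
    case (Suc k)
    have "q ^ k \<le> n" using K2[of k] Suc m3 by simp
    then have "real q ^ k \<le> real n" by (metis of_nat_le_iff of_nat_power)
    then have "ln (real q ^ k) \<le> L" unfolding L_def using q_2 n1000 by (subst ln_le_cancel_iff) auto
    then have "real k * ln (real q) \<le> L" using q_2 by (simp add: ln_realpow)
    moreover have "real k * (ln (real N) / 4) \<le> real k * ln (real q)" using lnq by (intro mult_left_mono) auto
    ultimately have "real k * ln (real N) \<le> 4 * L" by simp
    then have "real k \<le> 4 * L / ln (real N)" using lnN by (simp add: pos_le_divide_eq)
    then show ?thesis using Suc l1 by simp
  qed
  have "L / ln (real N) \<le> L / 1" using lnN L1 by (intro divide_left_mono) auto
  then have K5L: "real K \<le> 5 * L" using K5 by simp
  moreover have "868 * (\<gamma> * L) \<le> real q" using q868 by (simp only: mult.assoc)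
  ultimately have Kq: "K \<le> q" using \<gamma>L L1 by linarith
  show ?thesis
  proof (rule that[of q m K])
    show "q\<^sup>2 \<le> N" using q2 by (simp add: power2_eq_square flip: of_nat_mult)
    show "K \<le> q" by (rule Kq)
  qed (use n1000 N1000 L1 q_2 q868 m1 m3 m(1) ratio K1 K2 K5 K5L logL in \<open>auto simp: L_def\<close>)
qed

lemma card_peak_union_le:
  fixes n d N q m K :: nat and \<gamma> Q :: real
  assumes \<gamma>: "\<gamma> \<ge> 1" and Q: "Q = 6000 * \<gamma>" and n: "n \<ge> 24" and L1: "ln (real n) \<ge> 1"
    and q: "2 \<le> q" "q\<^sup>2 \<le> N" "868 * \<gamma> * ln (real n) \<le> real q"
    and m: "1 \<le> m" "3 * m \<le> n" "real m \<le> real n / (Q * ln (real n))"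
    and K: "\<And>k. k < K \<Longrightarrow> q ^ k < m" "K \<le> q" "real K \<le> 5 * ln (real n)"
    and N: "N \<le> d"
    and \<eta>: "\<eta> = real n powr (- 8 * \<gamma>)"
    and B: "\<And>i j. i < n \<Longrightarrow> j < n \<Longrightarrow> cmod (B i j) \<le> b" and \<Lambda>: "(real d + real n * b) * \<eta> \<le> 1/16"
    and f: "f = (\<lambda>k. min (q ^ k) m)"
  shows "real (card (\<Union>k<K. peak_event n d B \<eta> f k)) \<le> 10 * ln (real n) / real n * real (card (perm_tuples n d))"
proof -
  define L where "L = ln (real n)"
  let ?\<Omega> = "perm_tuples n d"
  have \<gamma>L: "L \<le> \<gamma> * L" using mult_right_mono[OF \<gamma>, of L] L1 by (simp add: L_def)
  have L1': "L \<ge> 1" using L1 by (simp add: L_def)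
  have each: "real (card (peak_event n d B \<eta> f k)) \<le> 2 * exp (- 36 * ln (real n)) * real (card ?\<Omega>)" if k: "k < K" for k
  proof -
    define m1 where "m1 = (if k = 0 then 0 else f (k - 1))"
    \<comment> \<open>The largest \<open>h\<close> that the bound for a fixed vector with
      \<open>f k\<close> large entries allows.\<close>
    define h where "h = min (f k * N div 4) (n div 12)"
    have f1: "f j \<ge> 1" for j using q m by (simp add: f)
    have fm: "f j \<le> m" for j by (simp add: f)
    have fSuc: "f (Suc k) \<le> q * f k"
    proof (cases "q ^ k \<le> m")
      case True
      then show ?thesis by (simp add: f)
    next
      case False
      then have "f (Suc k) \<le> m" "f k = m" by (auto simp: f)
      then show ?thesis using q(1) by (metis le_trans mult_le_mono1 nat_mult_1 one_le_numeral)
    qed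
    have m1f: "m1 \<le> f k"
    proof (cases k)
      case 0
      then show ?thesis by (simp add: m1_def)
    next
      case (Suc j)
      have "q ^ j \<le> q ^ k" using q(1) Suc by (intro power_increasing) auto
      moreover have "m1 = min (q ^ j) m" "f k = min (q ^ k) m" using Suc by (simp_all add: m1_def f)
      ultimately show ?thesis using min.mono by simp
    qed
    \<comment> \<open>A huge entry costs \<open>K\<close> times as much as a moderate one; there are
      fewer of them by a factor \<open>q\<close>, and \<open>K \<le> q\<close>.\<close>
    have Km1: "K * m1 \<le> m"
    proof (cases k)
      case 0
      then show ?thesis by (simp add: m1_def)
    next
      case (Suc j)
      have "m1 \<le> q ^ j" using Suc by (simp add: m1_def f)
      then have "K * m1 \<le> q * q ^ j" using K(2) by (intro mult_le_mono) auto
      also have "\<dots> = q ^ k" using Suc by simp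
      also have "\<dots> \<le> m" using K(1)[OF k] by simp
      finally show ?thesis .
    qed
    \<comment> \<open>Both summands are at most \<open>q * f k\<close>, which gives 216 = 2 * 108.
      The constant 868 is 4 * 216 plus 4, and the extra 4 absorbs the rounding in
      \<open>div 4\<close>.\<close>
    have e1: "108 * (\<gamma> * L * (real K * real m1 + real (f (Suc k)))) \<le> real (f k * N div 4)"
    proof -
      have "real K * real m1 + real (f (Suc k)) \<le> real q * real (f k) + real q * real (f k)"
        using m1f fSuc K(2) by (intro add_mono mult_mono) (auto simp flip: of_nat_mult)
      then have "\<gamma> * L * (real K * real m1 + real (f (Suc k))) \<le> \<gamma> * L * (2 * (real q * real (f k)))"
        using \<gamma> L1' by (intro mult_left_mono) auto
      also have "\<dots> = 2 * (\<gamma> * L * real q * real (f k))" by simp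
      finally have a: "108 * (\<gamma> * L * (real K * real m1 + real (f (Suc k)))) \<le> 216 * (\<gamma> * L * real q * real (f k))"
        using mult_left_mono[of _ _ "108::real"] by fastforce
      have "868 * (\<gamma> * L) * (real q * real (f k)) \<le> real q * (real q * real (f k))"
        using q(3) by (intro mult_right_mono) (auto simp: L_def mult.assoc)
      also have "\<dots> = real (q\<^sup>2) * real (f k)" by (simp add: power2_eq_square)
      also have "\<dots> \<le> real N * real (f k)" using q(2) by (intro mult_right_mono) auto
      finally have b: "868 * (\<gamma> * L * real q * real (f k)) \<le> real (f k * N)" by (simp add: mult_ac)
      have "1 * 1 * 1 * 1 \<le> \<gamma> * L * real q * real (f k)" using \<gamma> L1' q f1[of k] by (intro mult_mono) auto
      then have c: "1 \<le> \<gamma> * L * real q * real (f k)" by simp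
      have "real (f k * N) \<le> 4 * real (f k * N div 4) + 3"
      proof -
        have "f k * N \<le> 4 * (f k * N div 4) + 3" by presburger
        then show ?thesis by linarith
      qed
      then show ?thesis using a b c by linarith
    qed
    \<comment> \<open>With \<open>m\<close> at most n / (Q L) and Q = 6000 \<gamma>, the left side
      is at most 0.036 n, which is below \<open>n div 12\<close> once
      \<open>n \<ge> 24\<close>.\<close>
    have e2: "108 * (\<gamma> * L * (real K * real m1 + real (f (Suc k)))) \<le> real (n div 12)"
    proof -
      have "real K * real m1 + real (f (Suc k)) \<le> real m + real m"
        using Km1 fm[of "Suc k"] by (intro add_mono) (auto simp flip: of_nat_mult)
      also have "\<dots> \<le> 2 * (real n / (Q * L))" using m(3) by (simp add: L_def)
      finally have "\<gamma> * L * (real K * real m1 + real (f (Suc k))) \<le> \<gamma> * L * (2 * (real n / (Q * L)))"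
        using \<gamma> L1' by (intro mult_left_mono) auto
      also have "\<dots> = real n / 3000" using \<gamma> L1' by (simp add: Q field_simps)
      finally have a: "108 * (\<gamma> * L * (real K * real m1 + real (f (Suc k)))) \<le> 108 * (real n / 3000)"
        by (rule mult_left_mono) simp
      have "n \<le> 12 * (n div 12) + 11" by presburger
      then have "real n \<le> 12 * real (n div 12) + 11" by linarith
      then show ?thesis using a n by linarith
    qed
    show ?thesis
    proof (rule card_peak_event_le[OF _ \<gamma> \<eta> B \<Lambda> N k, where h = h])
      show "4 * h \<le> f k * N" "12 * h \<le> n" by (auto simp: h_def)
      show "(if k = 0 then 0 else f (k - 1)) + f k + f (Suc k) \<le> n"
        using fm[of k] fm[of "Suc k"] fm[of "k - 1"] m(2) by auto
      have "108 * (\<gamma> * L * (real K * real m1 + real (f (Suc k)))) \<le> real h" using e1 e2 by (simp add: h_def)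
      then show "108 * \<gamma> * ln (real n) * (real K * real (if k = 0 then 0 else f (k - 1)) + real (f (Suc k))) \<le> real h"
        unfolding m1_def L_def by (simp only: mult.assoc)
    qed (use n f1 in auto)
  qed
  have "card (\<Union>k<K. peak_event n d B \<eta> f k) \<le> (\<Sum>k<K. card (peak_event n d B \<eta> f k))"
    by (rule card_UN_le) simp
  then have "real (card (\<Union>k<K. peak_event n d B \<eta> f k)) \<le> (\<Sum>k<K. real (card (peak_event n d B \<eta> f k)))"
    by (simp flip: of_nat_sum)
  also have "\<dots> \<le> (\<Sum>k<K. 2 * exp (- 36 * ln (real n)) * real (card ?\<Omega>))"
    by (intro sum_mono each) simp
  also have "\<dots> = (real K * (2 * exp (- 36 * L))) * real (card ?\<Omega>)" by (simp add: L_def)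
  also have "\<dots> \<le> (10 * L / real n) * real (card ?\<Omega>)"
  proof (rule mult_right_mono)
    have "exp (- 36 * L) \<le> exp (- L)" using L1' by simp
    also have "exp (- L) = 1 / real n" using n by (simp add: L_def exp_minus divide_inverse)
    finally have "real K * (2 * exp (- 36 * L)) \<le> (5 * L) * (2 * (1 / real n))"
      using K(3) L1' by (intro mult_mono) (auto simp: L_def)
    then show "real K * (2 * exp (- 36 * L)) \<le> 10 * L / real n" by simp
  qed simp
  finally show ?thesis by (simp add: L_def)
qed

text \<open>With the largest admissible \<open>x\<close>, of order N m^2/n^2, the Littlewood-Offord
  bound is at most 4 (n/m) / sqrt N. This third factor n/m joins the two from averaging over pairs,
  hence the cube.\<close>

lemma card_spread_event_le_ratio:
  fixes n d N m :: nat and X :: real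
  assumes N: "N \<le> d" "1 \<le> N" and n: "n > 0" and m: "m \<ge> 1" and ratio: "real n / real m \<le> X"
    and t: "t \<ge> 0" and \<rho>: "\<rho> > 0" and small: "64 * real n * t < \<rho>\<^sup>2"
  shows "real (card (spread_event n d B t \<rho> m)) \<le> 24 * X ^ 3 / sqrt (real N) * real (card (perm_tuples n d))"
proof -
  define x where "x = N * m\<^sup>2 div (6 * n\<^sup>2)"
  have "6 * x * n\<^sup>2 \<le> N * m\<^sup>2"
    unfolding x_def by (metis div_times_less_eq_dividend mult.assoc mult.commute)
  then have le: "real (card (spread_event n d B t \<rho> m))
      \<le> 6 * (real n / real m)\<^sup>2 / sqrt (real x / 2 + 1) * real (card (perm_tuples n d))"
    using N n m by (intro card_spread_event_le[where d' = N] t \<rho> small) auto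
  have "N * m\<^sup>2 < (x + 1) * (6 * n\<^sup>2)"
    using dividend_less_times_div[of "6 * n\<^sup>2" "N * m\<^sup>2"] n by (simp add: x_def algebra_simps)
  then have "real (N * m\<^sup>2) < real ((x + 1) * (6 * n\<^sup>2))" using of_nat_less_iff by blast
  then have "real N * (real m)\<^sup>2 \<le> (real x + 1) * 6 * (real n)\<^sup>2" by (simp add: algebra_simps)
  also have "\<dots> \<le> (real x / 2 + 1) * 16 * (real n)\<^sup>2" by (intro mult_right_mono) auto
  finally have "real N * (real m)\<^sup>2 / (16 * (real n)\<^sup>2) \<le> real x / 2 + 1"
    using n by (subst pos_divide_le_eq) (simp_all only: mult.assoc, simp)
  then have "sqrt (real N * (real m)\<^sup>2 / (16 * (real n)\<^sup>2)) \<le> sqrt (real x / 2 + 1)" by (rule real_sqrt_le_mono)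
  moreover have "sqrt (real N * (real m)\<^sup>2 / (16 * (real n)\<^sup>2)) = sqrt (real N) / (4 * (real n / real m))"
    using n m by (simp add: real_sqrt_divide real_sqrt_mult)
  ultimately have s: "sqrt (real N) / (4 * (real n / real m)) \<le> sqrt (real x / 2 + 1)" by simp
  have nm: "real n / real m > 0" and sN: "sqrt (real N) > 0" using n m N by auto
  have "6 * (real n / real m)\<^sup>2 / sqrt (real x / 2 + 1) \<le> 6 * (real n / real m)\<^sup>2 / (sqrt (real N) / (4 * (real n / real m)))"
    using s nm sN n m by (intro divide_left_mono mult_pos_pos divide_pos_pos) auto
  also have "\<dots> = 24 * (real n / real m) ^ 3 / sqrt (real N)"
    using nm sN by (simp add: power2_eq_square power3_eq_cube mult_ac)
  also have "\<dots> \<le> 24 * X ^ 3 / sqrt (real N)"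
    using ratio nm sN by (intro divide_right_mono mult_left_mono power_mono) auto
  finally have "6 * (real n / real m)\<^sup>2 / sqrt (real x / 2 + 1) * real (card (perm_tuples n d))
      \<le> 24 * X ^ 3 / sqrt (real N) * real (card (perm_tuples n d))" by (intro mult_right_mono) auto
  then show ?thesis using le by linarith
qed

section \<open>Assembly of the bounds and the final constants\<close>

theorem theorem2p2:
  shows "\<exists>Cbar::real. \<forall>\<gamma>0::real. \<gamma>0 \<ge> 1 \<longrightarrow> (\<exists>C::real.
     \<forall>(n::nat) (d::nat) (Z::complex mat) (\<zeta>::complex).
       1 \<le> n \<longrightarrow> 1 \<le> d \<longrightarrow> real d \<le> real n powr \<gamma>0 \<longrightarrow>
       Z \<in> carrier_mat n n \<longrightarrow>
       norm_perp1 Z \<le> real n powr \<gamma>0 \<longrightarrow>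
       Z *\<^sub>v (ones_vec n) = \<zeta> \<cdot>\<^sub>v (ones_vec n) \<longrightarrow>
       mat_adjoint Z *\<^sub>v (ones_vec n) = cnj \<zeta> \<cdot>\<^sub>v (ones_vec n) \<longrightarrow>
       measure_pmf.prob (perm_tuple_pmf n d)
         {\<pi>. smallest_sv (S_mat n d \<pi> + Z) <
               min (real n powr (- Cbar * \<gamma>0 * log (real (min d n)) (real n)))
                   (cmod (of_nat d + \<zeta>))}
       \<le> C * (ln (real n)) ^ 4 / sqrt (real (min d n)))"
\<comment> \<open>With \<nu> = log_N n and K \<le> 5 \<nu>, the separation \<rho> = \<eta>^K / n is
  at least n^(-40 \<gamma> \<nu> - 1). The requirement 64 n t < \<rho>^2 follows from n^(3 - 100
  \<gamma> \<nu>) < n^(-80 \<gamma> \<nu> - 2), which holds as \<gamma> \<nu> \<ge> 1.\<close>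
proof (rule exI[of _ "100::real"], intro allI impI)
  fix \<gamma> :: real assume \<gamma>: "\<gamma> \<ge> 1"
  define Q where "Q = 6000 * \<gamma>"
  \<comment> \<open>20 collects the peak events of both sides, 10 each, and 192 = 24 * 2^3 comes
    from the spread event with n/m at most 2 Q ln n.\<close>
  define C where "C = 20 + 192 * Q ^ 3"
  show "\<exists>C::real.
     \<forall>(n::nat) (d::nat) (Z::complex mat) (\<zeta>::complex).
       1 \<le> n \<longrightarrow> 1 \<le> d \<longrightarrow> real d \<le> real n powr \<gamma> \<longrightarrow>
       Z \<in> carrier_mat n n \<longrightarrow>
       norm_perp1 Z \<le> real n powr \<gamma> \<longrightarrow>
       Z *\<^sub>v (ones_vec n) = \<zeta> \<cdot>\<^sub>v (ones_vec n) \<longrightarrow>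
       mat_adjoint Z *\<^sub>v (ones_vec n) = cnj \<zeta> \<cdot>\<^sub>v (ones_vec n) \<longrightarrow>
       measure_pmf.prob (perm_tuple_pmf n d)
         {\<pi>. smallest_sv (S_mat n d \<pi> + Z) <
               min (real n powr (- 100 * \<gamma> * log (real (min d n)) (real n)))
                   (cmod (of_nat d + \<zeta>))}
       \<le> C * (ln (real n)) ^ 4 / sqrt (real (min d n))"
  proof (intro exI[of _ C] allI impI)
    fix n d :: nat and Z :: "complex mat" and \<zeta> :: complex
    assume n1: "1 \<le> n" and d1: "1 \<le> d" and d: "real d \<le> real n powr \<gamma>"
      and Z: "Z \<in> carrier_mat n n" and norm: "norm_perp1 Z \<le> real n powr \<gamma>"
      and Z1: "Z *\<^sub>v (ones_vec n) = \<zeta> \<cdot>\<^sub>v (ones_vec n)"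
      and ZT1: "mat_adjoint Z *\<^sub>v (ones_vec n) = cnj \<zeta> \<cdot>\<^sub>v (ones_vec n)"
    define N where "N = min d n"
    define \<nu> where "\<nu> = log (real N) (real n)"
    define t where "t = real n powr (- 100 * \<gamma> * \<nu>)"
    define B where "B = centred n d Z \<zeta>"
    let ?\<Omega> = "perm_tuples n d"
    let ?A = "{\<pi>. smallest_sv (S_mat n d \<pi> + Z) < min t (cmod (of_nat d + \<zeta>))}"
    have n0: "n > 0" using n1 by simp
    have t0: "t > 0" using n0 by (simp add: t_def)
    have N1: "1 \<le> N" "N \<le> n" "N \<le> d" using n1 d1 by (auto simp: N_def)
    have \<Omega>pos: "real (card ?\<Omega>) > 0" using card_perm_tuples_pos by simp
    then have ne: "?\<Omega> \<noteq> {}" by auto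
    have prob: "measure_pmf.prob (perm_tuple_pmf n d) ?A = real (card (?\<Omega> \<inter> ?A)) / real (card ?\<Omega>)"
      unfolding perm_tuple_pmf_def by (rule measure_pmf_of_set[OF ne finite_perm_tuples])
    have pairs: "\<exists>u w. near_null n d B t \<pi> u \<and> left_near_null n d B t \<pi> w \<and>
        (\<forall>z. \<exists>i<n. cmod (u i - z) \<ge> 1 / real n) \<and> (\<forall>z. \<exists>i<n. cmod (w i - z) \<ge> 1 / real n)"
      if "\<pi> \<in> ?\<Omega> \<inter> ?A" for \<pi>
      unfolding B_def by (rule small_sv_imp_near_null_pair[OF n0 Z Z1 ZT1 _ t0]) (use that in auto)
    have sN: "sqrt (real N) > 0" using N1 by simp
    have "measure_pmf.prob (perm_tuple_pmf n d) ?A \<le> C * ln (real n) ^ 4 / sqrt (real N)"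
    proof (cases "C * ln (real n) ^ 4 \<ge> sqrt (real N)")
      case True
      then have "1 \<le> C * ln (real n) ^ 4 / sqrt (real N)" using sN by (simp add: pos_le_divide_eq)
      then show ?thesis using measure_pmf.prob_le_1 order_trans by blast
    next
      case False
      then have big: "C * ln (real n) ^ 4 < sqrt (real N)" by simp
      show ?thesis
      \<comment> \<open>Here the logarithm vanishes, so the probability must be exactly 0: a single
        entry cannot differ from the constant equal to it.\<close>
      proof (cases "n = 1")
        case True
        have "?\<Omega> \<inter> ?A = {}"
        proof (rule ccontr)
          assume "?\<Omega> \<inter> ?A \<noteq> {}"
          then obtain u where "\<And>z. \<exists>i<n. cmod (u i - z) \<ge> 1 / real n" using pairs by blast
          from this[of "u 0"] show False using True by auto
        qed
        then show ?thesis using prob True by simp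
      next
        case False
        then have n2: "n \<ge> 2" using n1 by simp
        obtain q m K where P: "n \<ge> 24" "ln (real n) \<ge> 1" "N \<ge> 3" "2 \<le> q" "q\<^sup>2 \<le> N"
          "868 * \<gamma> * ln (real n) \<le> real q" "1 \<le> m" "3 * m \<le> n" "real m \<le> real n / (Q * ln (real n))"
          "real n / real m \<le> 2 * Q * ln (real n)"
          "m \<le> q ^ K" "\<And>k. k < K \<Longrightarrow> q ^ k < m" "K \<le> q" "real K \<le> 5 * log (real N) (real n)" "real K \<le> 5 * ln (real n)"
          using scale_parameters[OF \<gamma> Q_def C_def n2 N1(1,2) big] by blast
        define \<eta> where "\<eta> = real n powr (- 8 * \<gamma>)"
        define f where "f = (\<lambda>k. min (q ^ k) m)"
        define L where "L = ln (real n)"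
        define b where "b = 2 * real n powr \<gamma>"
        have nr: "real n > 1" using P(1) by simp
        have fK: "f K = m" using P(11) by (simp add: f_def)
        have f0: "f 0 = 1" using P(7) by (simp add: f_def)
        have fb: "1 \<le> f k \<and> f k \<le> n" for k using P(4,7,8) by (auto simp: f_def)
        have Bb: "cmod (B i j) \<le> b" if "i < n" "j < n" for i j
        proof -
          have "real d / real n \<le> real d / 1" using n1 by (intro divide_left_mono) auto
          then show ?thesis
            using centred_entry_bound[OF n0 Z Z1 ZT1 that, of d] norm d unfolding B_def b_def by linarith
        qed
        have "real n powr (- 8 * \<gamma>) \<le> real n powr 0" using nr \<gamma> by (intro powr_mono) auto
        then have \<eta>01: "0 < \<eta>" "\<eta> \<le> 1" using nr by (auto simp: \<eta>_def)
        \<comment> \<open>The operator norm in the sup norm is at most 3 n^(1 + \<gamma>), so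
          rounding to precision n^(-8 \<gamma>) changes images by at most 3 / n^2.\<close>
        have \<Lambda>: "(real d + real n * b) * \<eta> \<le> 1/16"
        proof -
          have a: "real n powr \<gamma> \<le> real n powr (1 + \<gamma>)" using nr by (intro powr_mono) auto
          have "real n * b = 2 * real n powr (1 + \<gamma>)" using nr by (simp add: b_def powr_add)
          then have "real d + real n * b \<le> 3 * real n powr (1 + \<gamma>)" using d a by linarith
          then have "(real d + real n * b) * \<eta> \<le> 3 * real n powr (1 + \<gamma>) * real n powr (- 8 * \<gamma>)"
            unfolding \<eta>_def by (intro mult_right_mono) auto
          also have "\<dots> = 3 * real n powr (1 - 7 * \<gamma>)" by (simp add: mult.assoc flip: powr_add)
          also have "\<dots> \<le> 3 * real n powr (- 2)" using nr \<gamma> by (intro mult_left_mono powr_mono) auto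
          also have "\<dots> \<le> 1/16"
          proof -
            have "real n powr (- 2) = 1 / (real n * real n)" using nr by (simp add: powr_minus powr_numeral power2_eq_square divide_inverse)
            moreover have "real n * real n \<ge> 24 * 24" using P(1) by (intro mult_mono) auto
            then have "1 / (real n * real n) \<le> 1 / (24 * 24)" by (intro divide_left_mono) auto
            ultimately show ?thesis by simp
          qed
          finally show ?thesis .
        qed
        have \<nu>1: "\<nu> \<ge> 1" using P(3) N1 by (simp add: \<nu>_def)
        have \<gamma>\<nu>: "\<gamma> * \<nu> \<ge> 1" using mult_mono[OF \<gamma> \<nu>1] \<gamma> by simp
        have K\<nu>: "\<gamma> * real K \<le> 5 * (\<gamma> * \<nu>)" using mult_left_mono[OF P(14), of \<gamma>] \<gamma> by (simp add: \<nu>_def mult_ac)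
        have \<eta>K: "\<eta> ^ K = real n powr (- 8 * (\<gamma> * real K))"
          using nr by (simp add: \<eta>_def powr_realpow[symmetric] powr_powr mult_ac)
        define s where "s = 1 / real n"
        have s_powr: "s = real n powr (- 1)" using nr by (simp add: s_def powr_minus divide_inverse)
        have \<rho>_powr: "\<eta> ^ K * s = real n powr (- 8 * (\<gamma> * real K) - 1)"
          unfolding \<eta>K s_powr powr_add[symmetric] by simp
        have t1: "16 * t \<le> \<eta> ^ K * s"
        proof -
          have "16 * t \<le> real n powr 1 * real n powr (- 100 * (\<gamma> * \<nu>))"
            unfolding t_def using P(1) by (intro mult_mono) (auto simp: mult.assoc)
          also have "\<dots> = real n powr (1 - 100 * (\<gamma> * \<nu>))" unfolding powr_add[symmetric] by simp
          also have "\<dots> \<le> real n powr (- 8 * (\<gamma> * real K) - 1)"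
            using nr K\<nu> \<gamma>\<nu> by (intro powr_mono) auto
          finally show ?thesis unfolding \<rho>_powr .
        qed
        have t2: "64 * real n * t < (\<eta> ^ K * s)\<^sup>2"
        proof -
          have "64 * real n * t \<le> real n powr 2 * real n powr 1 * real n powr (- 100 * (\<gamma> * \<nu>))"
          proof (intro mult_mono)
            have "real n * real n \<ge> 24 * 24" using P(1) by (intro mult_mono) auto
            then show "64 \<le> real n powr 2" using nr by (simp add: powr_numeral power2_eq_square)
          qed (use nr in \<open>auto simp: t_def mult.assoc\<close>)
          also have "\<dots> = real n powr (3 - 100 * (\<gamma> * \<nu>))" unfolding powr_add[symmetric] by simp
          also have "\<dots> < real n powr (2 * (- 8 * (\<gamma> * real K) - 1))"
            using nr K\<nu> \<gamma>\<nu> by (intro powr_less_mono) auto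
          also have "\<dots> = (\<eta> ^ K * s)\<^sup>2"
            unfolding \<rho>_powr power2_eq_square powr_add[symmetric] by simp
          finally show ?thesis .
        qed
        let ?U1 = "\<Union>k<K. peak_event n d B \<eta> f k"
        let ?U2 = "\<Union>k<K. peak_event n d (\<lambda>i j. B j i) \<eta> f k"
        let ?V2 = "{\<pi>\<in>?\<Omega>. inv_tuple d \<pi> \<in> ?U2}"
        let ?W = "spread_event n d B t (\<eta> ^ K * s) (f K)"
        have s0: "s > 0" using nr by (simp add: s_def)
        have rows: "of_nat d + (\<Sum>j<n. B i j) = 0" if "i < n" for i
          unfolding B_def by (rule centred_row_sum[OF n0 Z Z1 ZT1 that])
        have cols: "of_nat d + (\<Sum>i<n. B i j) = 0" if "j < n" for j
          unfolding B_def by (rule centred_col_sum[OF n0 Z Z1 ZT1 that])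
        have sub: "?\<Omega> \<inter> ?A \<subseteq> ?U1 \<union> (?V2 \<union> ?W)"
        proof
          fix \<pi> assume p: "\<pi> \<in> ?\<Omega> \<inter> ?A"
          then have pi: "\<pi> \<in> ?\<Omega>" by blast
          obtain u w where uw: "near_null n d B t \<pi> u" "left_near_null n d B t \<pi> w"
            "\<And>z. \<exists>i<n. cmod (u i - z) \<ge> s" "\<And>z. \<exists>i<n. cmod (w i - z) \<ge> s"
            using pairs[OF p] unfolding s_def by blast
          have "\<pi> \<in> ?U1 \<or> inv_tuple d \<pi> \<in> ?U2 \<or> \<pi> \<in> ?W"
            by (rule near_null_pair_cases[where f = f and K = K and u = u and w = w])
               (use n0 f0 fb \<eta>01 pi rows cols uw s0 t1 in auto)
          then show "\<pi> \<in> ?U1 \<union> (?V2 \<union> ?W)" using pi by blast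
        qed
        have pe: "peak_event n d D \<eta> f k \<subseteq> ?\<Omega>" for D k by (auto simp: peak_event_def)
        have finU: "finite ?U1" "finite ?V2" "finite ?W"
          by (rule finite_subset[OF _ finite_perm_tuples[of n d]], use pe in \<open>auto simp: spread_event_def\<close>)+
        have "card (?\<Omega> \<inter> ?A) \<le> card (?U1 \<union> (?V2 \<union> ?W))" by (rule card_mono[OF _ sub]) (use finU in auto)
        also have "\<dots> \<le> card ?U1 + (card ?V2 + card ?W)"
          using card_Un_le[of ?U1 "?V2 \<union> ?W"] card_Un_le[of ?V2 ?W] by linarith
        also have "card ?V2 = card ?U2" by (rule card_inv_tuple_vimage) (use pe in blast)
        finally have "real (card (?\<Omega> \<inter> ?A)) \<le> real (card ?U1) + (real (card ?U2) + real (card ?W))" by linarith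
        also have "\<dots> \<le> 10 * L / real n * real (card ?\<Omega>) + (10 * L / real n * real (card ?\<Omega>)
            + 24 * (2 * Q * L) ^ 3 / sqrt (real N) * real (card ?\<Omega>))"
        proof (intro add_mono)
          show "real (card ?U1) \<le> 10 * L / real n * real (card ?\<Omega>)"
            unfolding L_def
            by (rule card_peak_union_le[OF \<gamma> Q_def P(1,2,4,5,6,7,8,9,12,13,15) N1(3) \<eta>_def Bb \<Lambda> f_def])
          show "real (card ?U2) \<le> 10 * L / real n * real (card ?\<Omega>)"
            unfolding L_def
            by (rule card_peak_union_le[OF \<gamma> Q_def P(1,2,4,5,6,7,8,9,12,13,15) N1(3) \<eta>_def Bb \<Lambda> f_def])
          show "real (card ?W) \<le> 24 * (2 * Q * L) ^ 3 / sqrt (real N) * real (card ?\<Omega>)"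
            unfolding L_def fK
            using card_spread_event_le_ratio[OF N1(3,1) n0 P(7,10) less_imp_le[OF t0] _ t2] \<eta>01 s0 by simp
        qed
        also have "\<dots> = (20 * L / real n + 192 * Q ^ 3 * L ^ 3 / sqrt (real N)) * real (card ?\<Omega>)"
          by (simp add: distrib_right power_mult_distrib)
        also have "\<dots> \<le> (C * L ^ 4 / sqrt (real N)) * real (card ?\<Omega>)"
        proof (rule mult_right_mono)
          have L1: "L \<ge> 1" using P(2) by (simp add: L_def)
          have "sqrt (real N) \<le> real n"
          proof -
            have "sqrt (real N) \<le> sqrt (real n * real n)"
              using N1 nr mult_mono[of 1 "real n" "real N" "real n"] by (intro real_sqrt_le_mono) auto
            then show ?thesis by simp
          qed
          then have "20 * L / real n \<le> 20 * L / sqrt (real N)" using sN L1 nr by (intro divide_left_mono mult_pos_pos) auto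
          also have "\<dots> \<le> 20 * L ^ 4 / sqrt (real N)"
            using L1 sN by (intro divide_right_mono mult_left_mono self_le_power) auto
          finally have 1: "20 * L / real n \<le> 20 * L ^ 4 / sqrt (real N)" .
          have "192 * Q ^ 3 * L ^ 3 / sqrt (real N) \<le> 192 * Q ^ 3 * L ^ 4 / sqrt (real N)"
            using L1 sN \<gamma> by (intro divide_right_mono mult_left_mono power_increasing) (auto simp: Q_def)
          then have "20 * L / real n + 192 * Q ^ 3 * L ^ 3 / sqrt (real N)
              \<le> 20 * L ^ 4 / sqrt (real N) + 192 * Q ^ 3 * L ^ 4 / sqrt (real N)" using 1 by (rule add_mono[rotated])
          then show "20 * L / real n + 192 * Q ^ 3 * L ^ 3 / sqrt (real N) \<le> C * L ^ 4 / sqrt (real N)"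
            by (simp add: C_def distrib_right add_divide_distrib)
        qed simp
        finally show ?thesis unfolding prob L_def using \<Omega>pos by (simp only: pos_divide_le_eq)
      qed
    qed
    then show "measure_pmf.prob (perm_tuple_pmf n d)
         {\<pi>. smallest_sv (S_mat n d \<pi> + Z) <
               min (real n powr (- 100 * \<gamma> * log (real (min d n)) (real n)))
                   (cmod (of_nat d + \<zeta>))}
       \<le> C * (ln (real n)) ^ 4 / sqrt (real (min d n))"
      unfolding t_def \<nu>_def N_def .
  qed
qed

end
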